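(* Let $\Omega\subset\mathbb{R}^{2}$ be a bounded domain. Then the Babuška–Aziz constant $C(\Omega)$ is finite if and only if the Friedrichs constant $\Gamma(\Omega)$ is finite, and $$C(\Omega)=\Gamma(\Omega)+1 .$$
   Context: A domain is a nonempty connected open set; no regularity of $\Omega$ is assumed. $L^2_\circ(\Omega)$ is the space of $q\in L^2(\Omega)$ with $\int_\Omega q\,d\mathbf{x}=0$; $\|\cdot\|_{0,\Omega}$ is the $L^2(\Omega)$ norm. $H^1_0(\Omega)$ is the closure of $C^\infty_0(\Omega)$ in $H^1(\Omega)$, and for $\mathbf{v}=(v_1,v_2)\in H^1_0(\Omega)^2$, $|\mathbf{v}|_{1,\Omega}=\big(\sum_{k,j=1}^{2}\|\partial_{x_j}v_k\|_{0,\Omega}^2\big)^{1/2}$. Babuška–Aziz constant: $C(\Omega)\in[0,\infty]$ is the smallest constant $C$ such that for every $q\in L^2_\circ(\Omega)$ there exists $\mathbf{u}\in H^1_0(\Omega)^2$ with $\operatorname{div}\mathbf{u}=q$ and $|\mathbf{u}|_{1,\Omega}^2\le C\,\|q\|_{0,\Omega}^2$ (with $C(\Omega)=\infty$ if no finite such constant exists). Friedrichs constant: identify $\mathbb{R}^2$ with $\mathbb{C}$ and let $\mathfrak{F}_\circ(\Omega)$ be the space of complex-valued holomorphic functions on $\Omega$ that are square integrable and of mean value zero on $\Omega$. $\Gamma(\Omega)\in[0,\infty]$ is the smallest constant $\Gamma$ such that $\|h\|_{0,\Omega}^2\le\Gamma\,\|g\|_{0,\Omega}^2$ for all $h+ig\in\mathfrak{F}_\circ(\Omega)$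 with $h,g$ real-valued (with $\Gamma(\Omega)=\infty$ if no finite such constant exists). *)

theory Defs
  imports "HOL-Complex_Analysis.Complex_Analysis"
begin

text \<open>
  The plane is identified with the complex numbers throughout: the coordinate directions
  \<open>x\<^sub>1\<close>, \<open>x\<^sub>2\<close> are the basis vectors \<open>1\<close>, \<open>\<i>\<close>. Elements of the function spaces are
  represented by functions on the whole space whose values outside \<open>\<Omega>\<close> are irrelevant, and
  equality in them is equality almost everywhere on \<open>\<Omega>\<close>.
\<close>

definition bounded_domain :: "'a::euclidean_space set \<Rightarrow> bool" where
  "bounded_domain \<Omega> \<longleftrightarrow> \<Omega> \<noteq> {} \<and> connected \<Omega> \<and> open \<Omega> \<and> bounded \<Omega>"

definition L2 :: "'a::euclidean_space set \<Rightarrow> ('a \<Rightarrow> real) set" where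
  "L2 \<Omega> = {q \<in> borel_measurable (lebesgue_on \<Omega>). integrable (lebesgue_on \<Omega>) (\<lambda>x. (q x)\<^sup>2)}"

definition L2_norm :: "'a::euclidean_space set \<Rightarrow> ('a \<Rightarrow> real) \<Rightarrow> real" where
  "L2_norm \<Omega> q = sqrt (LINT x|lebesgue_on \<Omega>. (q x)\<^sup>2)"

text \<open>For bounded \<open>\<Omega>\<close> the members of \<open>L2 \<Omega>\<close> are integrable, so the mean value below is genuine.\<close>

definition L2_mean_zero :: "'a::euclidean_space set \<Rightarrow> ('a \<Rightarrow> real) set" where
  "L2_mean_zero \<Omega> = {q \<in> L2 \<Omega>. (LINT x|lebesgue_on \<Omega>. q x) = 0}"

definition partial_deriv :: "'a::euclidean_space \<Rightarrow> ('a \<Rightarrow> real) \<Rightarrow> 'a \<Rightarrow> real" where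
  "partial_deriv b f x = frechet_derivative f (at x) b"

fun C_diff :: "nat \<Rightarrow> ('a::euclidean_space \<Rightarrow> real) \<Rightarrow> bool" where
  "C_diff 0 f \<longleftrightarrow> continuous_on UNIV f"
| "C_diff (Suc k) f \<longleftrightarrow> f differentiable_on UNIV \<and> (\<forall>b\<in>Basis. C_diff k (partial_deriv b f))"

text \<open>\<open>C\<^sub>0\<^sup>\<infinity>(\<Omega>)\<close>, each function being extended by zero to the whole space.\<close>

definition test_functions :: "'a::euclidean_space set \<Rightarrow> ('a \<Rightarrow> real) set" where
  "test_functions \<Omega> =
     {\<phi>. (\<forall>k. C_diff k \<phi>) \<and> compact (closure {x. \<phi> x \<noteq> 0}) \<and> closure {x. \<phi> x \<noteq> 0} \<subseteq> \<Omega>}"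

definition is_weak_deriv ::
    "'a::euclidean_space set \<Rightarrow> 'a \<Rightarrow> ('a \<Rightarrow> real) \<Rightarrow> ('a \<Rightarrow> real) \<Rightarrow> bool" where
  "is_weak_deriv \<Omega> b u w \<longleftrightarrow>
     (\<forall>\<phi>\<in>test_functions \<Omega>.
        (LINT x|lebesgue_on \<Omega>. u x * partial_deriv b \<phi> x) = - (LINT x|lebesgue_on \<Omega>. w x * \<phi> x))"

definition H1 :: "'a::euclidean_space set \<Rightarrow> ('a \<Rightarrow> real) set" where
  "H1 \<Omega> = {u \<in> L2 \<Omega>. \<forall>b\<in>Basis. \<exists>w\<in>L2 \<Omega>. is_weak_deriv \<Omega> b u w}"

text \<open>A representative of the weak derivative, which is unique up to null sets for \<open>u \<in> H1 \<Omega>\<close>.\<close>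

definition weak_deriv :: "'a::euclidean_space set \<Rightarrow> 'a \<Rightarrow> ('a \<Rightarrow> real) \<Rightarrow> 'a \<Rightarrow> real" where
  "weak_deriv \<Omega> b u = (SOME w. w \<in> L2 \<Omega> \<and> is_weak_deriv \<Omega> b u w)"

definition H1_norm :: "'a::euclidean_space set \<Rightarrow> ('a \<Rightarrow> real) \<Rightarrow> real" where
  "H1_norm \<Omega> u = sqrt ((L2_norm \<Omega> u)\<^sup>2 + (\<Sum>b\<in>Basis. (L2_norm \<Omega> (weak_deriv \<Omega> b u))\<^sup>2))"

definition H1_0 :: "'a::euclidean_space set \<Rightarrow> ('a \<Rightarrow> real) set" where
  "H1_0 \<Omega> = {u \<in> H1 \<Omega>. \<forall>\<epsilon>>0. \<exists>\<phi>\<in>test_functions \<Omega>. H1_norm \<Omega> (\<lambda>x. u x - \<phi> x) < \<epsilon>}"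

definition H1_seminorm :: "complex set \<Rightarrow> (complex \<Rightarrow> real) \<times> (complex \<Rightarrow> real) \<Rightarrow> real" where
  "H1_seminorm \<Omega> = (\<lambda>(v\<^sub>1, v\<^sub>2).
     sqrt (\<Sum>b\<in>Basis. (L2_norm \<Omega> (weak_deriv \<Omega> b v\<^sub>1))\<^sup>2 + (L2_norm \<Omega> (weak_deriv \<Omega> b v\<^sub>2))\<^sup>2))"

definition weak_div ::
    "complex set \<Rightarrow> (complex \<Rightarrow> real) \<times> (complex \<Rightarrow> real) \<Rightarrow> complex \<Rightarrow> real" where
  "weak_div \<Omega> = (\<lambda>(v\<^sub>1, v\<^sub>2) x. weak_deriv \<Omega> 1 v\<^sub>1 x + weak_deriv \<Omega> \<i> v\<^sub>2 x)"

text \<open>Smallest constants are infima in \<open>[0,\<infinity>]\<close>; the infimum of the empty set is \<open>\<infinity>\<close>.\<close>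

definition Babuska_Aziz_admissible :: "complex set \<Rightarrow> real \<Rightarrow> bool" where
  "Babuska_Aziz_admissible \<Omega> C \<longleftrightarrow>
     (\<forall>q\<in>L2_mean_zero \<Omega>. \<exists>u\<in>H1_0 \<Omega> \<times> H1_0 \<Omega>.
        (AE x in lebesgue_on \<Omega>. weak_div \<Omega> u x = q x) \<and>
        (H1_seminorm \<Omega> u)\<^sup>2 \<le> C * (L2_norm \<Omega> q)\<^sup>2)"

definition Babuska_Aziz_const :: "complex set \<Rightarrow> ennreal" where
  "Babuska_Aziz_const \<Omega> = Inf (ennreal ` {C. 0 \<le> C \<and> Babuska_Aziz_admissible \<Omega> C})"

definition Friedrichs_space :: "complex set \<Rightarrow> (complex \<Rightarrow> complex) set" where
  "Friedrichs_space \<Omega> =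
     {w. w holomorphic_on \<Omega> \<and> integrable (lebesgue_on \<Omega>) (\<lambda>z. (norm (w z))\<^sup>2) \<and>
         (LINT z|lebesgue_on \<Omega>. w z) = 0}"

definition Friedrichs_admissible :: "complex set \<Rightarrow> real \<Rightarrow> bool" where
  "Friedrichs_admissible \<Omega> \<Gamma> \<longleftrightarrow>
     (\<forall>w\<in>Friedrichs_space \<Omega>.
        (L2_norm \<Omega> (\<lambda>z. Re (w z)))\<^sup>2 \<le> \<Gamma> * (L2_norm \<Omega> (\<lambda>z. Im (w z)))\<^sup>2)"

definition Friedrichs_const :: "complex set \<Rightarrow> ennreal" where
  "Friedrichs_const \<Omega> = Inf (ennreal ` {\<Gamma>. 0 \<le> \<Gamma> \<and> Friedrichs_admissible \<Omega> \<Gamma>})"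

end

theory Submission
  imports Defs
begin

text \<open>
  For \<open>V = (v\<^sub>1, v\<^sub>2)\<close> with test function components put \<open>D V = div V + i curl V\<close>, a complex derivative of
  \<open>v\<^sub>1 + i v\<^sub>2\<close>. Then \<open>\<parallel>D V\<parallel> = |V|\<^sub>1\<close>, and by Weyl's lemma the orthogonal complement of the range of \<open>D\<close> in
  \<open>L\<^sup>2(\<Omega>; \<complex>)\<close>, regarded as a real Hilbert space, is the space of square integrable holomorphic functions.

  If \<open>h + i g\<close> is such a function with mean zero and \<open>div u = h\<close>, orthogonality gives
  \<open>\<parallel>h\<parallel>\<^sup>2 = - \<integral> g curl u\<close>, while \<open>\<parallel>curl u\<parallel>\<^sup>2 = |u|\<^sub>1\<^sup>2 - \<parallel>h\<parallel>\<^sup>2 \<le> (C - 1) \<parallel>h\<parallel>\<^sup>2\<close>; hence \<open>\<Gamma> \<le> C - 1\<close>.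

  Conversely, given \<open>q\<close>, let \<open>d + i c\<close> be the point of the closed range that minimises
  \<open>\<parallel>q - d\<parallel>\<^sup>2 + \<tau> \<parallel>c\<parallel>\<^sup>2\<close>. Then \<open>(q - d)/\<tau> - i c\<close> is holomorphic with mean zero and orthogonal to \<open>d + i c\<close>, so
  \<open>\<parallel>c\<parallel>\<^sup>2 = \<integral> d (q - d)/\<tau> \<le> \<surd>\<Gamma> \<parallel>c\<parallel> \<parallel>d\<parallel>\<close>, that is \<open>\<parallel>c\<parallel>\<^sup>2 \<le> \<Gamma> \<parallel>d\<parallel>\<^sup>2\<close>. The same estimate holds for
  differences of two such minimisers, and \<open>\<parallel>q - d\<parallel> \<le> \<tau> \<Gamma> \<parallel>q\<parallel>\<close>; hence they converge as \<open>\<tau> \<rightarrow> 0\<close>, and the limit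
  gives a solution of \<open>div u = q\<close> with \<open>|u|\<^sub>1\<^sup>2 \<le> (\<Gamma> + 1) \<parallel>q\<parallel>\<^sup>2\<close>.
\<close>

section \<open>Square integrable functions\<close>

text \<open>No regularity of the boundary is available, so solvability of div u = q cannot be
  presupposed. The penalised problem avoids the question: for each \<tau> > 0 a minimiser exists by
  orthogonal projection alone, and solvability emerges in the limit. Dividing the residual by \<tau>
  makes this limit accessible: the imaginary part of (q - d)/\<tau> - i c is -c, with no \<tau>
  left, so differences for two values of \<tau> satisfy the same relations. The rate comes from the
  chain \<parallel>(q - d)/\<tau>\<parallel> \<le> \<surd>\<Gamma> \<parallel>c\<parallel> \<le>
  \<Gamma> \<parallel>d\<parallel> \<le> \<Gamma> \<parallel>q\<parallel>. The isometry of D rests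
  on the vanishing integral of a Jacobian determinant. With the Poincare inequality it identifies
  the closure of the range, up to null sets, with the image of
  \<open>H1_0 \<Omega> \<times> H1_0 \<Omega>\<close>. The summand 1 in \<Gamma> + 1 is the share of
  div u in the squared seminorm. Mean value zero reflects the constants: they are holomorphic, hence
  orthogonal to the range, and a nonzero real constant violates the Friedrichs inequality for every
  \<Gamma>.\<close>

definition l2 :: "'a measure \<Rightarrow> ('a \<Rightarrow> 'b::euclidean_space) set" where
  "l2 M = {f \<in> borel_measurable M. integrable M (\<lambda>x. (norm (f x))\<^sup>2)}"

definition l2norm :: "'a measure \<Rightarrow> ('a \<Rightarrow> 'b::euclidean_space) \<Rightarrow> real" where
  "l2norm M f = sqrt (LINT x|M. (norm (f x))\<^sup>2)"

lemma l2D: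
  assumes "f \<in> l2 M"
  shows "f \<in> borel_measurable M" "integrable M (\<lambda>x. (norm (f x))\<^sup>2)"
  using assms by (auto simp: l2_def)

lemma l2norm_nonneg [simp]: "0 \<le> l2norm M f"
  by (simp add: l2norm_def)

lemma l2norm_power2: "(l2norm M f)\<^sup>2 = (LINT x|M. (norm (f x))\<^sup>2)"
  by (simp add: l2norm_def)

lemma l2norm_minus_commute: "l2norm M (\<lambda>x. f x - g x) = l2norm M (\<lambda>x. g x - f x)"
  by (simp add: l2norm_def norm_minus_commute)

lemma l2norm_cong_AE:
  assumes "f \<in> borel_measurable M" "g \<in> borel_measurable M" "AE x in M. f x = g x"
  shows "l2norm M f = l2norm M g"
proof -
  have "(LINT x|M. (norm (f x))\<^sup>2) = (LINT x|M. (norm (g x))\<^sup>2)"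
    using assms by (intro integral_cong_AE) auto
  then show ?thesis by (simp add: l2norm_def)
qed

lemma norm_add_power2_le: "(norm (a + b :: 'b::real_inner))\<^sup>2 \<le> 2 * (norm a)\<^sup>2 + 2 * (norm b)\<^sup>2"
proof -
  have "(norm (a + b))\<^sup>2 + (norm (a - b))\<^sup>2 = 2 * (norm a)\<^sup>2 + 2 * (norm b)\<^sup>2"
    by (simp add: power2_norm_eq_inner inner_simps inner_commute)
  then show ?thesis by (smt (verit) zero_le_power2)
qed

lemma l2_add:
  assumes "f \<in> l2 M" "g \<in> l2 M"
  shows "(\<lambda>x. f x + g x) \<in> l2 M"
proof -
  note [measurable] = assms[THEN l2D(1)]
  have "integrable M (\<lambda>x. 2 * (norm (f x))\<^sup>2 + 2 * (norm (g x))\<^sup>2)"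
    using assms[THEN l2D(2)] by auto
  then have "integrable M (\<lambda>x. (norm (f x + g x))\<^sup>2)"
    by (rule Bochner_Integration.integrable_bound) (auto simp: norm_add_power2_le)
  then show ?thesis by (simp add: l2_def)
qed

lemma l2_scaleR:
  assumes "f \<in> l2 M"
  shows "(\<lambda>x. c *\<^sub>R f x) \<in> l2 M"
  using assms by (auto simp: l2_def power_mult_distrib)

lemma l2_diff:
  assumes "f \<in> l2 M" "g \<in> l2 M"
  shows "(\<lambda>x. f x - g x) \<in> l2 M"
  using l2_add[OF assms(1) l2_scaleR[OF assms(2), of "-1"]] by simp

lemma l2_inner:
  assumes "f \<in> l2 M" "g \<in> l2 M"
  shows "integrable M (\<lambda>x. f x \<bullet> g x)"
proof -
  note [measurable] = assms[THEN l2D(1)]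
  have "integrable M (\<lambda>x. (norm (f x))\<^sup>2 + (norm (g x))\<^sup>2)"
    using assms[THEN l2D(2)] by auto
  moreover have le: "\<bar>f x \<bullet> g x\<bar> \<le> (norm (f x))\<^sup>2 + (norm (g x))\<^sup>2" for x
  proof -
    have "\<bar>f x \<bullet> g x\<bar> \<le> norm (f x) * norm (g x)" by (rule Cauchy_Schwarz_ineq2)
    also have "2 * (norm (f x) * norm (g x)) \<le> (norm (f x))\<^sup>2 + (norm (g x))\<^sup>2"
      using sum_squares_bound[of "norm (f x)" "norm (g x)"] by simp
    then have "norm (f x) * norm (g x) \<le> (norm (f x))\<^sup>2 + (norm (g x))\<^sup>2"
      by (smt (verit) mult_nonneg_nonneg norm_ge_zero)
    finally show ?thesis .
  qed
  ultimately show ?thesis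
    by (elim Bochner_Integration.integrable_bound) (auto simp: le)
qed

lemma l2_real_mult:
  fixes f g :: "'a \<Rightarrow> real"
  assumes "f \<in> l2 M" "g \<in> l2 M"
  shows "integrable M (\<lambda>x. f x * g x)"
  using l2_inner[OF assms] by simp

lemma l2norm_power2_add:
  assumes "f \<in> l2 M" "g \<in> l2 M"
  shows "(l2norm M (\<lambda>x. f x + t *\<^sub>R g x))\<^sup>2 =
    (l2norm M f)\<^sup>2 + 2 * t * (LINT x|M. f x \<bullet> g x) + t\<^sup>2 * (l2norm M g)\<^sup>2"
proof -
  have "(norm (f x + t *\<^sub>R g x))\<^sup>2 = (norm (f x))\<^sup>2 + 2 * t * (f x \<bullet> g x) + t\<^sup>2 * (norm (g x))\<^sup>2" for x
    by (simp add: power2_norm_eq_inner inner_simps inner_commute power2_eq_square[of t])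
  then show ?thesis
    using assms[THEN l2D(2)] l2_inner[OF assms]
    by (simp add: l2norm_power2)
qed

text \<open>The quadratic polynomial t \<mapsto> \<parallel>f + t g\<parallel>^2 is nonnegative. As
  \<open>l2norm\<close> is only a seminorm on functions, the leading coefficient may vanish for a
  nonzero \<open>g\<close>; then a nonzero linear term is refuted by a large t.\<close>

lemma l2_Cauchy_Schwarz:
  assumes "f \<in> l2 M" "g \<in> l2 M"
  shows "\<bar>LINT x|M. f x \<bullet> g x\<bar> \<le> l2norm M f * l2norm M g"
proof -
  let ?i = "LINT x|M. f x \<bullet> g x"
  have *: "0 \<le> (l2norm M f)\<^sup>2 + 2 * t * ?i + t\<^sup>2 * (l2norm M g)\<^sup>2" for t
    using l2norm_power2_add[OF assms, of t] by (metis zero_le_power2)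
  have "?i\<^sup>2 \<le> (l2norm M f * l2norm M g)\<^sup>2"
  proof (cases "l2norm M g = 0")
    case True
    have "?i = 0"
    proof (rule ccontr)
      assume "?i \<noteq> 0"
      \<comment> \<open>The chosen t turns the remaining linear expression into -1.\<close>
      then show False
        using *[of "- ((l2norm M f)\<^sup>2 + 1) / (2 * ?i)"] True by (simp add: field_simps)
    qed
    then show ?thesis by simp
  next
    case False
    then have pos: "(l2norm M g)\<^sup>2 > 0" by simp
    \<comment> \<open>This t is the vertex of the parabola.\<close>
    have "0 \<le> (l2norm M f)\<^sup>2 + 2 * (- ?i / (l2norm M g)\<^sup>2) * ?i + (- ?i / (l2norm M g)\<^sup>2)\<^sup>2 * (l2norm M g)\<^sup>2"
      by (rule *)
    also have "\<dots> = (l2norm M f)\<^sup>2 - ?i\<^sup>2 / (l2norm M g)\<^sup>2"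
      using False by (simp add: power2_eq_square divide_simps)
    finally have "0 \<le> (l2norm M f)\<^sup>2 - ?i\<^sup>2 / (l2norm M g)\<^sup>2" .
    then show ?thesis using pos by (simp add: field_simps power_mult_distrib)
  qed
  then show ?thesis
    by (metis abs_le_square_iff abs_mult abs_of_nonneg l2norm_nonneg)
qed

lemma l2norm_scaleR [simp]: "l2norm M (\<lambda>x. c *\<^sub>R f x) = \<bar>c\<bar> * l2norm M f"
  by (simp add: l2norm_def power_mult_distrib real_sqrt_mult)

lemma l2norm_triangle:
  assumes "f \<in> l2 M" "g \<in> l2 M"
  shows "l2norm M (\<lambda>x. f x + g x) \<le> l2norm M f + l2norm M g"
proof (rule power2_le_imp_le)
  show "(l2norm M (\<lambda>x. f x + g x))\<^sup>2 \<le> (l2norm M f + l2norm M g)\<^sup>2"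
    using l2norm_power2_add[OF assms, of 1] l2_Cauchy_Schwarz[OF assms]
    by (simp add: power2_sum)
qed simp

lemma l2norm_diff_triangle:
  assumes "f \<in> l2 M" "g \<in> l2 M" "h \<in> l2 M"
  shows "l2norm M (\<lambda>x. f x - h x) \<le> l2norm M (\<lambda>x. f x - g x) + l2norm M (\<lambda>x. g x - h x)"
  using l2norm_triangle[OF l2_diff[OF assms(1,2)] l2_diff[OF assms(2,3)]]
  by simp

lemma l2norm_reverse_triangle:
  assumes "f \<in> l2 M" "g \<in> l2 M"
  shows "\<bar>l2norm M f - l2norm M g\<bar> \<le> l2norm M (\<lambda>x. f x - g x)"
  using l2norm_triangle[OF l2_diff[OF assms(1,2)] assms(2)]
    l2norm_triangle[OF l2_diff[OF assms(2,1)] assms(1)] l2norm_minus_commute[of M f g]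
  by simp

text \<open>A subsequence whose increments \<open>d\<^sub>k\<close> satisfy \<open>\<parallel>d\<^sub>k\<parallel> \<le> 4\<^sup>-\<^sup>k\<close> has \<open>\<Sum> 4\<^sup>k |d\<^sub>k|\<^sup>2\<close> integrable, so it
  converges almost everywhere; Fatou's lemma then gives convergence in mean.\<close>

lemma l2_complete:
  fixes f :: "nat \<Rightarrow> 'a \<Rightarrow> 'b::euclidean_space"
  assumes f: "\<And>n. f n \<in> l2 M"
    and Cauchy: "\<And>e. e > 0 \<Longrightarrow> \<exists>N. \<forall>m\<ge>N. \<forall>n\<ge>N. l2norm M (\<lambda>x. f m x - f n x) < e"
  obtains g where "g \<in> l2 M" "(\<lambda>n. l2norm M (\<lambda>x. f n x - g x)) \<longlonglongrightarrow> 0"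
proof -
  have "\<forall>k. \<exists>N. \<forall>m\<ge>N. \<forall>n\<ge>N. l2norm M (\<lambda>x. f m x - f n x) < (1/4)^k"
    using Cauchy by simp
  then obtain N where N: "\<And>k m n. m \<ge> N k \<Longrightarrow> n \<ge> N k \<Longrightarrow> l2norm M (\<lambda>x. f m x - f n x) < (1/4)^k"
    by metis
  \<comment> \<open>The cumulative sum makes \<open>r\<close> monotone and at least
    \<open>N k\<close>; the summand \<open>k\<close> forces \<open>k \<le> r k\<close>, so the
    subsequence passes every threshold.\<close>
  define r where "r k = (\<Sum>i\<le>k. N i) + k" for k
  have rN: "r k \<ge> N k" for k unfolding r_def
    by (metis (no_types, lifting) atMost_iff finite_atMost le_refl member_le_sum trans_le_add1 zero_le)
  have rmono: "r k \<le> r (Suc k)" for k unfolding r_def by simp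
  have rge: "k \<le> r k" for k unfolding r_def by simp
  define d where "d k x = f (r (Suc k)) x - f (r k) x" for k x
  have d: "d k \<in> l2 M" for k
    unfolding d_def using l2_diff[OF f f] by simp
  note [measurable] = f[THEN l2D(1)] d[THEN l2D(1)]
  have dsmall: "(l2norm M (d k))\<^sup>2 \<le> (1/16)^k" for k
  proof -
    have "l2norm M (d k) < (1/4)^k"
      unfolding d_def using N[of k "r (Suc k)" "r k"] rN rmono order_trans by blast
    then have "(l2norm M (d k))\<^sup>2 \<le> ((1/4)^k)\<^sup>2" by (intro power_mono) auto
    also have "\<dots> = (1/16)^k" by (simp add: power2_eq_square flip: power_mult_distrib)
    finally show ?thesis .
  qed
  have ae: "AE x in M. summable (\<lambda>k. 4^k * (norm (d k x))\<^sup>2)"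
  proof -
    have "(\<integral>\<^sup>+x. (\<Sum>k. ennreal (4^k * (norm (d k x))\<^sup>2)) \<partial>M) = (\<Sum>k. \<integral>\<^sup>+x. ennreal (4^k * (norm (d k x))\<^sup>2) \<partial>M)"
      by (intro nn_integral_suminf) auto
    also have "\<dots> = (\<Sum>k. ennreal (4^k * (l2norm M (d k))\<^sup>2))"
      using d[THEN l2D(2)]
      by (intro suminf_cong, subst nn_integral_eq_integral) (auto simp: l2norm_power2)
    also have "\<dots> \<le> (\<Sum>k. ennreal ((1/4)^k))"
    proof (intro suminf_le ennreal_leI)
      fix k
      have "4^k * (l2norm M (d k))\<^sup>2 \<le> 4^k * (1/16)^k" using dsmall by (intro mult_left_mono) auto
      also have "\<dots> = (1/4)^k" by (simp flip: power_mult_distrib)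
      finally show "4^k * (l2norm M (d k))\<^sup>2 \<le> (1/4)^k" .
    qed auto
    also have "\<dots> < \<infinity>"
      by (subst suminf_ennreal2) (auto simp: summable_geometric)
    finally have fin: "(\<integral>\<^sup>+x. (\<Sum>k. ennreal (4^k * (norm (d k x))\<^sup>2)) \<partial>M) < \<infinity>" .
    then have "AE x in M. (\<Sum>k. ennreal (4^k * (norm (d k x))\<^sup>2)) \<noteq> \<infinity>"
      by (intro nn_integral_PInf_AE) auto
    then show ?thesis
      by eventually_elim (rule summable_suminf_not_top, auto)
  qed
  have "AE x in M. convergent (\<lambda>k. f (r k) x)"
    using ae
  proof eventually_elim
    case (elim x)
    then have "(\<lambda>k. 4^k * (norm (d k x))\<^sup>2) \<longlonglongrightarrow> 0" by (rule summable_LIMSEQ_zero)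
    then have "Bseq (\<lambda>k. 4^k * (norm (d k x))\<^sup>2)" by (intro convergent_imp_Bseq convergentI)
    then obtain B where B: "\<And>k. norm (4^k * (norm (d k x))\<^sup>2) \<le> B" by (auto simp: Bseq_def)
    \<comment> \<open>Boundedness of the terms of the convergent weighted series already yields a
      geometric majorant, since 4^k is the square of 2^k.\<close>
    have dle: "norm (d k x) \<le> sqrt B * (1/2)^k" for k
    proof (rule power2_le_imp_le)
      have "4^k * (norm (d k x))\<^sup>2 \<le> B" using B[of k] by simp
      moreover have "0 \<le> B" using B[of 0] by (meson norm_ge_zero order_trans)
      ultimately show "(norm (d k x))\<^sup>2 \<le> (sqrt B * (1/2)^k)\<^sup>2"
        using power_mult_distrib[of 2 "2::real" k]
        by (simp add: power_mult_distrib power_divide power2_eq_square[of "2^k"] field_simps)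
      show "0 \<le> sqrt B * (1/2)^k" using \<open>0 \<le> B\<close> by simp
    qed
    have "summable (\<lambda>k. sqrt B * (1/2)^k)" by (intro summable_mult summable_geometric) simp
    then have "summable (\<lambda>k. d k x)" by (rule summable_comparison_test'[OF _ dle])
    then have "convergent (\<lambda>n. \<Sum>k<n. d k x)" by (simp add: summable_iff_convergent)
    moreover have "(\<Sum>k<n. d k x) = f (r n) x - f (r 0) x" for n
      unfolding d_def by (rule sum_lessThan_telescope)
    ultimately have "convergent (\<lambda>n. (f (r n) x - f (r 0) x) + f (r 0) x)"
      by (intro convergent_add convergent_const) simp
    then show ?case by simp
  qed
  define g where "g x = lim (\<lambda>k. f (r k) x)" for x
  have gm[measurable]: "g \<in> borel_measurable M"
    unfolding g_def by (rule borel_measurable_lim_metric) auto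
  have lim: "AE x in M. (\<lambda>k. f (r k) x) \<longlonglongrightarrow> g x"
    using \<open>AE x in M. convergent (\<lambda>k. f (r k) x)\<close>
    by eventually_elim (simp add: g_def convergent_LIMSEQ_iff)
  \<comment> \<open>One Fatou estimate serves twice: it puts \<open>f n - g\<close>, hence
    \<open>g\<close>, into \<open>l2 M\<close>, and it carries the Cauchy bound over to the
    limit.\<close>
  have key: "integrable M (\<lambda>x. (norm (f n x - g x))\<^sup>2) \<and> (l2norm M (\<lambda>x. f n x - g x))\<^sup>2 \<le> e\<^sup>2"
    if e: "e > 0" and n: "\<And>m. m \<ge> K \<Longrightarrow> l2norm M (\<lambda>x. f n x - f m x) < e" for n e K
  proof -
    have "(\<integral>\<^sup>+x. ennreal ((norm (f n x - g x))\<^sup>2) \<partial>M) = (\<integral>\<^sup>+x. liminf (\<lambda>k. ennreal ((norm (f n x - f (r k) x))\<^sup>2)) \<partial>M)"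
    proof (rule nn_integral_cong_AE)
      show "AE x in M. ennreal ((norm (f n x - g x))\<^sup>2) = liminf (\<lambda>k. ennreal ((norm (f n x - f (r k) x))\<^sup>2))"
        using lim
      proof eventually_elim
        case (elim x)
        have "(\<lambda>k. ennreal ((norm (f n x - f (r k) x))\<^sup>2)) \<longlonglongrightarrow> ennreal ((norm (f n x - g x))\<^sup>2)"
          by (intro tendsto_intros elim)
        then show ?case by (intro lim_imp_Liminf[symmetric]) simp_all
      qed
    qed
    also have "\<dots> \<le> liminf (\<lambda>k. \<integral>\<^sup>+x. ennreal ((norm (f n x - f (r k) x))\<^sup>2) \<partial>M)"
      by (intro nn_integral_liminf) auto
    also have "\<dots> \<le> ennreal (e\<^sup>2)"
    proof (rule Liminf_le, simp)
      show "\<forall>\<^sub>F k in sequentially. (\<integral>\<^sup>+x. ennreal ((norm (f n x - f (r k) x))\<^sup>2) \<partial>M) \<le> ennreal (e\<^sup>2)"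
        using eventually_ge_at_top[of K]
      proof eventually_elim
        case (elim k)
        have "(l2norm M (\<lambda>x. f n x - f (r k) x))\<^sup>2 \<le> e\<^sup>2"
          using n[of "r k"] rge[of k] elim by (intro power_mono) auto
        then show ?case
          using l2D(2)[OF l2_diff[OF f[of n] f[of "r k"]]]
          by (subst nn_integral_eq_integral) (auto simp: l2norm_power2)
      qed
    qed
    finally have le: "(\<integral>\<^sup>+x. ennreal ((norm (f n x - g x))\<^sup>2) \<partial>M) \<le> ennreal (e\<^sup>2)" .
    then have int: "integrable M (\<lambda>x. (norm (f n x - g x))\<^sup>2)"
      by (intro integrableI_bounded) (auto simp: less_top[symmetric] top_unique)
    then have "(l2norm M (\<lambda>x. f n x - g x))\<^sup>2 \<le> e\<^sup>2"
      using le by (subst (asm) nn_integral_eq_integral) (auto simp: l2norm_power2)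
    with int show ?thesis by blast
  qed
  obtain K where K: "\<forall>m\<ge>K. \<forall>n\<ge>K. l2norm M (\<lambda>x. f m x - f n x) < 1" using Cauchy[of 1] by auto
  have "(\<lambda>x. f K x - g x) \<in> l2 M"
    using key[of 1 K K] K by (auto simp: l2_def)
  from l2_diff[OF f[of K] this] have "g \<in> l2 M" by simp
  moreover have "(\<lambda>n. l2norm M (\<lambda>x. f n x - g x)) \<longlonglongrightarrow> 0"
  proof (rule LIMSEQ_I)
    fix e :: real assume "e > 0"
    then obtain K where K: "\<forall>m\<ge>K. \<forall>n\<ge>K. l2norm M (\<lambda>x. f m x - f n x) < e/2"
      using Cauchy[of "e/2"] by auto
    have "l2norm M (\<lambda>x. f n x - g x) \<le> e/2" if "n \<ge> K" for n
      using key[of "e/2" K n] K that \<open>e > 0\<close> by (auto intro: power2_le_imp_le)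
    then show "\<exists>K. \<forall>n\<ge>K. norm (l2norm M (\<lambda>x. f n x - g x) - 0) < e"
      using \<open>e > 0\<close> by (intro exI[of _ K]) fastforce
  qed
  ultimately show ?thesis by (rule that)
qed

section \<open>Convergence in mean and orthogonal projection\<close>

lemma l2_tendsto_inner:
  assumes "\<And>n. f n \<in> l2 M" "g \<in> l2 M" "h \<in> l2 M"
    and "(\<lambda>n. l2norm M (\<lambda>x. f n x - g x)) \<longlonglongrightarrow> 0"
  shows "(\<lambda>n. LINT x|M. f n x \<bullet> h x) \<longlonglongrightarrow> (LINT x|M. g x \<bullet> h x)"
proof (rule LIM_zero_cancel, rule Lim_null_comparison)
  show "\<forall>\<^sub>F n in sequentially. norm ((LINT x|M. f n x \<bullet> h x) - (LINT x|M. g x \<bullet> h x))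
      \<le> l2norm M (\<lambda>x. f n x - g x) * l2norm M h"
  proof (intro always_eventually allI)
    fix n
    have "(LINT x|M. f n x \<bullet> h x) - (LINT x|M. g x \<bullet> h x) = (LINT x|M. (f n x - g x) \<bullet> h x)"
      using assms by (simp add: inner_diff_left l2_inner)
    then show "norm ((LINT x|M. f n x \<bullet> h x) - (LINT x|M. g x \<bullet> h x)) \<le> l2norm M (\<lambda>x. f n x - g x) * l2norm M h"
      using l2_Cauchy_Schwarz[OF l2_diff[OF assms(1)[of n] assms(2)] assms(3)] by simp
  qed
  show "(\<lambda>n. l2norm M (\<lambda>x. f n x - g x) * l2norm M h) \<longlonglongrightarrow> 0"
    using tendsto_mult_right[OF assms(4), of "l2norm M h"] by simp
qed

lemma l2_tendsto_norm:
  assumes "\<And>n. f n \<in> l2 M" "g \<in> l2 M"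
    and "(\<lambda>n. l2norm M (\<lambda>x. f n x - g x)) \<longlonglongrightarrow> 0"
  shows "(\<lambda>n. l2norm M (f n)) \<longlonglongrightarrow> l2norm M g"
proof (rule LIM_zero_cancel, rule Lim_null_comparison[OF _ assms(3)])
  show "\<forall>\<^sub>F n in sequentially. norm (l2norm M (f n) - l2norm M g) \<le> l2norm M (\<lambda>x. f n x - g x)"
    using l2norm_reverse_triangle[OF assms(1,2)] by simp
qed

lemma l2norm_triangle_diff:
  assumes "f \<in> l2 M" "g \<in> l2 M"
  shows "l2norm M (\<lambda>x. f x - g x) \<le> l2norm M f + l2norm M g"
  using l2norm_triangle[OF assms(1) l2_scaleR[OF assms(2), of "-1"]] l2norm_scaleR[of M "-1" g] by simp

lemma l2norm_eq_0:
  assumes "f \<in> l2 M" "l2norm M f = 0"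
  shows "AE x in M. f x = 0"
proof -
  have "(LINT x|M. (norm (f x))\<^sup>2) = 0" using assms(2) by (simp add: l2norm_def)
  then have "AE x in M. (norm (f x))\<^sup>2 = 0"
    using l2D(2)[OF assms(1)] by (subst (asm) integral_nonneg_eq_0_iff_AE) auto
  then show ?thesis by simp
qed

lemma l2_limit_unique:
  assumes "\<And>n. f n \<in> l2 M" "g \<in> l2 M" "h \<in> l2 M"
    and "(\<lambda>n. l2norm M (\<lambda>x. f n x - g x)) \<longlonglongrightarrow> 0" "(\<lambda>n. l2norm M (\<lambda>x. f n x - h x)) \<longlonglongrightarrow> 0"
  shows "AE x in M. g x = h x"
proof -
  have "l2norm M (\<lambda>x. g x - h x) \<le> l2norm M (\<lambda>x. f n x - g x) + l2norm M (\<lambda>x. f n x - h x)" for n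
    using l2norm_diff_triangle[OF assms(2) assms(1)[of n] assms(3)] l2norm_minus_commute[of M g] by simp
  then have "l2norm M (\<lambda>x. g x - h x) \<le> 0 + 0"
    by (intro LIMSEQ_le_const[OF tendsto_add[OF assms(4,5)]]) auto
  then have "l2norm M (\<lambda>x. g x - h x) = 0" using l2norm_nonneg[of M "\<lambda>x. g x - h x"] by linarith
  from l2norm_eq_0[OF l2_diff[OF assms(2,3)] this] show ?thesis by simp
qed

lemma l2_convergent_Cauchy:
  assumes "\<And>n. f n \<in> l2 M" "g \<in> l2 M"
    and "(\<lambda>n. l2norm M (\<lambda>x. f n x - g x)) \<longlonglongrightarrow> 0" "e > 0"
  shows "\<exists>N. \<forall>m\<ge>N. \<forall>n\<ge>N. l2norm M (\<lambda>x. f m x - f n x) < e"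
proof -
  obtain N where N: "\<And>n. n \<ge> N \<Longrightarrow> l2norm M (\<lambda>x. f n x - g x) < e / 2"
    using order_tendstoD(2)[OF assms(3) half_gt_zero[OF assms(4)]] by (auto simp: eventually_sequentially)
  have "l2norm M (\<lambda>x. f m x - f n x) < e" if "m \<ge> N" "n \<ge> N" for m n
    using l2norm_diff_triangle[OF assms(1)[of m] assms(2) assms(1)[of n]] N[OF that(1)] N[OF that(2)]
      l2norm_minus_commute[of M g "f n"] by linarith
  then show ?thesis by blast
qed

text \<open>\<open>S\<close> is a linear subspace that need not be closed, so the projection
  \<open>p\<close> is delivered together with a sequence from \<open>S\<close> that tends to it. The
  parallelogram identity makes a minimising sequence Cauchy; orthogonality is the vanishing of the
  first variation.\<close>

lemma l2_projection:
  fixes f :: "'a \<Rightarrow> 'b::euclidean_space"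
  assumes f: "f \<in> l2 M" and S: "S \<subseteq> l2 M" "S \<noteq> {}"
    and add: "\<And>s t c. s \<in> S \<Longrightarrow> t \<in> S \<Longrightarrow> (\<lambda>x. s x + c *\<^sub>R t x) \<in> S"
  obtains p s where "p \<in> l2 M" "\<And>n. s n \<in> S" "(\<lambda>n::nat. l2norm M (\<lambda>x. s n x - p x)) \<longlonglongrightarrow> 0"
    "\<And>t. t \<in> S \<Longrightarrow> (LINT x|M. (f x - p x) \<bullet> t x) = 0"
proof -
  define D where "D = (\<lambda>s. (l2norm M (\<lambda>x. f x - s x))\<^sup>2) ` S"
  define d where "d = Inf D"
  have bdd: "bdd_below D" unfolding D_def by (rule bdd_belowI2[of _ 0]) simp
  have dle: "d \<le> (l2norm M (\<lambda>x. f x - s x))\<^sup>2" if "s \<in> S" for s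
    unfolding d_def using bdd that by (auto simp: D_def intro!: cInf_lower)
  have "\<exists>s\<in>S. (l2norm M (\<lambda>x. f x - s x))\<^sup>2 < d + 1 / real (Suc n)" for n
  proof -
    have "D \<noteq> {}" "Inf D < d + 1 / real (Suc n)" using S by (auto simp: D_def d_def)
    from cInf_lessD[OF this] show ?thesis by (auto simp: D_def)
  qed
  then obtain s where sS: "\<And>n. s n \<in> S"
    and s: "\<And>n. (l2norm M (\<lambda>x. f x - s n x))\<^sup>2 < d + 1 / real (Suc n)" by metis
  have sq: "s n \<in> l2 M" for n using sS S by auto
  have par: "(l2norm M (\<lambda>x. s m x - s n x))\<^sup>2 \<le> 2 / real (Suc m) + 2 / real (Suc n)" for m n
  proof -
    \<comment> \<open>The midpoint of \<open>s m\<close> and \<open>s n\<close>, spelled with the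
      only closure operation assumed for \<open>S\<close>.\<close>
    have mid: "(\<lambda>x. s m x + (1/2) *\<^sub>R (s n x + (-1) *\<^sub>R s m x)) \<in> S"
      by (intro add sS)
    have "4 * (l2norm M (\<lambda>x. f x - (s m x + (1/2) *\<^sub>R (s n x + (-1) *\<^sub>R s m x))))\<^sup>2 + (l2norm M (\<lambda>x. s m x - s n x))\<^sup>2
       = 2 * (l2norm M (\<lambda>x. f x - s m x))\<^sup>2 + 2 * (l2norm M (\<lambda>x. f x - s n x))\<^sup>2"
    proof -
      have e: "4 * (norm (f x - (s m x + (1/2) *\<^sub>R (s n x + (-1) *\<^sub>R s m x))))\<^sup>2 + (norm (s m x - s n x))\<^sup>2
         = 2 * (norm (f x - s m x))\<^sup>2 + 2 * (norm (f x - s n x))\<^sup>2" for x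
        by (simp add: power2_norm_eq_inner inner_simps inner_commute field_simps)
      have i: "integrable M (\<lambda>x. (norm (f x - (s m x + (1/2) *\<^sub>R (s n x + (-1) *\<^sub>R s m x))))\<^sup>2)"
        "integrable M (\<lambda>x. (norm (s m x - s n x))\<^sup>2)" "integrable M (\<lambda>x. (norm (f x - s k x))\<^sup>2)" for k
        using S mid f by (auto intro!: l2D(2) l2_diff sq)
      show ?thesis
        unfolding l2norm_power2 integral_mult_right_zero[symmetric]
        using i by (simp only: e Bochner_Integration.integral_add[symmetric] integrable_mult_right)
    qed
    moreover have "2 / real (Suc m) = 2 * (1 / real (Suc m))" "2 / real (Suc n) = 2 * (1 / real (Suc n))"
      by simp_all
    ultimately show ?thesis using dle[OF mid] s[of m] s[of n] by linarith
  qed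
  have Cauchy: "\<exists>N. \<forall>m\<ge>N. \<forall>n\<ge>N. l2norm M (\<lambda>x. s m x - s n x) < e" if "e > 0" for e
  proof -
    obtain N where N: "4 / e\<^sup>2 < real N" using reals_Archimedean2 by blast
    have "l2norm M (\<lambda>x. s m x - s n x) < e" if "m \<ge> N" "n \<ge> N" for m n
    proof (rule power2_less_imp_less)
      have "0 < real N" using N \<open>e > 0\<close> by (smt (verit) divide_pos_pos zero_less_power)
      have "2 / real (Suc m) \<le> 2 / real N" "2 / real (Suc n) \<le> 2 / real N"
        using that \<open>0 < real N\<close> by (intro divide_left_mono; simp)+
      moreover have "4 / real N < e\<^sup>2" using N \<open>e > 0\<close> \<open>0 < real N\<close> by (simp add: field_simps)
      ultimately show "(l2norm M (\<lambda>x. s m x - s n x))\<^sup>2 < e\<^sup>2" using par[of m n] by simp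
    qed (use \<open>e > 0\<close> in simp)
    then show ?thesis by blast
  qed
  obtain p where p: "p \<in> l2 M" "(\<lambda>n. l2norm M (\<lambda>x. s n x - p x)) \<longlonglongrightarrow> 0"
    using l2_complete[OF sq Cauchy] by blast
  have "(LINT x|M. (f x - p x) \<bullet> t x) = 0" if t: "t \<in> S" for t
  proof -
    have tq: "t \<in> l2 M" using t S by auto
    let ?i = "LINT x|M. (f x - p x) \<bullet> t x"
    have fp: "(\<lambda>x. f x - p x) \<in> l2 M" using f p by (intro l2_diff)
    have fs: "(\<lambda>x. f x - s n x) \<in> l2 M" for n using f sq by (intro l2_diff)
    have l: "(\<lambda>n. l2norm M (\<lambda>x. (f x - s n x) - (f x - p x))) \<longlonglongrightarrow> 0"
      using p(2) by (simp add: l2norm_minus_commute[of M "s _" p])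
    \<comment> \<open>The competitor \<open>s n - c t\<close> is compared with the infimum
      \<open>d\<close>; in the limit both sides contain \<open>d\<close>, and only the variation
      remains.\<close>
    have le: "0 \<le> 2 * c * ?i + c\<^sup>2 * (l2norm M t)\<^sup>2" for c
    proof -
      have *: "d \<le> (l2norm M (\<lambda>x. f x - s n x))\<^sup>2 + 2 * c * (LINT x|M. (f x - s n x) \<bullet> t x) + c\<^sup>2 * (l2norm M t)\<^sup>2" for n
        using dle[OF add[OF sS[of n] t, of "-c"]] l2norm_power2_add[OF fs[of n] tq, of c]
        by (simp add: algebra_simps)
      have "(\<lambda>n. d + 1 / real (Suc n) + 2 * c * (LINT x|M. (f x - s n x) \<bullet> t x) + c\<^sup>2 * (l2norm M t)\<^sup>2) \<longlonglongrightarrow>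
          d + 0 + 2 * c * ?i + c\<^sup>2 * (l2norm M t)\<^sup>2"
        by (intro tendsto_intros l2_tendsto_inner[OF fs fp tq l] LIMSEQ_Suc[OF lim_1_over_n])
      moreover have "d \<le> d + 1 / real (Suc n) + 2 * c * (LINT x|M. (f x - s n x) \<bullet> t x) + c\<^sup>2 * (l2norm M t)\<^sup>2" for n
        using *[of n] s[of n] by linarith
      ultimately have "d \<le> d + 0 + 2 * c * ?i + c\<^sup>2 * (l2norm M t)\<^sup>2"
        by (intro LIMSEQ_le_const) auto
      then show ?thesis by simp
    qed
    show ?thesis
    proof (rule ccontr)
      assume i: "?i \<noteq> 0"
      \<comment> \<open>The added 1 keeps \<open>T\<close> positive when \<open>t\<close> has norm
        zero. With c = -i/T the variation would be at most -i^2/T < 0.\<close>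
      define T where "T = (l2norm M t)\<^sup>2 + 1"
      have T: "T > 0" by (simp add: T_def add_nonneg_pos)
      have "0 \<le> 2 * (- ?i / T) * ?i + (- ?i / T)\<^sup>2 * T"
        using le[of "- ?i / T"] by (simp add: T_def distrib_left) (smt (verit) zero_le_power2)
      also have "\<dots> = - ?i\<^sup>2 / T" using T by (simp add: power2_eq_square field_simps)
      finally show False using i T by (simp add: field_simps)
    qed
  qed
  with p sS that show ?thesis by blast
qed

section \<open>Smooth cutoff functions\<close>

lemma partial_deriv_eq: "(f has_derivative f') (at x) \<Longrightarrow> partial_deriv b f x = f' b"
  by (metis frechet_derivative_at partial_deriv_def)

lemma C_diff_Suc_has_derivative:
  "C_diff (Suc k) f \<Longrightarrow> (f has_derivative frechet_derivative f (at x)) (at x)"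
  by (simp add: frechet_derivative_works[symmetric] differentiable_on_eq_differentiable_at)

text \<open>The smoothness results below for sums, products, inverses and composites are inductions
  on the order through this rule: exhibit a derivative, then treat its coordinate directions by the
  induction hypothesis.\<close>

lemma C_diff_SucI:
  assumes "\<And>x. (f has_derivative f' x) (at x)" "\<And>b. b \<in> Basis \<Longrightarrow> C_diff k (\<lambda>x. f' x b)"
  shows "C_diff (Suc k) f"
proof -
  have "partial_deriv b f = (\<lambda>x. f' x b)" for b
    using partial_deriv_eq[OF assms(1)] by auto
  moreover have "f differentiable_on UNIV"
    using assms(1) by (auto simp: differentiable_on_def differentiable_def)
  ultimately show ?thesis using assms(2) by simp
qed

lemma C_diff_SucD: "C_diff (Suc k) f \<Longrightarrow> C_diff k f"
proof (induction k arbitrary: f)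
  case 0
  then show ?case by (simp add: differentiable_imp_continuous_on)
next
  case (Suc k)
  then show ?case by (metis C_diff.simps(2))
qed

lemma C_diff_partial: "C_diff (Suc k) f \<Longrightarrow> b \<in> Basis \<Longrightarrow> C_diff k (\<lambda>x. frechet_derivative f (at x) b)"
  by (simp add: partial_deriv_def[abs_def])

lemma C_diff_const: "C_diff k (\<lambda>x. c)"
proof (induction k arbitrary: c)
  case (Suc k)
  then show ?case by (intro C_diff_SucI[where f' = "\<lambda>x h. 0"]) auto
qed simp

lemma C_diff_bounded_linear:
  assumes "bounded_linear f" shows "C_diff k f"
proof (cases k)
  case 0
  then show ?thesis using assms by (simp add: linear_continuous_on)
next
  case (Suc n)
  then show ?thesis
    using C_diff_SucI[of f "\<lambda>x. f" n] C_diff_const assms by (auto simp: bounded_linear_imp_has_derivative)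
qed

lemma C_diff_add: "C_diff k f \<Longrightarrow> C_diff k g \<Longrightarrow> C_diff k (\<lambda>x. f x + g x)"
proof (induction k arbitrary: f g)
  case 0
  then show ?case by (simp add: continuous_on_add)
next
  case (Suc k)
  show ?case
    by (rule C_diff_SucI[OF has_derivative_add[OF Suc.prems[THEN C_diff_Suc_has_derivative]]])
      (intro Suc.IH Suc.prems[THEN C_diff_partial])
qed

lemma C_diff_mult: "C_diff k f \<Longrightarrow> C_diff k g \<Longrightarrow> C_diff k (\<lambda>x. f x * g x)"
proof (induction k arbitrary: f g)
  case 0
  then show ?case by (simp add: continuous_on_mult)
next
  case (Suc k)
  show ?case
    by (rule C_diff_SucI[OF has_derivative_mult[OF Suc.prems[THEN C_diff_Suc_has_derivative]]])
      (intro C_diff_add Suc.IH Suc.prems[THEN C_diff_partial] Suc.prems[THEN C_diff_SucD])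
qed

lemma C_diff_diff: "C_diff k f \<Longrightarrow> C_diff k g \<Longrightarrow> C_diff k (\<lambda>x. f x - g x)"
  using C_diff_add[of k f "\<lambda>x. (-1) * g x"] C_diff_mult[OF C_diff_const[of k "-1"], of g] by simp

lemma C_diff_inverse: "C_diff k f \<Longrightarrow> (\<And>x. f x \<noteq> 0) \<Longrightarrow> C_diff k (\<lambda>x. inverse (f x))"
proof (induction k arbitrary: f)
  case 0
  then show ?case by (simp add: continuous_on_inverse)
next
  case (Suc k)
  have "((\<lambda>x. inverse (f x)) has_derivative
      (\<lambda>h. (-1) * (inverse (f x) * frechet_derivative f (at x) h * inverse (f x)))) (at x)" for x
    using Deriv.has_derivative_inverse[OF Suc.prems(2) C_diff_Suc_has_derivative[OF Suc.prems(1)]] by simp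
  then show ?case
    by (rule C_diff_SucI)
      (intro C_diff_mult C_diff_const Suc.IH C_diff_SucD[OF Suc.prems(1)] C_diff_partial[OF Suc.prems(1)] Suc.prems(2))
qed

text \<open>Linearity on the line brings the chain rule into the form of a product, to which
  \<open>C_diff_mult\<close> applies.\<close>

lemma frechet_derivative_real_mult:
  fixes g :: "real \<Rightarrow> real"
  assumes "C_diff (Suc k) g"
  shows "frechet_derivative g (at y) h = frechet_derivative g (at y) 1 * h"
  using linear_cmul[OF has_derivative_linear[OF C_diff_Suc_has_derivative[OF assms]], of y h 1] by simp

lemma C_diff_compose:
  fixes g :: "real \<Rightarrow> real"
  shows "C_diff k g \<Longrightarrow> C_diff k f \<Longrightarrow> C_diff k (\<lambda>x. g (f x))"
proof (induction k arbitrary: f g)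
  case 0
  then show ?case by (auto intro: continuous_on_compose2[of UNIV g UNIV f])
next
  case (Suc k)
  have "((\<lambda>x. g (f x)) has_derivative
      (\<lambda>h. frechet_derivative g (at (f x)) 1 * frechet_derivative f (at x) h)) (at x)" for x
    using has_derivative_compose[OF C_diff_Suc_has_derivative[OF Suc.prems(2)] C_diff_Suc_has_derivative[OF Suc.prems(1)], of x]
    by (subst (asm) frechet_derivative_real_mult[OF Suc.prems(1)])
  then show ?case
    by (rule C_diff_SucI)
      (intro C_diff_mult Suc.IH[where g = "\<lambda>y. frechet_derivative g (at y) 1"] C_diff_SucD[OF Suc.prems(2)]
        C_diff_partial[OF Suc.prems(1)] C_diff_partial[OF Suc.prems(2)]; simp)
qed

section \<open>Smooth steps built from exp(-1/x)\<close>

definition flat :: "real poly \<Rightarrow> real \<Rightarrow> real" where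
  "flat p x = (if x > 0 then poly p (1/x) * exp (- 1/x) else 0)"

lemma tendsto_poly_exp_0: "((\<lambda>y. poly p y * exp (- y :: real)) \<longlongrightarrow> 0) at_top"
proof -
  have "((\<lambda>y. \<Sum>i\<le>degree p. coeff p i * (y ^ i / exp y)) \<longlongrightarrow> (\<Sum>i\<le>degree p. coeff p i * 0)) at_top"
    by (intro tendsto_intros tendsto_power_div_exp_0)
  moreover have "poly p y * exp (- y) = (\<Sum>i\<le>degree p. coeff p i * (y ^ i / exp y))" for y
    by (simp add: poly_altdef exp_minus sum_distrib_right divide_inverse mult.assoc)
  ultimately show ?thesis by simp
qed

text \<open>In the variable y = 1/x the derivative is y^2 (p(y) - p'(y)) e^(-y); the two
  \<open>pCons 0\<close> are the factor y^2. The family \<open>flat\<close> is thus closed under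
  differentiation, which is why the polynomial is a parameter.\<close>

lemma flat_has_derivative: "(flat p has_real_derivative flat (pCons 0 (pCons 0 (p - pderiv p))) x) (at x)"
proof -
  consider "x > 0" | "x < 0" | "x = 0" by linarith
  then show ?thesis
  proof cases
    case 1
    have "((\<lambda>x. poly p (1/x) * exp (- 1/x)) has_real_derivative
       flat (pCons 0 (pCons 0 (p - pderiv p))) x) (at x)"
      using 1 by (auto intro!: derivative_eq_intros simp: flat_def field_simps power2_eq_square)
    then show ?thesis
      by (rule has_field_derivative_transform_within_open[where S = "{0<..}"]) (use 1 in \<open>auto simp: flat_def\<close>)
  next
    case 2
    have "((\<lambda>x. 0) has_real_derivative flat (pCons 0 (pCons 0 (p - pderiv p))) x) (at x)"
      using 2 by (simp add: flat_def)
    then show ?thesis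
      by (rule has_field_derivative_transform_within_open[where S = "{..<0}"]) (use 2 in \<open>auto simp: flat_def\<close>)
  next
    case 3
    have "((\<lambda>h. flat p h / h) \<longlongrightarrow> 0) (at_right 0)"
    proof -
      \<comment> \<open>With y = 1/h the difference quotient at 0 is y p(y) e^(-y), the same kind of
        expression with the polynomial \<open>pCons 0 p\<close>.\<close>
      have "((\<lambda>h. poly (pCons 0 p) (inverse h) * exp (- inverse h :: real)) \<longlongrightarrow> 0) (at_right 0)"
        by (rule filterlim_compose[OF tendsto_poly_exp_0 filterlim_inverse_at_top_right])
      then show ?thesis
        by (rule Lim_transform_eventually)
          (auto simp: eventually_at_filter flat_def field_simps)
    qed
    moreover have "((\<lambda>h. flat p h / h) \<longlongrightarrow> 0) (at_left 0)"
      by (rule Lim_transform_eventually[OF tendsto_const]) (auto simp: eventually_at_filter flat_def)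
    ultimately have "((\<lambda>h. flat p h / h) \<longlongrightarrow> 0) (at 0)"
      by (simp add: filterlim_split_at)
    then show ?thesis using 3 by (simp add: DERIV_def flat_def)
  qed
qed

lemma C_diff_flat: "C_diff k (flat p)"
proof (induction k arbitrary: p)
  case 0
  show ?case
    using DERIV_continuous_on[of UNIV "flat p"] flat_has_derivative[of p] by auto
next
  case (Suc k)
  show ?case
    by (rule C_diff_SucI[OF flat_has_derivative[unfolded has_field_derivative_def]])
      (use Suc in simp)
qed

text \<open>The usual smooth transition from 0 (for s \<le> 1) to 1 (for s \<ge> 2). The denominator
  is positive because s - 1 and 2 - s are never both nonpositive.\<close>

definition step :: "real \<Rightarrow> real" where
  "step s = flat 1 (s - 1) * inverse (flat 1 (s - 1) + flat 1 (2 - s))"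

lemma flat_1_pos: "x > 0 \<Longrightarrow> flat 1 x > 0" and flat_1_nonneg: "flat 1 x \<ge> 0"
  by (auto simp: flat_def)

lemma step_denominator_pos: "flat 1 (s - 1) + flat 1 (2 - s) > 0"
  using flat_1_pos[of "s - 1"] flat_1_pos[of "2 - s"] flat_1_nonneg[of "s - 1"] flat_1_nonneg[of "2 - s"]
  by (cases "s > 1") auto

lemma flat_1_mono: "x \<le> y \<Longrightarrow> flat 1 x \<le> flat 1 y"
  by (auto simp: flat_def field_simps)

lemma step_mono: "s \<le> t \<Longrightarrow> step s \<le> step t"
proof -
  assume "s \<le> t"
  \<comment> \<open>This is the claim after clearing denominators and cancelling the common product;
    both factors on the right are the larger ones.\<close>
  then have "flat 1 (s - 1) * flat 1 (2 - t) \<le> flat 1 (t - 1) * flat 1 (2 - s)"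
    by (intro mult_mono flat_1_mono flat_1_nonneg) auto
  then show ?thesis
    using step_denominator_pos[of s] step_denominator_pos[of t]
    by (simp add: step_def divide_simps algebra_simps)
qed

lemma step_0: "s \<le> 1 \<Longrightarrow> step s = 0"
  by (simp add: step_def flat_def)

lemma step_1: "s \<ge> 2 \<Longrightarrow> step s = 1"
  using step_denominator_pos[of s] by (simp add: step_def flat_def field_simps)

lemma step_bounds: "0 \<le> step s" "step s \<le> 1"
  using step_mono[of "min s 1" s] step_mono[of s "max s 2"] step_0[of "min s 1"] step_1[of "max s 2"] by auto

lemma C_diff_step: "C_diff k step"
proof -
  have "C_diff k (\<lambda>s. flat 1 (s - 1) * inverse (flat 1 (s - 1) + flat 1 (2 - s)))"
  proof (intro C_diff_mult C_diff_inverse C_diff_add C_diff_compose[OF C_diff_flat])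
    show "C_diff k (\<lambda>s::real. s - 1)" "C_diff k (\<lambda>s::real. 2 - s)"
      by (intro C_diff_diff C_diff_const C_diff_bounded_linear bounded_linear_ident)+
    show "flat 1 (s - 1) + flat 1 (2 - s) \<noteq> 0" for s
      using step_denominator_pos[of s] by simp
  qed (intro C_diff_diff C_diff_const C_diff_bounded_linear bounded_linear_ident)+
  then show ?thesis by (simp add: step_def[abs_def])
qed

text \<open>The function \<open>step s / s\<close>, where the denominator is replaced by a positive one for \<open>s < 1\<close>.\<close>

definition step_quotient :: "real \<Rightarrow> real" where
  "step_quotient s = step s * inverse (s * step (2 * s) + (1 - step (2 * s)))"

text \<open>The denominator is a convex combination of s and 1. The weight of s vanishes for s \<le>
  1/2 and is 1 for s \<ge> 1, so the denominator equals s wherever \<open>step s\<close> is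
  nonzero.\<close>

lemma step_quotient_denominator_pos: "s * step (2 * s) + (1 - step (2 * s)) > 0"
proof (cases "s > 0")
  case True
  have "step (2 * s) = 0 \<or> step (2 * s) > 0" using step_bounds[of "2 * s"] by auto
  then show ?thesis using True step_bounds[of "2 * s"] by (auto intro: add_pos_nonneg)
next
  case False
  then show ?thesis by (simp add: step_0)
qed

lemma C_diff_step_quotient: "C_diff k step_quotient"
proof -
  have "C_diff k (\<lambda>s. step s * inverse (s * step (2 * s) + (1 - step (2 * s))))"
  proof (intro C_diff_mult C_diff_inverse C_diff_add C_diff_diff C_diff_const C_diff_compose[OF C_diff_step])
    show "s * step (2 * s) + (1 - step (2 * s)) \<noteq> 0" for s
      using step_quotient_denominator_pos[of s] by simp
  qed (intro C_diff_step C_diff_mult C_diff_const C_diff_bounded_linear bounded_linear_ident)+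
  then show ?thesis by (simp add: step_quotient_def[abs_def])
qed

lemma step_quotient_mult: "s * step_quotient s = step s"
proof (cases "s \<le> 1")
  case False
  then show ?thesis by (simp add: step_quotient_def step_1)
qed (simp add: step_quotient_def step_0)

lemma step_quotient_ge_2: "s \<ge> 2 \<Longrightarrow> step_quotient s = 1 / s"
  using step_quotient_mult[of s] by (simp add: step_1 field_simps)

text \<open>A nonnegative smooth bump that vanishes outside [1, 2]; it serves as the radial profile
  of the mollifiers, in the variable |z|^2.\<close>

definition dstep :: "real \<Rightarrow> real" where
  "dstep = partial_deriv 1 step"

lemma C_diff_dstep: "C_diff k dstep"
  using C_diff_step[of "Suc k"] by (simp add: dstep_def)

lemma C_diff_has_real_derivative:
  assumes "C_diff (Suc k) f"
  shows "(f has_real_derivative partial_deriv 1 f x) (at x)"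
  using C_diff_Suc_has_derivative[OF assms]
  by (rule has_derivative_imp_has_field_derivative)
    (metis frechet_derivative_real_mult[OF assms] partial_deriv_def mult.commute)

lemma step_has_derivative: "(step has_real_derivative dstep s) (at s)"
  unfolding dstep_def by (rule C_diff_has_real_derivative[OF C_diff_step[of 1, unfolded One_nat_def]])

lemma dstep_nonneg: "0 \<le> dstep s"
  using mono_on_imp_deriv_nonneg[of UNIV step "dstep s" s] step_has_derivative step_mono
  by (auto simp: mono_on_def)

lemma dstep_0: "s < 1 \<Longrightarrow> dstep s = 0"
  by (rule DERIV_unique[OF step_has_derivative], rule has_field_derivative_transform_within_open[OF DERIV_const[of 0], where S = "{..<1}"])
    (auto simp: step_0)

lemma dstep_gt_2: "s > 2 \<Longrightarrow> dstep s = 0"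
  by (rule DERIV_unique[OF step_has_derivative], rule has_field_derivative_transform_within_open[OF DERIV_const[of 1], where S = "{2<..}"])
    (auto simp: step_1)

text \<open>Otherwise \<open>step\<close> would be constant, although it rises from 0 at 1 to 1 at
  2. This keeps the total mass of the profile from being zero.\<close>

lemma dstep_positive: "\<exists>s. dstep s > 0"
proof (rule ccontr)
  assume "\<nexists>s. dstep s > 0"
  then have "(step has_real_derivative 0) (at s)" for s
    using step_has_derivative[of s] dstep_nonneg[of s] by (metis less_eq_real_def)
  then have "step 1 = step 2" by (intro DERIV_isconst_all) auto
  then show False by (simp add: step_0 step_1)
qed

section \<open>Test functions and integration by parts\<close>

lemma integral_lborel_translate:
  fixes f :: "'a::euclidean_space \<Rightarrow> 'b::{banach, second_countable_topology}"
  assumes [measurable]: "f \<in> borel_measurable borel"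
  shows "(LINT x|lborel. f (x + c)) = (LINT x|lborel. f x)"
proof -
  have "(LINT x|lborel. f x) = (LINT x|distr lborel borel ((+) c). f x)"
    by (simp add: lborel_distr_plus)
  also have "\<dots> = (LINT x|lborel. f (c + x))" by (rule integral_distr) auto
  finally show ?thesis by (simp add: add.commute)
qed

lemma integrable_compact_support:
  fixes f :: "'a::euclidean_space \<Rightarrow> 'b::{banach, second_countable_topology}"
  assumes "continuous_on UNIV f" "compact K" "\<And>x. x \<notin> K \<Longrightarrow> f x = 0"
  shows "integrable lborel f"
proof -
  have "integrable lborel (\<lambda>x. indicator K x *\<^sub>R f x)"
    by (rule borel_integrable_compact[OF assms(2) continuous_on_subset[OF assms(1)]]) auto
  moreover have "(\<lambda>x. indicator K x *\<^sub>R f x) = f" using assms(3) by (auto simp: indicator_def)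
  ultimately show ?thesis by simp
qed

lemma integral_lebesgue_on_eq_lborel:
  fixes f :: "'a::euclidean_space \<Rightarrow> 'b::euclidean_space"
  assumes "open \<Omega>" "f \<in> borel_measurable borel" "\<And>x. x \<notin> \<Omega> \<Longrightarrow> f x = 0"
  shows "(LINT x|lebesgue_on \<Omega>. f x) = (LINT x|lborel. f x)"
    and "integrable (lebesgue_on \<Omega>) f \<longleftrightarrow> integrable lborel f"
proof -
  have \<Omega>: "\<Omega> \<in> sets lebesgue" using assms(1) by simp
  have eq: "(\<lambda>x. if x \<in> \<Omega> then f x else 0) = f" using assms(3) by auto
  show "(LINT x|lebesgue_on \<Omega>. f x) = (LINT x|lborel. f x)"
    using Lebesgue_Measure.integral_restrict_UNIV[OF \<Omega>, of f] assms(2) by (simp add: eq integral_completion)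
  show "integrable (lebesgue_on \<Omega>) f \<longleftrightarrow> integrable lborel f"
    using Lebesgue_Measure.integrable_restrict_UNIV[OF \<Omega>, of f] assms(2) by (simp add: eq integrable_completion)
qed

text \<open>\<open>\<Omega>\<close> and the complement of \<open>K\<close> are open and cover the
  space, and the function is continuous on each.\<close>

lemma continuous_on_glue_zero:
  assumes "open \<Omega>" "continuous_on \<Omega> f" "closed K" "K \<subseteq> \<Omega>" "\<And>x. x \<notin> K \<Longrightarrow> f x = 0"
  shows "continuous_on UNIV (f :: 'a::topological_space \<Rightarrow> 'b::real_normed_vector)"
proof -
  have "continuous_on (\<Omega> \<union> - K) f"
    by (rule continuous_on_open_Un) (use assms in \<open>auto intro: continuous_on_eq[OF continuous_on_const[of _ 0]]\<close>)
  moreover have "\<Omega> \<union> - K = UNIV" using assms(4) by auto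
  ultimately show ?thesis by simp
qed

lemma has_derivative_zero_outside:
  assumes "closed K" "\<And>x. x \<notin> K \<Longrightarrow> f x = 0" "x \<notin> K"
  shows "(f has_derivative (\<lambda>h. 0)) (at x)"
  by (rule has_derivative_transform_within_open[OF has_derivative_const[of 0] open_Compl[OF assms(1)]])
    (use assms in auto)

text \<open>Dominated convergence: the mean value theorem bounds the difference quotients by the
  maximum \<open>B\<close> of the directional derivative, and all of them vanish outside one fixed
  ball, on which the continuous \<open>h\<close> is bounded.\<close>

lemma difference_quotient_tendsto:
  fixes g h :: "'a::euclidean_space \<Rightarrow> real"
  assumes g: "\<And>x. (g has_derivative g' x) (at x)" and cont: "continuous_on UNIV (\<lambda>x. g' x b)"
    and K: "compact K" "\<And>x. x \<notin> K \<Longrightarrow> g x = 0" and h: "continuous_on UNIV h"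
  shows "(\<lambda>n. LINT x|lborel. h x * (real (Suc n) * (g (x + (1 / real (Suc n)) *\<^sub>R b) - g x)))
     \<longlonglongrightarrow> (LINT x|lborel. h x * g' x b)"
proof -
  let ?q = "\<lambda>n x. real (Suc n) * (g (x + (1 / real (Suc n)) *\<^sub>R b) - g x)"
  have gc: "continuous_on UNIV g"
    using g by (meson continuous_at_imp_continuous_on has_derivative_continuous)
  have g'0: "g' x b = 0" if "x \<notin> K" for x
  proof -
    have "(g has_derivative (\<lambda>h. 0)) (at x)"
      by (rule has_derivative_zero_outside[OF compact_imp_closed[OF K(1)] K(2) that])
    then show ?thesis using has_derivative_unique[OF g] by metis
  qed
  obtain B where B: "\<And>x. norm (g' x b) \<le> B"
  proof -
    have "bounded ((\<lambda>x. g' x b) ` K)"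
      by (intro compact_imp_bounded compact_continuous_image K continuous_on_subset[OF cont]) auto
    then obtain B where "\<And>x. x \<in> K \<Longrightarrow> norm (g' x b) \<le> B" by (auto simp: bounded_iff)
    then have "norm (g' x b) \<le> max B 0" for x using g'0[of x] by (cases "x \<in> K") fastforce+
    then show ?thesis by (rule that)
  qed
  have bound: "\<bar>g (x + t *\<^sub>R b) - g x\<bar> \<le> B * t" if "t > 0" for x t
  proof -
    have d: "((\<lambda>s. g (x + s *\<^sub>R b)) has_derivative (\<lambda>u. g' (x + s *\<^sub>R b) (u *\<^sub>R b))) (at s)" for s
      by (rule has_derivative_compose[OF _ g]) (auto intro!: derivative_eq_intros)
    have "\<exists>s\<in>{0<..<t}. norm (g (x + t *\<^sub>R b) - g (x + 0 *\<^sub>R b)) \<le> norm (g' (x + s *\<^sub>R b) ((t - 0) *\<^sub>R b))"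
      by (rule mvt_general[OF that continuous_at_imp_continuous_on d])
        (auto intro: has_derivative_continuous[OF d])
    then obtain s where "\<bar>g (x + t *\<^sub>R b) - g x\<bar> \<le> norm (g' (x + s *\<^sub>R b) (t *\<^sub>R b))" by auto
    also have "\<dots> = t * norm (g' (x + s *\<^sub>R b) b)"
      using linear_cmul[OF has_derivative_linear[OF g]] that by (simp add: abs_mult)
    also have "\<dots> \<le> t * B" using B that by (intro mult_left_mono) auto
    finally show ?thesis by (simp add: mult.commute)
  qed
  obtain R where R: "K \<subseteq> cball 0 R"
    using bounded_subset_ballD[OF compact_imp_bounded[OF K(1)], of 0] ball_subset_cball by blast
  \<comment> \<open>The steps are at most 1 in length along \<open>b\<close>, so neither x nor its
    translate can meet \<open>K\<close> unless x lies in this ball.\<close>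
  define W where "W = cball (0::'a) (R + norm b)"
  have "integrable lborel (\<lambda>x. indicator W x *\<^sub>R (\<bar>h x\<bar> * B))"
    unfolding W_def by (rule borel_integrable_compact) (auto intro!: continuous_intros continuous_on_subset[OF h])
  then show ?thesis
  proof (rule integral_dominated_convergence[rotated 2])
    have [measurable]: "g \<in> borel_measurable borel" "h \<in> borel_measurable borel" "(\<lambda>x. g' x b) \<in> borel_measurable borel"
      using gc h cont by (auto intro: borel_measurable_continuous_onI)
    show "(\<lambda>x. h x * g' x b) \<in> borel_measurable lborel"
      "(\<lambda>x. h x * ?q n x) \<in> borel_measurable lborel" for n
      by auto
    have "(\<lambda>n. ?q n x) \<longlonglongrightarrow> g' x b" for x
    proof -
      have d: "((\<lambda>s. g (x + s *\<^sub>R b)) has_derivative (\<lambda>u. g' x (u *\<^sub>R b))) (at 0)"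
        by (rule has_derivative_compose[of _ _ 0 UNIV g]) (auto intro!: derivative_eq_intros g)
      then have "((\<lambda>s. g (x + s *\<^sub>R b)) has_real_derivative g' x b) (at 0)"
        by (rule has_derivative_imp_has_field_derivative)
          (use linear_cmul[OF has_derivative_linear[OF g]] in simp)
      then have "((\<lambda>s. (g (x + s *\<^sub>R b) - g x) / s) \<longlongrightarrow> g' x b) (at 0)" by (simp add: DERIV_def)
      moreover have "filterlim (\<lambda>n. 1 / real (Suc n)) (at 0) sequentially"
        unfolding filterlim_at using LIMSEQ_Suc[OF lim_1_over_n] by auto
      ultimately have "(\<lambda>n. (g (x + (1 / real (Suc n)) *\<^sub>R b) - g x) / (1 / real (Suc n))) \<longlonglongrightarrow> g' x b"
        by (rule filterlim_compose)
      then show ?thesis by (simp add: mult.commute)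
    qed
    then show "AE x in lborel. (\<lambda>n. h x * ?q n x) \<longlonglongrightarrow> h x * g' x b"
      by (intro AE_I2 tendsto_mult_left)
    show "AE x in lborel. norm (h x * ?q n x)
        \<le> indicator W x *\<^sub>R (\<bar>h x\<bar> * B)" for n
    proof (rule AE_I2)
      fix x
      show "norm (h x * ?q n x) \<le> indicator W x *\<^sub>R (\<bar>h x\<bar> * B)"
      proof (cases "x \<in> W")
        case True
        have "real (Suc n) * \<bar>g (x + (1 / real (Suc n)) *\<^sub>R b) - g x\<bar> \<le> real (Suc n) * (B * (1 / real (Suc n)))"
          using bound[of "1 / real (Suc n)" x] by (intro mult_left_mono) auto
        then have "real (Suc n) * \<bar>g (x + (1 / real (Suc n)) *\<^sub>R b) - g x\<bar> \<le> B" by simp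
        then have "\<bar>h x\<bar> * (real (Suc n) * \<bar>g (x + (1 / real (Suc n)) *\<^sub>R b) - g x\<bar>) \<le> \<bar>h x\<bar> * B"
          by (intro mult_left_mono) auto
        then show ?thesis using True by (simp only: abs_mult real_norm_def) simp
      next
        case False
        then have nx: "norm x > R + norm b" by (simp add: W_def)
        have "norm ((1 / real (Suc n)) *\<^sub>R b) \<le> norm b"
          by (simp add: field_simps mult_left_le_one_le)
        then have "norm (x + (1 / real (Suc n)) *\<^sub>R b) > R"
          using nx norm_diff_ineq[of x "(1 / real (Suc n)) *\<^sub>R b"] by linarith
        moreover have "norm x > R" using nx norm_ge_zero[of b] by linarith
        ultimately have "x + (1 / real (Suc n)) *\<^sub>R b \<notin> K" "x \<notin> K"
          using R by (auto simp: subset_iff not_le[symmetric])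
        then show ?thesis using False K(2) by simp
      qed
    qed
  qed
qed

text \<open>By translation invariance every difference quotient of \<open>g\<close> has integral
  zero; the previous limit is taken with \<open>h = 1\<close>.\<close>

lemma integral_derivative_zero:
  fixes g :: "'a::euclidean_space \<Rightarrow> real"
  assumes g: "\<And>x. (g has_derivative g' x) (at x)" and cont: "continuous_on UNIV (\<lambda>x. g' x b)"
    and K: "compact K" "\<And>x. x \<notin> K \<Longrightarrow> g x = 0"
  shows "(LINT x|lborel. g' x b) = 0"
proof -
  have gc: "continuous_on UNIV g"
    using g by (meson continuous_at_imp_continuous_on has_derivative_continuous)
  have [measurable]: "g \<in> borel_measurable borel" using gc by (rule borel_measurable_continuous_onI)
  have int: "integrable lborel g" using integrable_compact_support[OF gc K] .
  have "(LINT x|lborel. 1 * (real (Suc n) * (g (x + (1 / real (Suc n)) *\<^sub>R b) - g x))) = 0" for n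
  proof -
    have i2: "integrable lborel (\<lambda>x. g (x + (1 / real (Suc n)) *\<^sub>R b))"
    proof (rule integrable_compact_support)
      show "continuous_on UNIV (\<lambda>x. g (x + (1 / real (Suc n)) *\<^sub>R b))"
        by (rule continuous_on_compose2[OF gc]) (auto intro!: continuous_intros)
      show "compact ((+) (- ((1 / real (Suc n)) *\<^sub>R b)) ` K)" using K(1) by (rule compact_translation)
      show "g (x + (1 / real (Suc n)) *\<^sub>R b) = 0" if "x \<notin> (+) (- ((1 / real (Suc n)) *\<^sub>R b)) ` K" for x
      proof (rule K(2))
        show "x + (1 / real (Suc n)) *\<^sub>R b \<notin> K"
        proof
          assume "x + (1 / real (Suc n)) *\<^sub>R b \<in> K"
          moreover have "x = - ((1 / real (Suc n)) *\<^sub>R b) + (x + (1 / real (Suc n)) *\<^sub>R b)" by simp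
          ultimately show False using that by blast
        qed
      qed
    qed
    show ?thesis
      using int i2 integral_lborel_translate[of g "(1 / real (Suc n)) *\<^sub>R b"] by simp
  qed
  with difference_quotient_tendsto[OF assms continuous_on_const[of UNIV 1]] show ?thesis
    by (simp add: LIMSEQ_const_iff)
qed

section \<open>Test functions, integration by parts and the Poincare inequality\<close>

lemma test_function_C_diff: "\<phi> \<in> test_functions \<Omega> \<Longrightarrow> C_diff k \<phi>"
  by (simp add: test_functions_def)

lemma test_function_has_derivative:
  "\<phi> \<in> test_functions \<Omega> \<Longrightarrow> (\<phi> has_derivative (\<lambda>h. partial_deriv h \<phi> x)) (at x)"
  unfolding partial_deriv_def using C_diff_Suc_has_derivative[OF test_function_C_diff] by blast

lemma test_function_continuous: "\<phi> \<in> test_functions \<Omega> \<Longrightarrow> continuous_on UNIV \<phi>"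
  using test_function_C_diff[of \<phi> \<Omega> 0] by simp

lemma test_function_partial_continuous:
  "\<phi> \<in> test_functions \<Omega> \<Longrightarrow> b \<in> Basis \<Longrightarrow> continuous_on UNIV (partial_deriv b \<phi>)"
  using test_function_C_diff[of \<phi> \<Omega> 1] by simp

lemma test_functionE:
  assumes "\<phi> \<in> test_functions \<Omega>"
  obtains K where "compact K" "K \<subseteq> \<Omega>" "\<And>x. x \<notin> K \<Longrightarrow> \<phi> x = 0" "\<And>x b. x \<notin> K \<Longrightarrow> partial_deriv b \<phi> x = 0"
proof
  let ?K = "closure {x. \<phi> x \<noteq> 0}"
  show "compact ?K" "?K \<subseteq> \<Omega>" using assms by (auto simp: test_functions_def)
  show z: "\<phi> x = 0" if "x \<notin> ?K" for x using that closure_subset[of "{x. \<phi> x \<noteq> 0}"] by auto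
  show "partial_deriv b \<phi> x = 0" if "x \<notin> ?K" for x b
  proof -
    have "(\<phi> has_derivative (\<lambda>h. 0)) (at x)"
      by (rule has_derivative_zero_outside[OF closed_closure z that])
    then show ?thesis by (rule partial_deriv_eq)
  qed
qed

lemma test_functionI:
  assumes "\<And>k. C_diff k \<phi>" "compact K" "K \<subseteq> \<Omega>" "\<And>x. x \<notin> K \<Longrightarrow> \<phi> x = 0"
  shows "\<phi> \<in> test_functions \<Omega>"
proof -
  have "closure {x. \<phi> x \<noteq> 0} \<subseteq> K"
    using assms(2,4) by (intro closure_minimal) (auto simp: compact_imp_closed)
  moreover from this have "compact (closure {x. \<phi> x \<noteq> 0})"
    using assms(2) by (metis closed_closure compact_Int_closed inf.absorb_iff2)
  ultimately show ?thesis using assms(1,3) by (auto simp: test_functions_def)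
qed

lemma test_function_add_scaled:
  assumes "\<phi> \<in> test_functions \<Omega>" "\<psi> \<in> test_functions \<Omega>"
  shows "(\<lambda>x. \<phi> x + c * \<psi> x) \<in> test_functions \<Omega>"
    and "partial_deriv b (\<lambda>x. \<phi> x + c * \<psi> x) x = partial_deriv b \<phi> x + c * partial_deriv b \<psi> x"
proof -
  obtain K where K: "compact K" "K \<subseteq> \<Omega>" "\<And>x. x \<notin> K \<Longrightarrow> \<phi> x = 0" using test_functionE[OF assms(1)] by metis
  obtain L where L: "compact L" "L \<subseteq> \<Omega>" "\<And>x. x \<notin> L \<Longrightarrow> \<psi> x = 0" using test_functionE[OF assms(2)] by metis
  show "(\<lambda>x. \<phi> x + c * \<psi> x) \<in> test_functions \<Omega>"
    by (rule test_functionI[of _ "K \<union> L"])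
      (use K L in \<open>auto intro!: C_diff_add C_diff_mult C_diff_const test_function_C_diff[OF assms(1)] test_function_C_diff[OF assms(2)]\<close>)
  show "partial_deriv b (\<lambda>x. \<phi> x + c * \<psi> x) x = partial_deriv b \<phi> x + c * partial_deriv b \<psi> x"
    by (rule partial_deriv_eq)
      (auto intro!: derivative_eq_intros assms[THEN test_function_has_derivative])
qed

lemma test_function_diff:
  assumes "\<phi> \<in> test_functions \<Omega>" "\<psi> \<in> test_functions \<Omega>"
  shows "(\<lambda>x. \<phi> x - \<psi> x) \<in> test_functions \<Omega>"
    and "partial_deriv b (\<lambda>x. \<phi> x - \<psi> x) x = partial_deriv b \<phi> x - partial_deriv b \<psi> x"
  using test_function_add_scaled[OF assms, where c = "-1"] by simp_all

lemma l2_compact_support: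
  fixes f :: "'a::euclidean_space \<Rightarrow> 'b::euclidean_space"
  assumes "open \<Omega>" "continuous_on UNIV f" "compact K" "K \<subseteq> \<Omega>" "\<And>x. x \<notin> K \<Longrightarrow> f x = 0"
  shows "f \<in> l2 (lebesgue_on \<Omega>)"
proof -
  have m: "f \<in> borel_measurable borel" using assms(2) by (rule borel_measurable_continuous_onI)
  have "integrable lborel (\<lambda>x. (norm (f x))\<^sup>2)"
    by (rule integrable_compact_support[OF _ assms(3)]) (use assms in \<open>auto intro!: continuous_intros\<close>)
  then have "integrable (lebesgue_on \<Omega>) (\<lambda>x. (norm (f x))\<^sup>2)"
    using m assms by (subst integral_lebesgue_on_eq_lborel(2)) auto
  moreover have "f \<in> borel_measurable (lebesgue_on \<Omega>)"
    using assms by (intro continuous_imp_measurable_on_sets_lebesgue) (auto intro: continuous_on_subset)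
  ultimately show ?thesis by (simp add: l2_def)
qed

lemma test_function_l2:
  assumes "open \<Omega>" "\<phi> \<in> test_functions \<Omega>"
  shows "\<phi> \<in> l2 (lebesgue_on \<Omega>)"
    and "b \<in> Basis \<Longrightarrow> partial_deriv b \<phi> \<in> l2 (lebesgue_on \<Omega>)"
proof -
  obtain K where K: "compact K" "K \<subseteq> \<Omega>" "\<And>x. x \<notin> K \<Longrightarrow> \<phi> x = 0" "\<And>x b. x \<notin> K \<Longrightarrow> partial_deriv b \<phi> x = 0"
    using test_functionE[OF assms(2)] by metis
  show "\<phi> \<in> l2 (lebesgue_on \<Omega>)"
    by (rule l2_compact_support[OF assms(1) test_function_continuous[OF assms(2)] K(1,2,3)])
  show "partial_deriv b \<phi> \<in> l2 (lebesgue_on \<Omega>)" if "b \<in> Basis"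
    by (rule l2_compact_support[OF assms(1) test_function_partial_continuous[OF assms(2) that] K(1,2,4)])
qed

text \<open>\<open>integral_derivative_zero\<close> is applied to \<open>h * \<phi>\<close>. Nothing
  is known about \<open>h\<close> outside \<open>\<Omega>\<close>, but the product vanishes off a
  compact subset of \<open>\<Omega>\<close> and is therefore differentiable everywhere.\<close>

lemma integration_by_parts:
  fixes \<phi> h :: "'a::euclidean_space \<Rightarrow> real"
  assumes "open \<Omega>" "\<phi> \<in> test_functions \<Omega>" and b: "b \<in> Basis"
    and h: "\<And>x. x \<in> \<Omega> \<Longrightarrow> (h has_derivative h' x) (at x)" and cont: "continuous_on \<Omega> (\<lambda>x. h' x b)"
  shows "(LINT x|lebesgue_on \<Omega>. h x * partial_deriv b \<phi> x) = - (LINT x|lebesgue_on \<Omega>. h' x b * \<phi> x)"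
proof -
  obtain K where K: "compact K" "K \<subseteq> \<Omega>" "\<And>x. x \<notin> K \<Longrightarrow> \<phi> x = 0" "\<And>x b. x \<notin> K \<Longrightarrow> partial_deriv b \<phi> x = 0"
    using test_functionE[OF assms(2)] by metis
  have hc: "continuous_on \<Omega> h"
    using h by (meson continuous_at_imp_continuous_on has_derivative_continuous)
  have \<phi>c: "continuous_on \<Omega> \<phi>" "continuous_on \<Omega> (partial_deriv b \<phi>)"
    using test_function_continuous[OF assms(2)] test_function_partial_continuous[OF assms(2) b]
    by (auto intro: continuous_on_subset)
  have c1: "continuous_on UNIV (\<lambda>x. h x * partial_deriv b \<phi> x)"
    by (rule continuous_on_glue_zero[OF assms(1) _ compact_imp_closed[OF K(1)] K(2)])
      (use hc \<phi>c K in \<open>auto intro!: continuous_intros\<close>)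
  have c2: "continuous_on UNIV (\<lambda>x. h' x b * \<phi> x)"
    by (rule continuous_on_glue_zero[OF assms(1) _ compact_imp_closed[OF K(1)] K(2)])
      (use cont \<phi>c K in \<open>auto intro!: continuous_intros\<close>)
  \<comment> \<open>The conditional discards the values of \<open>h'\<close> off \<open>K\<close>,
    where they have no meaning in general and \<open>\<phi>\<close> vanishes anyway.\<close>
  have der: "((\<lambda>x. h x * \<phi> x) has_derivative (\<lambda>u. h x * partial_deriv u \<phi> x + (if x \<in> K then h' x u else 0) * \<phi> x)) (at x)" for x
  proof (cases "x \<in> K")
    case True
    then show ?thesis
      using has_derivative_mult[OF h test_function_has_derivative[OF assms(2)], of x] K(2) by auto
  next
    case False
    have "((\<lambda>x. h x * \<phi> x) has_derivative (\<lambda>h. 0)) (at x)"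
      by (rule has_derivative_zero_outside[OF compact_imp_closed[OF K(1)] _ False]) (use K in simp)
    then show ?thesis using False K by simp
  qed
  have eq: "h x * partial_deriv b \<phi> x + (if x \<in> K then h' x b else 0) * \<phi> x = h x * partial_deriv b \<phi> x + h' x b * \<phi> x" for x
    using K by simp
  have i: "integrable lborel (\<lambda>x. h x * partial_deriv b \<phi> x)" "integrable lborel (\<lambda>x. h' x b * \<phi> x)"
    using c1 c2 K by (auto intro!: integrable_compact_support[OF _ K(1)])
  have "(LINT x|lborel. h x * partial_deriv b \<phi> x + h' x b * \<phi> x) = 0"
    using integral_derivative_zero[OF der, of b K] c1 c2 K unfolding eq by (simp add: continuous_on_add)
  then have "(LINT x|lborel. h x * partial_deriv b \<phi> x) = - (LINT x|lborel. h' x b * \<phi> x)"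
    using i by simp
  moreover have "(LINT x|lebesgue_on \<Omega>. h x * partial_deriv b \<phi> x) = (LINT x|lborel. h x * partial_deriv b \<phi> x)"
    using K c1 by (intro integral_lebesgue_on_eq_lborel(1)[OF assms(1)]) (auto intro: borel_measurable_continuous_onI)
  moreover have "(LINT x|lebesgue_on \<Omega>. h' x b * \<phi> x) = (LINT x|lborel. h' x b * \<phi> x)"
    using K c2 by (intro integral_lebesgue_on_eq_lborel(1)[OF assms(1)]) (auto intro: borel_measurable_continuous_onI)
  ultimately show ?thesis by simp
qed

lemma is_weak_deriv_test_function:
  assumes "open \<Omega>" "\<phi> \<in> test_functions \<Omega>" "b \<in> Basis"
  shows "is_weak_deriv \<Omega> b \<phi> (partial_deriv b \<phi>)"
  unfolding is_weak_deriv_def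
  using integration_by_parts[OF assms(1) _ assms(3) test_function_has_derivative[OF assms(2)]]
    test_function_partial_continuous[OF assms(2,3)] by (auto intro: continuous_on_subset)

text \<open>The coordinate x \<bullet> b has derivative 1 in direction b, so
  \<parallel>\<phi>\<parallel>^2 equals -2 times the integral of (x \<bullet> b) \<phi> times the
  partial derivative. Since |x \<bullet> b| \<le> R on \<open>\<Omega>\<close>, Cauchy-Schwarz gives
  the constant 2R.\<close>

lemma Poincare_inequality:
  assumes "open \<Omega>" "\<phi> \<in> test_functions \<Omega>" and b: "b \<in> Basis" and R: "\<Omega> \<subseteq> cball 0 R" "0 \<le> R"
  shows "l2norm (lebesgue_on \<Omega>) \<phi> \<le> 2 * R * l2norm (lebesgue_on \<Omega>) (partial_deriv b \<phi>)"
proof -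
  let ?M = "lebesgue_on \<Omega>" and ?d = "partial_deriv b \<phi>"
  note sq = test_function_l2[OF assms(1,2)]
  have xm [measurable]: "(\<lambda>x. x \<bullet> b) \<in> borel_measurable ?M"
    by (intro continuous_imp_measurable_on_sets_lebesgue continuous_intros) (use assms(1) in auto)
  note [measurable] = sq(1)[THEN l2D(1)] sq(2)[OF b, THEN l2D(1)]
  have le: "\<bar>x \<bullet> b\<bar> \<le> R" if "x \<in> \<Omega>" for x
    using Basis_le_norm[OF b, of x] R(1) that by (force simp: subset_iff)
  have xs: "(\<lambda>x. (x \<bullet> b) * \<phi> x) \<in> l2 ?M \<and> l2norm ?M (\<lambda>x. (x \<bullet> b) * \<phi> x) \<le> R * l2norm ?M \<phi>"
  proof -
    have *: "(norm ((x \<bullet> b) * \<phi> x))\<^sup>2 \<le> R\<^sup>2 * (norm (\<phi> x))\<^sup>2" if "x \<in> \<Omega>" for x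
      using le[OF that] by (auto simp: power_mult_distrib intro!: mult_right_mono abs_le_square_iff[THEN iffD1])
    have i: "integrable ?M (\<lambda>x. R\<^sup>2 * (norm (\<phi> x))\<^sup>2)" using sq(1)[THEN l2D(2)] by simp
    have i2: "integrable ?M (\<lambda>x. (norm ((x \<bullet> b) * \<phi> x))\<^sup>2)"
      by (rule Bochner_Integration.integrable_bound[OF i]) (use * in auto)
    have "(l2norm ?M (\<lambda>x. (x \<bullet> b) * \<phi> x))\<^sup>2 \<le> (R * l2norm ?M \<phi>)\<^sup>2"
      using integral_mono[OF i2 i] * by (simp add: l2norm_power2 power_mult_distrib)
    then have "l2norm ?M (\<lambda>x. (x \<bullet> b) * \<phi> x) \<le> R * l2norm ?M \<phi>"
      by (rule power2_le_imp_le) (use R in simp)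
    with i2 show ?thesis by (simp add: l2_def)
  qed
  \<comment> \<open>Here (x \<bullet> b) \<phi> is integrated by parts against \<open>\<phi>\<close>
    itself; the left-hand integral reappears on the right, which is the origin of the factor
    2.\<close>
  have "(LINT x|?M. ((x \<bullet> b) * \<phi> x) * ?d x) = - (LINT x|?M. ((x \<bullet> b) * ?d x + \<phi> x) * \<phi> x)"
  proof -
    have der: "((\<lambda>x. (x \<bullet> b) * \<phi> x) has_derivative (\<lambda>h. (x \<bullet> b) * partial_deriv h \<phi> x + (h \<bullet> b) * \<phi> x)) (at x)" for x
      by (auto intro!: derivative_eq_intros test_function_has_derivative[OF assms(2)])
    have "continuous_on \<Omega> (\<lambda>x. (x \<bullet> b) * partial_deriv b \<phi> x + (b \<bullet> b) * \<phi> x)"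
      by (intro continuous_intros continuous_on_subset[OF test_function_continuous[OF assms(2)]]
        continuous_on_subset[OF test_function_partial_continuous[OF assms(2) b]]) auto
    with integration_by_parts[OF assms(1,2) b der] b show ?thesis by simp
  qed
  also have "(LINT x|?M. ((x \<bullet> b) * ?d x + \<phi> x) * \<phi> x) = (LINT x|?M. ((x \<bullet> b) * \<phi> x) * ?d x) + (LINT x|?M. (norm (\<phi> x))\<^sup>2)"
    using l2_real_mult[OF conjunct1[OF xs] sq(2)[OF b]] sq(1)[THEN l2D(2)]
    by (subst Bochner_Integration.integral_add[symmetric]) (auto simp: algebra_simps power2_eq_square)
  finally have "(l2norm ?M \<phi>)\<^sup>2 = - 2 * (LINT x|?M. ((x \<bullet> b) * \<phi> x) * ?d x)"
    by (simp add: l2norm_power2)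
  also have "\<dots> \<le> 2 * (R * l2norm ?M \<phi> * l2norm ?M ?d)"
  proof -
    have "\<bar>LINT x|?M. ((x \<bullet> b) * \<phi> x) * ?d x\<bar> \<le> l2norm ?M (\<lambda>x. (x \<bullet> b) * \<phi> x) * l2norm ?M ?d"
      using l2_Cauchy_Schwarz[OF conjunct1[OF xs] sq(2)[OF b]] by simp
    also have "\<dots> \<le> (R * l2norm ?M \<phi>) * l2norm ?M ?d" using xs by (intro mult_right_mono) auto
    finally show ?thesis by linarith
  qed
  finally have "l2norm ?M \<phi> * l2norm ?M \<phi> \<le> (2 * R * l2norm ?M ?d) * l2norm ?M \<phi>"
    by (simp add: power2_eq_square algebra_simps)
  then show ?thesis
    using R l2norm_nonneg[of ?M \<phi>] by (cases "l2norm ?M \<phi> = 0") (auto simp: mult_le_cancel_right)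
qed

text \<open>Replacing \<open>\<partial>\<^sub>c\<close> by difference quotients avoids the symmetry of second derivatives.\<close>

lemma integral_partial_derivs_swap:
  assumes "open \<Omega>" "\<phi> \<in> test_functions \<Omega>" "\<psi> \<in> test_functions \<Omega>" "b \<in> Basis" "c \<in> Basis"
  shows "(LINT x|lebesgue_on \<Omega>. partial_deriv b \<phi> x * partial_deriv c \<psi> x) =
    (LINT x|lebesgue_on \<Omega>. partial_deriv c \<phi> x * partial_deriv b \<psi> x)"
proof -
  obtain K where K: "compact K" "K \<subseteq> \<Omega>" "\<And>x. x \<notin> K \<Longrightarrow> \<phi> x = 0" "\<And>x b. x \<notin> K \<Longrightarrow> partial_deriv b \<phi> x = 0"
    using test_functionE[OF assms(2)] by metis
  obtain L where L: "compact L" "\<And>x. x \<notin> L \<Longrightarrow> \<psi> x = 0" "\<And>x b. x \<notin> L \<Longrightarrow> partial_deriv b \<psi> x = 0"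
    using test_functionE[OF assms(3)] by metis
  note c\<phi> = test_function_continuous[OF assms(2)] test_function_partial_continuous[OF assms(2)]
  note c\<psi> = test_function_continuous[OF assms(3)] test_function_partial_continuous[OF assms(3)]
  have [measurable]: "\<phi> \<in> borel_measurable borel" "\<psi> \<in> borel_measurable borel"
    "partial_deriv b \<phi> \<in> borel_measurable borel" "partial_deriv b \<psi> \<in> borel_measurable borel"
    "partial_deriv c \<phi> \<in> borel_measurable borel" "partial_deriv c \<psi> \<in> borel_measurable borel"
    using c\<phi> c\<psi> assms(4,5) by (auto intro: borel_measurable_continuous_onI)
  have shift: "continuous_on UNIV (\<lambda>x. f (x + a))" if "continuous_on UNIV f" for f :: "'a \<Rightarrow> real" and a
    by (rule continuous_on_compose2[OF that]) (auto intro!: continuous_intros)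
  define t where "t n = 1 / real (Suc n)" for n
  \<comment> \<open>Integration by parts moves the derivative in direction b onto
    \<open>\<psi>\<close>; the substitution x \<mapsto> x - t c then turns the shift of
    \<open>\<psi>\<close> by t c into a shift of \<open>\<phi>\<close> by -t c. The limit in
    direction -c supplies the second minus sign.\<close>
  have eq: "(LINT x|lborel. partial_deriv b \<phi> x * (real (Suc n) * (\<psi> (x + t n *\<^sub>R c) - \<psi> x))) =
     - (LINT x|lborel. partial_deriv b \<psi> x * (real (Suc n) * (\<phi> (x + t n *\<^sub>R (- c)) - \<phi> x)))" for n
  proof -
    let ?W = "\<lambda>x. real (Suc n) * (\<psi> (x + t n *\<^sub>R c) - \<psi> x)"
    have d2: "((\<lambda>x. \<psi> (x + t n *\<^sub>R c)) has_derivative (\<lambda>h. partial_deriv h \<psi> (x + t n *\<^sub>R c))) (at x)" for x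
      by (rule has_derivative_compose[OF _ test_function_has_derivative[OF assms(3)]]) (auto intro!: derivative_eq_intros)
    have der: "(?W has_derivative (\<lambda>h. real (Suc n) * (partial_deriv h \<psi> (x + t n *\<^sub>R c) - partial_deriv h \<psi> x))) (at x)" for x
      by (intro has_derivative_mult_right has_derivative_diff d2 test_function_has_derivative[OF assms(3)])
    have "(LINT x|lebesgue_on \<Omega>. ?W x * partial_deriv b \<phi> x)
       = - (LINT x|lebesgue_on \<Omega>. (real (Suc n) * (partial_deriv b \<psi> (x + t n *\<^sub>R c) - partial_deriv b \<psi> x)) * \<phi> x)"
      by (rule integration_by_parts[OF assms(1,2,4) der])
        (intro continuous_intros continuous_on_subset[OF shift[OF c\<psi>(2)[OF assms(4)]]] continuous_on_subset[OF c\<psi>(2)[OF assms(4)]]; simp)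
    then have "(LINT x|lborel. ?W x * partial_deriv b \<phi> x)
       = - (LINT x|lborel. (real (Suc n) * (partial_deriv b \<psi> (x + t n *\<^sub>R c) - partial_deriv b \<psi> x)) * \<phi> x)"
      using K by (subst (asm) (1 2) integral_lebesgue_on_eq_lborel(1)[OF assms(1)]) auto
    also have "(LINT x|lborel. (real (Suc n) * (partial_deriv b \<psi> (x + t n *\<^sub>R c) - partial_deriv b \<psi> x)) * \<phi> x)
      = (LINT x|lborel. real (Suc n) * (partial_deriv b \<psi> (x + t n *\<^sub>R c) * \<phi> x)) - (LINT x|lborel. real (Suc n) * (partial_deriv b \<psi> x * \<phi> x))"
      by (subst Bochner_Integration.integral_diff[symmetric])
        (auto simp: algebra_simps K intro!: integrable_mult_right integrable_compact_support[OF _ K(1)] continuous_intros shift c\<phi> c\<psi> assms)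
    also have "(LINT x|lborel. real (Suc n) * (partial_deriv b \<psi> (x + t n *\<^sub>R c) * \<phi> x))
       = (LINT x|lborel. real (Suc n) * (partial_deriv b \<psi> x * \<phi> (x + t n *\<^sub>R (- c))))"
      using integral_lborel_translate[of "\<lambda>x. real (Suc n) * (partial_deriv b \<psi> x * \<phi> (x + t n *\<^sub>R (- c)))" "t n *\<^sub>R c"]
      by simp
    also have "\<dots> - (LINT x|lborel. real (Suc n) * (partial_deriv b \<psi> x * \<phi> x)) =
       (LINT x|lborel. partial_deriv b \<psi> x * (real (Suc n) * (\<phi> (x + t n *\<^sub>R (- c)) - \<phi> x)))"
      by (subst Bochner_Integration.integral_diff[symmetric])
        (auto simp: algebra_simps L intro!: integrable_mult_right integrable_compact_support[OF _ L(1)] continuous_intros shift[of \<phi> "- (t n *\<^sub>R c)", simplified] c\<phi> c\<psi> assms)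
    finally show ?thesis by (simp add: mult.commute)
  qed
  have lim1: "(\<lambda>n. LINT x|lborel. partial_deriv b \<phi> x * (real (Suc n) * (\<psi> (x + t n *\<^sub>R c) - \<psi> x)))
      \<longlonglongrightarrow> (LINT x|lborel. partial_deriv b \<phi> x * partial_deriv c \<psi> x)"
    unfolding t_def
    by (rule difference_quotient_tendsto[OF test_function_has_derivative[OF assms(3)]])
      (use c\<phi> c\<psi> L assms in auto)
  have lim2: "(\<lambda>n. LINT x|lborel. partial_deriv b \<psi> x * (real (Suc n) * (\<phi> (x + t n *\<^sub>R (- c)) - \<phi> x)))
      \<longlonglongrightarrow> (LINT x|lborel. partial_deriv b \<psi> x * partial_deriv (- c) \<phi> x)"
  proof -
    have "partial_deriv (- c) \<phi> x = - partial_deriv c \<phi> x" for x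
      using linear_neg[OF has_derivative_linear[OF test_function_has_derivative[OF assms(2)]]] .
    then show ?thesis
      unfolding t_def
      by (intro difference_quotient_tendsto[OF test_function_has_derivative[OF assms(2)] _ K(1,3)])
        (use c\<phi> c\<psi> assms in \<open>auto intro!: continuous_intros\<close>)
  qed
  have "(LINT x|lborel. partial_deriv b \<phi> x * partial_deriv c \<psi> x) = - (LINT x|lborel. partial_deriv b \<psi> x * partial_deriv (- c) \<phi> x)"
    by (rule LIMSEQ_unique[OF lim1[unfolded eq] tendsto_minus[OF lim2]])
  also have "\<dots> = (LINT x|lborel. partial_deriv c \<phi> x * partial_deriv b \<psi> x)"
  proof -
    have "partial_deriv (- c) \<phi> x = - partial_deriv c \<phi> x" for x
      using linear_neg[OF has_derivative_linear[OF test_function_has_derivative[OF assms(2)]]] .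
    then show ?thesis by (simp add: mult.commute)
  qed
  finally show ?thesis
    using K by (subst (1 2) integral_lebesgue_on_eq_lborel(1)[OF assms(1)]) auto
qed

section \<open>Annular mollifiers\<close>

lemma C_diff_cmod_power2: "C_diff k (\<lambda>w. (cmod (w - c) / e)\<^sup>2)"
proof -
  have "C_diff k (\<lambda>w. (Re w - Re c) * (Re w - Re c) * (1 / e\<^sup>2) + (Im w - Im c) * (Im w - Im c) * (1 / e\<^sup>2))"
    by (intro C_diff_add C_diff_mult C_diff_diff C_diff_const C_diff_bounded_linear bounded_linear_Re bounded_linear_Im)
  moreover have "(cmod (w - c) / e)\<^sup>2 =
      (Re w - Re c) * (Re w - Re c) * (1 / e\<^sup>2) + (Im w - Im c) * (Im w - Im c) * (1 / e\<^sup>2)" for w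
    unfolding power_divide cmod_power2 by (simp add: power2_eq_square add_divide_distrib)
  ultimately show ?thesis by simp
qed

definition mollifier_mass :: real where
  "mollifier_mass = (LINT z|lborel. dstep ((cmod z)\<^sup>2))"

text \<open>The support is an annulus, so that the difference of two mollifiers is the \<open>\<partial>\<close>-bar derivative of a test
  function that vanishes near the singularity of \<open>1/z\<close>.\<close>

definition mollifier :: "real \<Rightarrow> complex \<Rightarrow> real" where
  "mollifier e z = dstep ((cmod z / e)\<^sup>2) / (e\<^sup>2 * mollifier_mass)"

lemma dstep_continuous: "continuous_on UNIV dstep"
  using C_diff_dstep[of 0] by simp

text \<open>A nonnegative function with integral zero vanishes almost everywhere, but the set where
  this continuous one is nonzero is open and, by \<open>dstep_positive\<close>, nonempty.\<close>

lemma mollifier_mass_pos: "mollifier_mass > 0"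
proof -
  let ?g = "\<lambda>z::complex. dstep ((cmod z)\<^sup>2)"
  have cont: "continuous_on UNIV ?g"
    by (rule continuous_on_compose2[OF dstep_continuous]) (auto intro!: continuous_intros)
  have int: "integrable lborel ?g"
  proof (rule integrable_compact_support[OF cont compact_cball])
    fix x :: complex assume "x \<notin> cball 0 2"
    then have "cmod x > 2" by simp
    then have "2 * 1 < cmod x * cmod x" by (intro mult_strict_mono) auto
    then have "(cmod x)\<^sup>2 > 2" by (simp add: power2_eq_square)
    then show "?g x = 0" by (rule dstep_gt_2)
  qed
  have "mollifier_mass \<noteq> 0"
  proof
    assume "mollifier_mass = 0"
    then have "AE z in lborel. ?g z = 0"
      using integral_nonneg_eq_0_iff_AE[OF int] dstep_nonneg by (auto simp: mollifier_mass_def)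
    then have "AE z in lebesgue. ?g z = 0" by (rule AE_completion)
    then have "negligible {z. ?g z \<noteq> 0}"
      unfolding negligible_iff_null_sets eventually_ae_filter
      by (auto intro: null_sets_completion_subset)
    moreover have "open {z. ?g z \<noteq> 0}"
      using open_Collect_neq[OF cont continuous_on_const[of UNIV 0]] by simp
    moreover obtain s where s: "dstep s > 0" using dstep_positive by auto
    \<comment> \<open>Nonnegativity allows s to be realised as the squared modulus of a point of the
      plane.\<close>
    then have "s \<ge> 0" using dstep_0[of s] by (cases "s < 1") auto
    then have "complex_of_real (sqrt s) \<in> {z. ?g z \<noteq> 0}" using s by simp
    ultimately show False using open_not_negligible by blast
  qed
  moreover have "mollifier_mass \<ge> 0"
    unfolding mollifier_mass_def by (intro integral_nonneg_AE) (simp add: dstep_nonneg)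
  ultimately show ?thesis by simp
qed

lemma mollifier_nonneg: "0 \<le> mollifier e z"
  using dstep_nonneg mollifier_mass_pos by (simp add: mollifier_def)

text \<open>The support already lies in the disc of radius \<surd>2 e; the rounder radius 2e is the
  one used in all inclusions of discs below.\<close>

lemma mollifier_eq_0:
  assumes "e > 0" "cmod z \<ge> 2 * e"
  shows "mollifier e z = 0"
proof -
  have "cmod z / e \<ge> 2" using assms by (simp add: field_simps)
  then have "(cmod z / e)\<^sup>2 \<ge> 2\<^sup>2" by (intro power_mono) auto
  then show ?thesis by (simp add: mollifier_def dstep_gt_2)
qed

lemma mollifier_C_diff: "C_diff k (\<lambda>w. mollifier e (w - z))"
proof -
  have "C_diff k (\<lambda>w. dstep ((cmod (w - z) / e)\<^sup>2) * (1 / (e\<^sup>2 * mollifier_mass)))"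
    by (intro C_diff_mult C_diff_const C_diff_compose[OF C_diff_dstep C_diff_cmod_power2])
  then show ?thesis by (simp add: mollifier_def)
qed

lemma mollifier_minus_commute: "mollifier e (w - z) = mollifier e (z - w)"
  by (simp add: mollifier_def norm_minus_commute)

lemma mollifier_continuous: "continuous_on UNIV (mollifier e)"
  using mollifier_C_diff[of 0 e 0] by simp

lemma mollifier_measurable [measurable]: "mollifier e \<in> borel_measurable borel"
  using mollifier_continuous by (rule borel_measurable_continuous_onI)

lemma mollifier_test_function:
  assumes "e > 0" "cball z (2 * e) \<subseteq> \<Omega>"
  shows "(\<lambda>w. mollifier e (w - z)) \<in> test_functions \<Omega>"
  by (rule test_functionI[OF mollifier_C_diff compact_cball assms(2)])
    (use assms(1) in \<open>auto simp: dist_norm norm_minus_commute intro: mollifier_eq_0\<close>)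

lemma mollifier_integrable: "e > 0 \<Longrightarrow> integrable lborel (\<lambda>w. mollifier e (w - z))"
  by (rule integrable_compact_support[OF _ compact_cball[of z "2 * e"]])
    (use mollifier_C_diff[of 0 e z] in \<open>auto simp: dist_norm norm_minus_commute intro: mollifier_eq_0\<close>)

lemma integral_mollifier:
  assumes "e > 0"
  shows "(LINT w|lborel. mollifier e (w - z)) = 1"
proof -
  have "(LINT w|lborel. mollifier e (w - z))
      = (LINT w|density (distr lborel borel (\<lambda>x. z + e *\<^sub>R x)) (\<lambda>_. ennreal (\<bar>e\<bar>^DIM(complex))). mollifier e (w - z))"
    using lborel_affine[of e z] assms by simp
  also have "\<dots> = (LINT x|lborel. e\<^sup>2 * mollifier e (e *\<^sub>R x))"
    by (subst integral_density) (auto simp: integral_distr power2_eq_square)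
  also have "\<dots> = (LINT x|lborel. dstep ((cmod x)\<^sup>2) / mollifier_mass)"
    using assms by (simp add: mollifier_def)
  also have "\<dots> = 1" using mollifier_mass_pos by (simp flip: mollifier_mass_def)
  finally show ?thesis .
qed

text \<open>As \<open>mollifier e\<close> is even, this is its convolution with \<open>f\<close> cut
  off outside \<open>\<Omega>\<close>. It is defined at every z, but is sure to be an average of
  total weight 1 only if \<open>cball z (2 * e) \<subseteq> \<Omega>\<close>.\<close>

definition mollify :: "complex set \<Rightarrow> real \<Rightarrow> (complex \<Rightarrow> 'b::euclidean_space) \<Rightarrow> complex \<Rightarrow> 'b" where
  "mollify \<Omega> e f z = (LINT w|lebesgue_on \<Omega>. mollifier e (w - z) *\<^sub>R f w)"

text \<open>The complex number built from the two partial derivatives is twice the d-bar derivative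
  of \<phi>, so this is the Cauchy-Riemann equation in the sense of distributions.\<close>

definition weakly_holomorphic :: "complex set \<Rightarrow> (complex \<Rightarrow> complex) \<Rightarrow> bool" where
  "weakly_holomorphic \<Omega> f \<longleftrightarrow> (\<forall>\<phi>\<in>test_functions \<Omega>.
     (LINT x|lebesgue_on \<Omega>. f x * Complex (partial_deriv 1 \<phi> x) (partial_deriv \<i> \<phi> x)) = 0)"

lemma l2_mult:
  fixes f g :: "'a \<Rightarrow> complex"
  assumes "f \<in> l2 M" "g \<in> l2 M"
  shows "integrable M (\<lambda>x. f x * g x)"
proof -
  note [measurable] = assms[THEN l2D(1)]
  have "integrable M (\<lambda>x. (norm (f x))\<^sup>2 + (norm (g x))\<^sup>2)"
    using assms[THEN l2D(2)] by auto
  moreover have le: "norm (f x * g x) \<le> norm ((norm (f x))\<^sup>2 + (norm (g x))\<^sup>2)" for x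
  proof -
    have "2 * (norm (f x) * norm (g x)) \<le> (norm (f x))\<^sup>2 + (norm (g x))\<^sup>2"
      using sum_squares_bound[of "norm (f x)" "norm (g x)"] by simp
    then show ?thesis
      by (simp add: norm_mult) (smt (verit) mult_nonneg_nonneg norm_ge_zero)
  qed
  ultimately show ?thesis
    by (elim Bochner_Integration.integrable_bound) (auto simp: le)
qed

lemma l2_Complex:
  assumes "f \<in> l2 M" "g \<in> l2 M"
  shows "(\<lambda>x. Complex (f x) (g x)) \<in> l2 M"
proof -
  note [measurable] = assms[THEN l2D(1)]
  have "(\<lambda>x. complex_of_real (f x) + \<i> * complex_of_real (g x)) \<in> borel_measurable M" by measurable
  then have "(\<lambda>x. Complex (f x) (g x)) \<in> borel_measurable M" by (simp add: Complex_eq)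
  then show ?thesis
    using assms[THEN l2D(2)] by (auto simp: l2_def cmod_power2)
qed

text \<open>The second identity differentiates \<open>s * step_quotient s = step s\<close> by the
  product rule.\<close>

lemma step_quotient_derivative:
  "(step_quotient has_real_derivative partial_deriv 1 step_quotient s) (at s)"
  "step_quotient s + s * partial_deriv 1 step_quotient s = dstep s"
proof -
  show d: "(step_quotient has_real_derivative partial_deriv 1 step_quotient s) (at s)"
    by (rule C_diff_has_real_derivative[OF C_diff_step_quotient[of "Suc 0"]])
  have "((\<lambda>s. s * step_quotient s) has_real_derivative (step_quotient s + s * partial_deriv 1 step_quotient s)) (at s)"
    by (auto intro!: derivative_eq_intros d)
  moreover have "((\<lambda>s. s * step_quotient s) has_real_derivative dstep s) (at s)"
    using step_has_derivative by (simp add: step_quotient_mult)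
  ultimately show "step_quotient s + s * partial_deriv 1 step_quotient s = dstep s"
    by (rule DERIV_unique)
qed

text \<open>With \<open>N\<^sub>e(\<zeta>) = step(|\<zeta>|\<^sup>2/e\<^sup>2)/|\<zeta>|\<^sup>2\<close> one has \<open>\<partial>\<close>-bar\<open>(conj \<zeta> N\<^sub>e(\<zeta>)) = mollifier_mass \<cdot> mollifier e \<zeta>\<close>, and
  \<open>N\<^sub>e = N\<^sub>d\<close> outside a disc.\<close>

lemma mollifier_independent_radius:
  assumes "open \<Omega>" and f: "f \<in> l2 (lebesgue_on \<Omega>)" "weakly_holomorphic \<Omega> f"
    and ed: "0 < e" "0 < d" "cball z (2 * e) \<subseteq> \<Omega>" "cball z (2 * d) \<subseteq> \<Omega>"
  shows "mollify \<Omega> e f z = mollify \<Omega> d f z"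
proof -
  let ?M = "lebesgue_on \<Omega>"
  define N where "N r w = step_quotient ((cmod (w - z) / r)\<^sup>2) * (1 / r\<^sup>2)" for r w
  \<comment> \<open>The radial factor of the gradient: grad \<open>N r\<close> is 2
    \<open>q r w\<close> (w - z). One factor 1/r^2 stems from the normalisation of \<open>N\<close>,
    the other from differentiating (|w - z|/r)^2.\<close>
  define q where "q r w = partial_deriv 1 step_quotient ((cmod (w - z) / r)\<^sup>2) / r^4" for r w
  have N_C: "C_diff k (N r)" for k r
    unfolding N_def[abs_def] by (intro C_diff_mult C_diff_const C_diff_compose[OF C_diff_step_quotient C_diff_cmod_power2])
  have N_der: "(N r has_derivative (\<lambda>h. 2 * q r w * ((w - z) \<bullet> h))) (at w)" if "r > 0" for r w
  proof -
    have s: "((\<lambda>w. (cmod (w - z) / r)\<^sup>2) has_derivative (\<lambda>h. 2 * ((w - z) \<bullet> h) / r\<^sup>2)) (at w)"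
      unfolding power_divide power2_norm_eq_inner
      using that by (auto intro!: derivative_eq_intros simp: inner_commute field_simps power4_eq_xxxx power2_eq_square)
    have "((\<lambda>w. step_quotient ((cmod (w - z) / r)\<^sup>2)) has_derivative
        (\<lambda>h. (2 * ((w - z) \<bullet> h) / r\<^sup>2) * partial_deriv 1 step_quotient ((cmod (w - z) / r)\<^sup>2))) (at w)"
      using has_derivative_compose[OF s step_quotient_derivative(1)[unfolded has_field_derivative_def]]
      by (simp add: mult.commute)
    then have "(N r has_derivative (\<lambda>h. ((2 * ((w - z) \<bullet> h) / r\<^sup>2) * partial_deriv 1 step_quotient ((cmod (w - z) / r)\<^sup>2)) * (1 / r\<^sup>2))) (at w)"
      unfolding N_def[abs_def] by (rule has_derivative_mult_left)
    moreover have "((2 * ((w - z) \<bullet> h) / r\<^sup>2) * partial_deriv 1 step_quotient ((cmod (w - z) / r)\<^sup>2)) * (1 / r\<^sup>2)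
       = 2 * q r w * ((w - z) \<bullet> h)" for h
      using that by (simp add: q_def field_simps power4_eq_xxxx power2_eq_square)
    ultimately show ?thesis by simp
  qed
  have Nq: "N r w + q r w * (cmod (w - z))\<^sup>2 = mollifier_mass * mollifier r (w - z)" if "r > 0" for r w
  proof -
    have "dstep ((cmod (w - z) / r)\<^sup>2) * (1 / r\<^sup>2) = N r w + q r w * (cmod (w - z))\<^sup>2"
      unfolding step_quotient_derivative(2)[symmetric, of "(cmod (w - z) / r)\<^sup>2"] N_def q_def
      using that by (simp add: field_simps power4_eq_xxxx power2_eq_square)
    then show ?thesis using mollifier_mass_pos by (simp add: mollifier_def)
  qed
  have N_far: "N r w = 1 / (cmod (w - z))\<^sup>2" if "r > 0" "cmod (w - z) \<ge> 2 * r" for r w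
  proof -
    have "cmod (w - z) / r \<ge> 2" using that by (simp add: field_simps)
    then have "(cmod (w - z) / r)\<^sup>2 \<ge> 2\<^sup>2" by (intro power_mono) auto
    then show ?thesis using that by (simp add: N_def step_quotient_ge_2 power_divide)
  qed
  define R where "R = max (2 * e) (2 * d)"
  \<comment> \<open>The component of w - z in direction a, times the difference of the two kernels.
    Both kernels are 1/|w - z|^2 outside the larger disc, which gives compact support in
    \<open>\<Omega>\<close>.\<close>
  define \<psi> where "\<psi> a w = ((w - z) \<bullet> a) * (N e w - N d w)" for a w
  have \<psi>_test: "\<psi> a \<in> test_functions \<Omega>" for a
  proof (rule test_functionI[where K = "cball z R"])
    show "C_diff k (\<psi> a)" for k
      unfolding \<psi>_def[abs_def] inner_diff_left
      by (intro C_diff_mult C_diff_diff N_C C_diff_const C_diff_bounded_linear bounded_linear_inner_left)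
    show "cball z R \<subseteq> \<Omega>" using ed(3,4) by (auto simp: R_def max_def)
    show "\<psi> a w = 0" if "w \<notin> cball z R" for w
    proof -
      have "cmod (w - z) \<ge> 2 * e" "cmod (w - z) \<ge> 2 * d"
        using that by (auto simp: R_def dist_norm norm_minus_commute)
      then show ?thesis using ed N_far by (simp add: \<psi>_def)
    qed
  qed simp
  have \<psi>_der: "partial_deriv b (\<psi> a) w = (b \<bullet> a) * (N e w - N d w) + ((w - z) \<bullet> a) * (2 * q e w * ((w - z) \<bullet> b) - 2 * q d w * ((w - z) \<bullet> b))" for a b w
    unfolding \<psi>_def[abs_def]
    by (rule partial_deriv_eq) (auto intro!: derivative_eq_intros N_der ed)
  let ?P = "\<lambda>a w. Complex (partial_deriv 1 (\<psi> a) w) (partial_deriv \<i> (\<psi> a) w)"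
  have sq: "?P a \<in> l2 ?M" for a
    by (intro l2_Complex test_function_l2(2)[OF assms(1) \<psi>_test]) (auto simp: Basis_complex_def)
  \<comment> \<open>Since \<psi> for a = 1 minus \<i> times \<psi> for a = \<i> is the conjugate of
    w - z times the kernel difference, this combination tests \<open>f\<close> with twice the d-bar
    derivative of that complex function.\<close>
  have "0 = (LINT w|?M. f w * ?P 1 w)
      - \<i> * (LINT w|?M. f w * ?P \<i> w)"
    using f(2) \<psi>_test by (simp add: weakly_holomorphic_def)
  also have "\<dots> = (LINT w|?M. f w * ?P 1 w
      - \<i> * (f w * ?P \<i> w))"
    using l2_mult[OF f(1) sq] by simp
  also have "\<dots> = (LINT w|?M. (2 * mollifier_mass) *\<^sub>R (mollifier e (w - z) *\<^sub>R f w - mollifier d (w - z) *\<^sub>R f w))"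
  proof (rule Bochner_Integration.integral_cong[OF refl])
    fix w
    let ?x = "Re w - Re z" and ?y = "Im w - Im z"
    have s: "(cmod (w - z))\<^sup>2 = ?x\<^sup>2 + ?y\<^sup>2" by (simp add: cmod_power2)
    have "?P 1 w - \<i> * ?P \<i> w
      = of_real (2 * ((N e w + q e w * (cmod (w - z))\<^sup>2) - (N d w + q d w * (cmod (w - z))\<^sup>2)))"
      unfolding s \<psi>_der by (simp add: complex_eq_iff inner_complex_def algebra_simps power2_eq_square)
    also have "\<dots> = of_real (2 * mollifier_mass * (mollifier e (w - z) - mollifier d (w - z)))"
      using ed Nq by (simp add: algebra_simps)
    finally have *: "?P 1 w - \<i> * ?P \<i> w
      = of_real (2 * mollifier_mass * (mollifier e (w - z) - mollifier d (w - z)))" .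
    have "f w * ?P 1 w
      - \<i> * (f w * ?P \<i> w)
      = f w * (?P 1 w - \<i> * ?P \<i> w)"
      by (simp add: algebra_simps)
    also have "\<dots> = (2 * mollifier_mass) *\<^sub>R (mollifier e (w - z) *\<^sub>R f w - mollifier d (w - z) *\<^sub>R f w)"
      unfolding * by (simp add: scaleR_conv_of_real algebra_simps)
    finally show "f w * ?P 1 w
      - \<i> * (f w * ?P \<i> w)
      = (2 * mollifier_mass) *\<^sub>R (mollifier e (w - z) *\<^sub>R f w - mollifier d (w - z) *\<^sub>R f w)" .
  qed
  also have "\<dots> = (2 * mollifier_mass) *\<^sub>R (mollify \<Omega> e f z - mollify \<Omega> d f z)"
  proof -
    have "integrable ?M (\<lambda>w. mollifier r (w - z) *\<^sub>R f w)" if "r > 0" "cball z (2 * r) \<subseteq> \<Omega>" for r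
    proof -
      have "(\<lambda>w. Complex (mollifier r (w - z)) 0) \<in> l2 ?M"
        by (intro l2_Complex test_function_l2(1)[OF assms(1) mollifier_test_function[OF that]])
          (simp add: l2_def)
      from l2_mult[OF this f(1)] show ?thesis
        by (simp add: scaleR_conv_of_real complex_of_real_def)
    qed
    then show ?thesis unfolding mollify_def using ed by simp
  qed
  finally show ?thesis using mollifier_mass_pos by simp
qed

section \<open>The fundamental lemma of the calculus of variations\<close>

lemma l2_imp_integrable:
  assumes "finite_measure M" "f \<in> l2 M"
  shows "integrable M f"
proof -
  interpret finite_measure M by fact
  note [measurable] = l2D(1)[OF assms(2)]
  have "integrable M (\<lambda>x. 1 + (norm (f x))\<^sup>2)" using l2D(2)[OF assms(2)] by simp
  moreover have le: "norm (f x) \<le> norm (1 + (norm (f x))\<^sup>2)" for x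
  proof -
    have "2 * norm (f x) \<le> 1 + (norm (f x))\<^sup>2" using sum_squares_bound[of 1 "norm (f x)"] by simp
    then show ?thesis by (smt (verit) norm_ge_zero real_norm_def)
  qed
  ultimately show ?thesis by (elim Bochner_Integration.integrable_bound) (auto simp: le)
qed

lemma integrable_bounded_scaleR:
  fixes f :: "'a \<Rightarrow> 'b::{banach, second_countable_topology}"
  assumes "integrable M f" "g \<in> borel_measurable M" "\<And>x. x \<in> space M \<Longrightarrow> \<bar>g x\<bar> \<le> B"
  shows "integrable M (\<lambda>x. g x *\<^sub>R f x)"
proof (rule Bochner_Integration.integrable_bound)
  show "integrable M (\<lambda>x. B * norm (f x))" using assms(1) by simp
  show "(\<lambda>x. g x *\<^sub>R f x) \<in> borel_measurable M" using assms by measurable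
  show "AE x in M. norm (g x *\<^sub>R f x) \<le> norm (B * norm (f x))"
  proof (rule AE_I2)
    fix x assume "x \<in> space M"
    then have "\<bar>g x\<bar> * norm (f x) \<le> \<bar>B\<bar> * norm (f x)"
      using assms(3)[of x] by (intro mult_right_mono) auto
    then show "norm (g x *\<^sub>R f x) \<le> norm (B * norm (f x))" by (simp add: abs_mult)
  qed
qed

lemma finite_measure_bounded_open:
  assumes "open \<Omega>" "bounded (\<Omega> :: 'a::euclidean_space set)"
  shows "finite_measure (lebesgue_on \<Omega>)"
  using assms by (intro finite_measure_lebesgue_on lmeasurable_open)

lemma measurable_lebesgue_on_borel:
  assumes "open \<Omega>" "f \<in> borel_measurable borel"
  shows "f \<in> borel_measurable (lebesgue_on (\<Omega> :: 'a::euclidean_space set))"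
proof -
  have "f \<in> borel_measurable lborel" using assms(2) by simp
  then show ?thesis by (intro measurable_restrict_space1 measurable_completion)
qed

lemma mollifier_bounded:
  assumes "e > 0"
  obtains B where "B \<ge> 0" "\<And>z. mollifier e z \<le> B"
proof -
  have "bounded (mollifier e ` cball 0 (2 * e))"
    by (intro compact_imp_bounded compact_continuous_image continuous_on_subset[OF mollifier_continuous]) auto
  then obtain B where B: "\<And>z. z \<in> cball 0 (2 * e) \<Longrightarrow> norm (mollifier e z) \<le> B" unfolding bounded_iff by blast
  show ?thesis
  proof (rule that[of "max B 0"])
    fix z
    show "mollifier e z \<le> max B 0"
      using B[of z] mollifier_eq_0[OF assms, of z] by (cases "cmod z \<le> 2 * e") auto
  qed simp
qed

text \<open>Uniform continuity holds on a ball of radius R + 1 around the support; a step shorter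
  than 1 cannot lead from outside this ball into \<open>K\<close>.\<close>

lemma uniformly_continuous_compact_support:
  fixes f :: "'a::euclidean_space \<Rightarrow> 'b::real_normed_vector"
  assumes "continuous_on UNIV f" "compact K" "\<And>x. x \<notin> K \<Longrightarrow> f x = 0" "\<epsilon> > 0"
  obtains \<delta> where "\<delta> > 0" "\<And>x y. dist x y < \<delta> \<Longrightarrow> norm (f x - f y) < \<epsilon>"
proof -
  obtain R where R: "K \<subseteq> cball 0 R"
    using bounded_subset_ballD[OF compact_imp_bounded[OF assms(2)], of 0] ball_subset_cball by blast
  have "uniformly_continuous_on (cball 0 (R + 1)) f"
    by (intro compact_uniformly_continuous continuous_on_subset[OF assms(1)]) auto
  then obtain d where d: "d > 0" "\<And>x y. x \<in> cball 0 (R + 1) \<Longrightarrow> y \<in> cball 0 (R + 1) \<Longrightarrow> dist y x < d \<Longrightarrow> dist (f y) (f x) < \<epsilon>"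
    using assms(4) unfolding uniformly_continuous_on_def by metis
  show ?thesis
  proof (rule that[of "min d 1"])
    fix x y :: 'a assume xy: "dist x y < min d 1"
    show "norm (f x - f y) < \<epsilon>"
    proof (cases "x \<in> cball 0 (R + 1) \<and> y \<in> cball 0 (R + 1)")
      case True
      then show ?thesis using d(2)[of y x] xy by (simp add: dist_norm)
    next
      case False
      have "\<bar>norm x - norm y\<bar> < 1" using xy norm_triangle_ineq3[of x y] by (simp add: dist_norm)
      with False have "norm x > R" "norm y > R" by auto
      then have "x \<notin> K" "y \<notin> K" using R by (auto simp: subset_iff not_le[symmetric])
      then show ?thesis using assms(3,4) by simp
    qed
  qed (use d in simp)
qed

text \<open>Fubini transfers the mollifier from \<open>f\<close> to the continuous function \<phi>.
  The mollification of \<phi> converges uniformly because \<phi> is uniformly continuous, and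
  integrability of \<open>f\<close> finishes the estimate.\<close>

lemma mollification_tendsto:
  fixes f :: "complex \<Rightarrow> 'b::euclidean_space"
  assumes \<Omega>: "open \<Omega>" "bounded \<Omega>" and f: "f \<in> l2 (lebesgue_on \<Omega>)"
    and \<phi>: "continuous_on UNIV \<phi>" "compact K" "K \<subseteq> \<Omega>" "\<And>x. x \<notin> K \<Longrightarrow> \<phi> x = 0"
  shows "(\<lambda>n. LINT z|lebesgue_on \<Omega>. \<phi> z *\<^sub>R mollify \<Omega> (1 / real (Suc n)) f z)
    \<longlonglongrightarrow> (LINT w|lebesgue_on \<Omega>. \<phi> w *\<^sub>R f w)"
proof -
  let ?M = "lebesgue_on \<Omega>"
  interpret M: finite_measure ?M using finite_measure_bounded_open[OF \<Omega>] .
  interpret P: pair_sigma_finite ?M ?M ..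
  have int: "integrable ?M f" using l2_imp_integrable[OF M.finite_measure_axioms f] .
  have fm [measurable]: "f \<in> borel_measurable ?M" using l2D(1)[OF f] .
  have idm [measurable]: "(\<lambda>x. x) \<in> borel_measurable ?M" using measurable_lebesgue_on_borel[OF \<Omega>(1), of "\<lambda>x. x"] by simp
  have \<phi>b [measurable]: "\<phi> \<in> borel_measurable borel" using \<phi>(1) by (rule borel_measurable_continuous_onI)
  have \<phi>m [measurable]: "\<phi> \<in> borel_measurable ?M" using measurable_lebesgue_on_borel[OF \<Omega>(1) \<phi>b] .
  obtain C where C: "C \<ge> 0" "\<And>x. \<bar>\<phi> x\<bar> \<le> C"
  proof -
    have "bounded (\<phi> ` K)" by (intro compact_imp_bounded compact_continuous_image \<phi> continuous_on_subset[OF \<phi>(1)]) auto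
    then obtain C where C: "\<And>x. x \<in> K \<Longrightarrow> norm (\<phi> x) \<le> C" by (auto simp: bounded_iff)
    have "\<bar>\<phi> x\<bar> \<le> max C 0" for x using C[of x] \<phi>(4)[of x] by (cases "x \<in> K") auto
    then show ?thesis using that[of "max C 0"] by simp
  qed
  define G where "G e w = (LINT z|?M. \<phi> z * mollifier e (w - z))" for e w
  have swap: "(LINT z|?M. \<phi> z *\<^sub>R mollify \<Omega> e f z) = (LINT w|?M. G e w *\<^sub>R f w)"
    if e: "e > 0" for e
  proof -
    obtain B where B: "B \<ge> 0" "\<And>z. mollifier e z \<le> B" using mollifier_bounded[OF e] by metis
    have fstm: "(\<lambda>p. f (fst p)) \<in> borel_measurable (?M \<Otimes>\<^sub>M ?M)" by measurable
    have "integrable (?M \<Otimes>\<^sub>M ?M) (\<lambda>p. f (fst p))"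
      by (rule P.Fubini_integrable[OF fstm]) (use int in \<open>auto simp: M.emeasure_finite less_top[symmetric]\<close>)
    then have "integrable (?M \<Otimes>\<^sub>M ?M) (\<lambda>p. (\<phi> (snd p) * mollifier e (fst p - snd p)) *\<^sub>R f (fst p))"
    proof (rule integrable_bounded_scaleR)
      have [measurable]: "fst \<in> borel_measurable (?M \<Otimes>\<^sub>M ?M)" "snd \<in> borel_measurable (?M \<Otimes>\<^sub>M ?M)"
        using measurable_compose[OF measurable_fst idm] measurable_compose[OF measurable_snd idm] by auto
      show "(\<lambda>p. \<phi> (snd p) * mollifier e (fst p - snd p)) \<in> borel_measurable (?M \<Otimes>\<^sub>M ?M)" by measurable
      show "\<bar>\<phi> (snd p) * mollifier e (fst p - snd p)\<bar> \<le> C * B" for p :: "complex \<times> complex"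
        unfolding abs_mult using C B mollifier_nonneg by (intro mult_mono) auto
    qed
    then have "integrable (?M \<Otimes>\<^sub>M ?M) (case_prod (\<lambda>w z. (\<phi> z * mollifier e (w - z)) *\<^sub>R f w))"
      by (simp add: case_prod_beta')
    from P.Fubini_integral[OF this]
    have "(LINT z|?M. LINT w|?M. (\<phi> z * mollifier e (w - z)) *\<^sub>R f w) = (LINT w|?M. LINT z|?M. (\<phi> z * mollifier e (w - z)) *\<^sub>R f w)" .
    moreover have "(LINT w|?M. (\<phi> z * mollifier e (w - z)) *\<^sub>R f w) = \<phi> z *\<^sub>R mollify \<Omega> e f z" for z
      by (simp add: mollify_def flip: scaleR_scaleR)
    moreover have "(LINT z|?M. (\<phi> z * mollifier e (w - z)) *\<^sub>R f w) = G e w *\<^sub>R f w" for w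
      unfolding G_def
    proof (rule integral_scaleR_left)
      assume "f w \<noteq> 0"
      show "integrable ?M (\<lambda>z. \<phi> z * mollifier e (w - z))"
      proof (rule M.integrable_const_bound)
        show "AE z in ?M. norm (\<phi> z * mollifier e (w - z)) \<le> C * B"
          unfolding real_norm_def abs_mult using C B mollifier_nonneg by (intro AE_I2 mult_mono) auto
        show "(\<lambda>z. \<phi> z * mollifier e (w - z)) \<in> borel_measurable ?M" by measurable
      qed
    qed
    ultimately show ?thesis by simp
  qed
  \<comment> \<open>\<phi> vanishes off \<open>\<Omega>\<close>, so \<open>G e w\<close> is an
    integral over the whole plane, an average of \<phi> with total weight 1 over points at distance
    below 2e from w. This holds for w near the boundary too.\<close>
  have close: "\<bar>G e w - \<phi> w\<bar> \<le> \<epsilon>" if "e > 0" "\<epsilon> > 0" and \<delta>: "\<And>x y. dist x y < \<delta> \<Longrightarrow> norm (\<phi> x - \<phi> y) < \<epsilon>" "2 * e < \<delta>" for e \<epsilon> \<delta> w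
  proof -
    have G: "G e w = (LINT z|lborel. \<phi> z * mollifier e (z - w))"
      unfolding G_def mollifier_minus_commute[of e w]
      by (rule integral_lebesgue_on_eq_lborel(1)[OF \<Omega>(1)]) (use \<phi> in auto)
    have i1: "integrable lborel (\<lambda>z. \<phi> z * mollifier e (z - w))"
      using integrable_bounded_scaleR[OF mollifier_integrable[OF that(1), of w], of \<phi> C] C by simp
    have i2: "integrable lborel (\<lambda>z. \<phi> w * mollifier e (z - w))" using mollifier_integrable[OF that(1)] by simp
    have "G e w - \<phi> w = (LINT z|lborel. \<phi> z * mollifier e (z - w)) - (LINT z|lborel. \<phi> w * mollifier e (z - w))"
      unfolding G using integral_mollifier[OF that(1), of w] by simp
    also have "\<dots> = (LINT z|lborel. (\<phi> z - \<phi> w) * mollifier e (z - w))"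
      using i1 i2 by (simp add: left_diff_distrib)
    also have "\<bar>\<dots>\<bar> \<le> (LINT z|lborel. \<epsilon> * mollifier e (z - w))"
    proof (rule integral_abs_bound[THEN order_trans], rule integral_mono)
      show "integrable lborel (\<lambda>z. \<bar>(\<phi> z - \<phi> w) * mollifier e (z - w)\<bar>)"
        using Bochner_Integration.integrable_diff[OF i1 i2] by (simp add: left_diff_distrib)
      show "integrable lborel (\<lambda>z. \<epsilon> * mollifier e (z - w))" using mollifier_integrable[OF that(1)] by simp
      fix z
      show "\<bar>(\<phi> z - \<phi> w) * mollifier e (z - w)\<bar> \<le> \<epsilon> * mollifier e (z - w)"
      proof (cases "cmod (z - w) \<ge> 2 * e")
        case True
        then show ?thesis using mollifier_eq_0[OF that(1)] by simp
      next
        case False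
        then have "\<bar>\<phi> z - \<phi> w\<bar> \<le> \<epsilon>" using \<delta>(1)[of z w] \<delta>(2) by (simp add: dist_norm)
        then show ?thesis using mollifier_nonneg by (simp add: abs_mult mult_right_mono)
      qed
    qed
    also have "\<dots> = \<epsilon>" using integral_mollifier[OF that(1), of w] by simp
    finally show ?thesis .
  qed
  define I where "I = (LINT w|?M. norm (f w))"
  have I: "I \<ge> 0" unfolding I_def by (intro integral_nonneg_AE) auto
  show ?thesis
  proof (rule LIMSEQ_I)
    fix r :: real assume r: "r > 0"
    \<comment> \<open>The denominator I + 1 yields \<epsilon> I < r even if I = 0.\<close>
    define \<epsilon> where "\<epsilon> = r / (I + 1)"
    have \<epsilon>: "\<epsilon> > 0" using r I by (simp add: \<epsilon>_def)
    obtain \<delta> where \<delta>: "\<delta> > 0" "\<And>x y. dist x y < \<delta> \<Longrightarrow> norm (\<phi> x - \<phi> y) < \<epsilon>"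
      using uniformly_continuous_compact_support[OF \<phi>(1,2,4) \<epsilon>] by metis
    obtain N :: nat where N: "2 / \<delta> < N" using reals_Archimedean2 by blast
    have "norm ((LINT z|?M. \<phi> z *\<^sub>R mollify \<Omega> (1 / real (Suc n)) f z) - (LINT w|?M. \<phi> w *\<^sub>R f w)) < r"
      if "n \<ge> N" for n
    proof -
      let ?e = "1 / real (Suc n)"
      have "2 / \<delta> < real (Suc n)" using N that by linarith
      then have e\<delta>: "2 * ?e < \<delta>" using \<delta>(1) by (simp add: field_simps)
      have cl: "\<bar>G ?e w - \<phi> w\<bar> \<le> \<epsilon>" for w by (rule close[OF _ \<epsilon> \<delta>(2) e\<delta>]) simp_all
      have Gb: "\<bar>G ?e w\<bar> \<le> C + \<epsilon>" for w using cl[of w] C(2)[of w] by linarith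
      have Gm: "G ?e \<in> borel_measurable ?M"
        unfolding G_def[abs_def] by (rule M.borel_measurable_lebesgue_integral) measurable
      have i1: "integrable ?M (\<lambda>w. G ?e w *\<^sub>R f w)" by (rule integrable_bounded_scaleR[OF int Gm Gb])
      have i2: "integrable ?M (\<lambda>w. \<phi> w *\<^sub>R f w)" by (rule integrable_bounded_scaleR[OF int \<phi>m C(2)])
      have "(LINT z|?M. \<phi> z *\<^sub>R mollify \<Omega> ?e f z) - (LINT w|?M. \<phi> w *\<^sub>R f w)
         = (LINT w|?M. (G ?e w - \<phi> w) *\<^sub>R f w)"
        using i1 i2 by (subst swap) (simp_all add: scaleR_diff_left)
      also have "norm \<dots> \<le> (LINT w|?M. \<epsilon> * norm (f w))"
      proof (rule integral_norm_bound[THEN order_trans], rule integral_mono)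
        show "integrable ?M (\<lambda>w. norm ((G ?e w - \<phi> w) *\<^sub>R f w))"
          using Bochner_Integration.integrable_diff[OF i1 i2] by (simp only: scaleR_diff_left) (rule integrable_norm)
        show "integrable ?M (\<lambda>w. \<epsilon> * norm (f w))" using int by simp
        show "norm ((G ?e w - \<phi> w) *\<^sub>R f w) \<le> \<epsilon> * norm (f w)" for w
          using cl[of w] by (simp add: mult_right_mono)
      qed
      also have "\<dots> = \<epsilon> * I" by (simp add: I_def)
      also have "\<dots> < r" using r I by (simp add: \<epsilon>_def field_simps)
      finally show ?thesis .
    qed
    then show "\<exists>N. \<forall>n\<ge>N. norm ((LINT z|?M. \<phi> z *\<^sub>R mollify \<Omega> (1 / real (Suc n)) f z) - (LINT w|?M. \<phi> w *\<^sub>R f w)) < r"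
      by blast
  qed
qed

text \<open>One radius serves the whole compact set. The discs of radius 2e carry the mollifiers,
  which thus become test functions for every centre in \<open>K\<close> at once.\<close>

lemma eventually_cball_subset:
  assumes "open \<Omega>" "compact K" "K \<subseteq> (\<Omega> :: 'a::euclidean_space set)"
  shows "\<forall>\<^sub>F n in sequentially. \<forall>z\<in>K. cball z (2 * (1 / real (Suc n))) \<subseteq> \<Omega>"
proof -
  obtain d where d: "d > 0" "(\<Union>z\<in>K. cball z d) \<subseteq> \<Omega>"
    using compact_subset_open_imp_cball_epsilon_subset[OF assms(2,1,3)] by auto
  obtain N :: nat where N: "2 / d < N" using reals_Archimedean2 by blast
  show ?thesis
  proof (rule eventually_sequentiallyI[of N], rule ballI)
    fix n z assume "n \<ge> N" "z \<in> K"
    then have "2 / d < real (Suc n)" using N by linarith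
    then have "2 * (1 / real (Suc n)) \<le> d" using d(1) by (simp add: field_simps)
    then have "cball z (2 * (1 / real (Suc n))) \<subseteq> cball z d" by (rule subset_cball)
    then show "cball z (2 * (1 / real (Suc n))) \<subseteq> \<Omega>" using d(2) \<open>z \<in> K\<close> by blast
  qed
qed

text \<open>For small radius and x in the support of \<phi>, the value of \<open>mollify\<close> at
  x is itself a pairing of \<open>f\<close> with a test function, hence zero; the limit of the
  mollified pairings is the pairing with \<phi>.\<close>

lemma fundamental_lemma_continuous:
  fixes f :: "complex \<Rightarrow> real"
  assumes \<Omega>: "open \<Omega>" "bounded \<Omega>" and f: "f \<in> l2 (lebesgue_on \<Omega>)"
    and z: "\<forall>\<phi>\<in>test_functions \<Omega>. (LINT x|lebesgue_on \<Omega>. f x * \<phi> x) = 0"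
    and \<phi>: "continuous_on UNIV \<phi>" "compact K" "K \<subseteq> \<Omega>" "\<And>x. x \<notin> K \<Longrightarrow> \<phi> x = 0"
  shows "(LINT x|lebesgue_on \<Omega>. \<phi> x * f x) = 0"
proof -
  have "\<forall>\<^sub>F n in sequentially. (LINT z|lebesgue_on \<Omega>. \<phi> z *\<^sub>R mollify \<Omega> (1 / real (Suc n)) f z) = 0"
    using eventually_cball_subset[OF \<Omega>(1) \<phi>(2,3)]
  proof eventually_elim
    case (elim n)
    have "\<phi> x *\<^sub>R mollify \<Omega> (1 / real (Suc n)) f x = 0" for x
    proof (cases "x \<in> K")
      case True
      then show ?thesis
        using z[rule_format, OF mollifier_test_function[of "1 / real (Suc n)" x]] elim by (simp add: mollify_def mult.commute)
    qed (use \<phi> in simp)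
    then show ?case by (simp only: integral_zero)
  qed
  then have "(\<lambda>n. LINT z|lebesgue_on \<Omega>. \<phi> z *\<^sub>R mollify \<Omega> (1 / real (Suc n)) f z) \<longlonglongrightarrow> 0"
    by (rule tendsto_eventually)
  with mollification_tendsto[OF \<Omega> f \<phi>] show ?thesis using LIMSEQ_unique by fastforce
qed

text \<open>The indicator of \<open>K\<close> is a decreasing limit of piecewise linear functions of
  the distance to \<open>K\<close>, all supported in one compact neighbourhood inside
  \<open>\<Omega>\<close>; the dominating function is |f|.\<close>

lemma fundamental_lemma_compact:
  fixes f :: "complex \<Rightarrow> real"
  assumes \<Omega>: "open \<Omega>" "bounded \<Omega>" and f: "f \<in> l2 (lebesgue_on \<Omega>)"
    and z: "\<forall>\<phi>\<in>test_functions \<Omega>. (LINT x|lebesgue_on \<Omega>. f x * \<phi> x) = 0"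
    and K: "compact K" "K \<subseteq> \<Omega>"
  shows "(LINT x|lebesgue_on \<Omega>. indicator K x * f x) = 0"
\<comment> \<open>The distance to the empty set is 0 by convention, which would make the cutoff
  equal to 1 everywhere.\<close>
proof (cases "K = {}")
  case False
  let ?M = "lebesgue_on \<Omega>"
  have int: "integrable ?M f" by (rule l2_imp_integrable[OF finite_measure_bounded_open[OF \<Omega>] f])
  obtain d where d: "d > 0" "(\<Union>z\<in>K. cball z d) \<subseteq> \<Omega>"
    using compact_subset_open_imp_cball_epsilon_subset[OF K(1) \<Omega>(1) K(2)] by auto
  define cut where "cut n x = max 0 (1 - real (Suc n) / d * infdist x K)" for n x
  have cutc: "continuous_on UNIV (cut n)" for n unfolding cut_def[abs_def] by (intro continuous_intros)
  have cut1: "\<bar>cut n x\<bar> \<le> 1" for n x using d infdist_nonneg[of x K] by (simp add: cut_def)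
  have zero: "(LINT x|?M. cut n x * f x) = 0" for n
  proof (rule fundamental_lemma_continuous[OF \<Omega> f z cutc])
    show "compact {x. infdist x K \<le> d}" using compact_infdist_le[OF False K(1) d(1)] .
    show "{x. infdist x K \<le> d} \<subseteq> \<Omega>"
    proof
      fix x assume "x \<in> {x. infdist x K \<le> d}"
      moreover obtain y where "y \<in> K" "infdist x K = dist x y" 
        using infdist_attains_inf[OF compact_imp_closed[OF K(1)] False] by metis
      ultimately have "x \<in> cball y d" by (simp add: dist_commute)
      then show "x \<in> \<Omega>" using d(2) \<open>y \<in> K\<close> by blast
    qed
    show "cut n x = 0" if "x \<notin> {x. infdist x K \<le> d}" for x
    proof -
      have "infdist x K / d \<ge> 1" using that d by (simp add: field_simps)
      then have "real (Suc n) * (infdist x K / d) \<ge> 1 * 1" by (intro mult_mono) auto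
      then show ?thesis by (simp add: cut_def)
    qed
  qed
  have "(\<lambda>n. LINT x|?M. cut n x * f x) \<longlonglongrightarrow> (LINT x|?M. indicator K x * f x)"
  proof (rule integral_dominated_convergence[where w = "\<lambda>x. norm (f x)"])
    have [measurable]: "f \<in> borel_measurable ?M" using l2D(1)[OF f] .
    have [measurable]: "cut n \<in> borel_measurable ?M" for n
      by (rule measurable_lebesgue_on_borel[OF \<Omega>(1) borel_measurable_continuous_onI[OF cutc]])
    have [measurable]: "(indicator K :: complex \<Rightarrow> real) \<in> borel_measurable ?M"
      by (rule measurable_lebesgue_on_borel[OF \<Omega>(1)]) (use compact_imp_closed[OF K(1)] in simp)
    show "(\<lambda>x. indicator K x * f x) \<in> borel_measurable ?M" "(\<lambda>x. cut n x * f x) \<in> borel_measurable ?M" for n by auto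
    show "integrable ?M (\<lambda>x. norm (f x))" using int by simp
    show "AE x in ?M. norm (cut n x * f x) \<le> norm (f x)" for n
      using cut1 by (auto simp: abs_mult mult_left_le_one_le)
    have "(\<lambda>n. cut n x) \<longlonglongrightarrow> indicator K x" for x
    proof (cases "x \<in> K")
      case True
      then show ?thesis by (simp add: cut_def)
    next
      case False
      then have p: "infdist x K > 0"
        using \<open>K \<noteq> {}\<close> K(1) by (metis compact_imp_closed in_closed_iff_infdist_zero infdist_nonneg less_eq_real_def)
      obtain N :: nat where N: "d / infdist x K < N" using reals_Archimedean2 by blast
      have "cut n x = 0" if "n \<ge> N" for n
      proof -
        have "d / infdist x K < real (Suc n)" using N that by linarith
        then show ?thesis using p d by (simp add: cut_def field_simps)
      qed
      then have "\<forall>\<^sub>F n in sequentially. cut n x = 0" by (auto simp: eventually_sequentially)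
      then show ?thesis using False by (simp add: tendsto_eventually)
    qed
    then show "AE x in ?M. (\<lambda>n. cut n x * f x) \<longlonglongrightarrow> indicator K x * f x"
      by (intro AE_I2 tendsto_mult_right)
  qed
  then show ?thesis using zero by (simp add: LIMSEQ_const_iff)
qed simp

text \<open>Inner regularity fills the set where f > 0 by a closed \<open>T\<close> up to measure e;
  \<open>T\<close> is compact because \<open>\<Omega>\<close> is bounded. The integral of
  \<open>f\<close> over \<open>T\<close> is zero while \<open>f\<close> is positive there, so
  \<open>T\<close> is null.\<close>

lemma fundamental_lemma_nonpos:
  fixes f :: "complex \<Rightarrow> real"
  assumes \<Omega>: "open \<Omega>" "bounded \<Omega>" and f: "f \<in> l2 (lebesgue_on \<Omega>)"
    and z: "\<forall>\<phi>\<in>test_functions \<Omega>. (LINT x|lebesgue_on \<Omega>. f x * \<phi> x) = 0"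
  shows "AE x in lebesgue_on \<Omega>. f x \<le> 0"
proof -
  let ?M = "lebesgue_on \<Omega>"
  have \<Omega>s: "\<Omega> \<in> sets lebesgue" using \<Omega> by simp
  have [measurable]: "f \<in> borel_measurable ?M" using l2D(1)[OF f] .
  have int: "integrable ?M f" by (rule l2_imp_integrable[OF finite_measure_bounded_open[OF \<Omega>] f])
  define P where "P = {x \<in> \<Omega>. f x > 0}"
  have "{x \<in> space ?M. f x > 0} \<in> sets ?M" by measurable
  then have P: "P \<in> sets lebesgue"
    using \<Omega>s by (simp add: P_def sets_restrict_space_iff)
  have "emeasure lebesgue P \<le> 0"
  proof (rule ennreal_le_epsilon)
    fix e :: real assume e: "0 < e"
    obtain T where T: "closed T" "T \<subseteq> P" "P - T \<in> lmeasurable" "emeasure lebesgue (P - T) < ennreal e"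
      using sets_lebesgue_inner_closed[OF P e] .
    have Tc: "compact T" using T(1,2) \<Omega>(2) bounded_subset by (auto simp: compact_eq_bounded_closed P_def)
    have T\<Omega>: "T \<subseteq> \<Omega>" using T(2) by (auto simp: P_def)
    have [measurable]: "(indicator T :: complex \<Rightarrow> real) \<in> borel_measurable ?M"
      by (rule measurable_lebesgue_on_borel[OF \<Omega>(1)]) (use T(1) in simp)
    have "integrable ?M (\<lambda>x. indicator T x *\<^sub>R f x)"
      by (rule integrable_bounded_scaleR[OF int, of _ 1]) (auto simp: abs_indicator indicator_le_1)
    then have "integrable ?M (\<lambda>x. indicator T x * f x)" by simp
    then have "AE x in ?M. indicator T x * f x = 0"
      using fundamental_lemma_compact[OF \<Omega> f z Tc T\<Omega>] T(2)
      by (subst (asm) integral_nonneg_eq_0_iff_AE) (auto simp: P_def less_imp_le subset_iff intro!: AE_I2 split: split_indicator)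
    then have "AE x in lebesgue. x \<in> \<Omega> \<longrightarrow> indicator T x * f x = 0"
      using \<Omega>s by (simp add: AE_restrict_space_iff)
    then have "AE x in lebesgue. x \<notin> T"
      by eventually_elim (use T(2) in \<open>auto simp: P_def indicator_def subset_iff\<close>)
    then have "emeasure lebesgue T = 0"
      using T(1) by (subst (asm) AE_iff_measurable[of T]) auto
    moreover have "emeasure lebesgue P \<le> emeasure lebesgue T + emeasure lebesgue (P - T)"
    proof -
      have "P = T \<union> (P - T)" using T(2) by auto
      then show ?thesis using emeasure_subadditive[of T lebesgue "P - T"] T by (metis borel_closed fmeasurableD sets_completionI_sets sets_lborel)
    qed
    ultimately show "emeasure lebesgue P \<le> 0 + ennreal e" using T(4) by (simp add: less_imp_le)
  qed
  then have "P \<in> null_sets lebesgue" using P by auto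
  then have "AE x in lebesgue. x \<notin> P" by (rule AE_not_in)
  then have "AE x in lebesgue. x \<in> \<Omega> \<longrightarrow> f x \<le> 0" by eventually_elim (auto simp: P_def)
  then show ?thesis using \<Omega>s by (simp add: AE_restrict_space_iff)
qed

lemma fundamental_lemma:
  fixes f :: "complex \<Rightarrow> real"
  assumes \<Omega>: "open \<Omega>" "bounded \<Omega>" and f: "f \<in> l2 (lebesgue_on \<Omega>)"
    and z: "\<forall>\<phi>\<in>test_functions \<Omega>. (LINT x|lebesgue_on \<Omega>. f x * \<phi> x) = 0"
  shows "AE x in lebesgue_on \<Omega>. f x = 0"
proof -
  have "AE x in lebesgue_on \<Omega>. - f x \<le> 0"
    by (rule fundamental_lemma_nonpos[OF \<Omega>]) (use l2_scaleR[OF f, of "-1"] z in auto)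
  with fundamental_lemma_nonpos[OF \<Omega> f z] show ?thesis by eventually_elim auto
qed

section \<open>Weyl's lemma for the Cauchy-Riemann equations\<close>

lemma test_functions_mono: "U \<subseteq> \<Omega> \<Longrightarrow> test_functions U \<subseteq> test_functions \<Omega>"
  by (auto simp: test_functions_def)

lemma integral_lebesgue_on_subset:
  fixes f :: "'a::euclidean_space \<Rightarrow> 'b::euclidean_space"
  assumes "open U" "open \<Omega>" "U \<subseteq> \<Omega>" "\<And>x. x \<notin> U \<Longrightarrow> f x = 0"
  shows "(LINT x|lebesgue_on U. f x) = (LINT x|lebesgue_on \<Omega>. f x)"
proof -
  have "(\<lambda>x. if x \<in> U then f x else 0) = (\<lambda>x. if x \<in> \<Omega> then f x else 0)" using assms(3,4) by (auto simp: fun_eq_iff)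
  then show ?thesis
    using Lebesgue_Measure.integral_restrict_UNIV[of U f] Lebesgue_Measure.integral_restrict_UNIV[of \<Omega> f] assms by simp
qed

lemma l2_subset:
  fixes f :: "'a::euclidean_space \<Rightarrow> 'b::euclidean_space"
  assumes "f \<in> l2 (lebesgue_on \<Omega>)" "open U" "open \<Omega>" "U \<subseteq> \<Omega>"
  shows "f \<in> l2 (lebesgue_on U)"
proof -
  have "f \<in> borel_measurable (lebesgue_on U)"
    using l2D(1)[OF assms(1)] assms(4) measurable_restrict_mono by blast
  moreover have "integrable (lebesgue_on U) (\<lambda>x. (norm (f x))\<^sup>2)"
  proof -
    have "set_integrable lebesgue \<Omega> (\<lambda>x. (norm (f x))\<^sup>2)"
      using l2D(2)[OF assms(1)] assms(3) by (simp add: integrable_restrict_space set_integrable_def)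
    then have "set_integrable lebesgue U (\<lambda>x. (norm (f x))\<^sup>2)"
      by (rule set_integrable_subset) (use assms in auto)
    then show ?thesis using assms(2) by (simp add: integrable_restrict_space set_integrable_def)
  qed
  ultimately show ?thesis by (simp add: l2_def)
qed

lemma l2_bounded:
  fixes f :: "'a \<Rightarrow> 'b::euclidean_space"
  assumes "finite_measure M" "f \<in> borel_measurable M" "\<And>x. x \<in> space M \<Longrightarrow> norm (f x) \<le> B"
  shows "f \<in> l2 M"
proof -
  interpret finite_measure M by fact
  note [measurable] = assms(2)
  have "integrable M (\<lambda>x. (norm (f x))\<^sup>2)"
    by (rule integrable_const_bound[of _ "B\<^sup>2"]) (auto intro!: AE_I2 power_mono assms(3))
  then show ?thesis using assms(2) by (simp add: l2_def)
qed

text \<open>The Taylor remainder is uniform in \<zeta> because the partial derivatives are uniformly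
  continuous. This is what allows differentiation under an integral against a function that is
  merely integrable.\<close>

lemma mollifier_uniform_derivative:
  assumes e: "e > 0" and \<epsilon>: "\<epsilon> > 0"
  obtains \<delta> where "\<delta> > 0" "\<And>\<zeta> h. cmod h < \<delta> \<Longrightarrow>
    \<bar>mollifier e (\<zeta> - h) - mollifier e \<zeta> + (Re h * partial_deriv 1 (mollifier e) \<zeta> + Im h * partial_deriv \<i> (mollifier e) \<zeta>)\<bar> \<le> \<epsilon> * cmod h"
proof -
  let ?g = "mollifier e"
  have test: "?g \<in> test_functions UNIV" using mollifier_test_function[OF e, of 0 UNIV] by simp
  have lin: "partial_deriv h ?g \<zeta> = Re h * partial_deriv 1 ?g \<zeta> + Im h * partial_deriv \<i> ?g \<zeta>" for h \<zeta>
  proof -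
    have l: "linear (\<lambda>h. partial_deriv h ?g \<zeta>)" using has_derivative_linear[OF test_function_has_derivative[OF test]] .
    have "h = Re h *\<^sub>R 1 + Im h *\<^sub>R \<i>" by (simp add: complex_eq_iff)
    then show ?thesis using linear_add[OF l, of "Re h *\<^sub>R 1" "Im h *\<^sub>R \<i>"] linear_cmul[OF l] by simp
  qed
  obtain K where K: "compact K" "\<And>x b. x \<notin> K \<Longrightarrow> partial_deriv b ?g x = 0"
    using test_functionE[OF test] by metis
  have "\<exists>d>0. \<forall>x y. dist x y < d \<longrightarrow> norm (partial_deriv b ?g x - partial_deriv b ?g y) < \<epsilon> / 2" if "b \<in> Basis" for b
    using uniformly_continuous_compact_support[OF test_function_partial_continuous[OF test that] K(1) K(2), of "\<epsilon> / 2"] \<epsilon>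
    by (metis half_gt_zero)
  from this[of 1] this[of \<i>] obtain d1 d2 where d: "d1 > 0" "d2 > 0"
    "\<And>x y. dist x y < d1 \<Longrightarrow> norm (partial_deriv 1 ?g x - partial_deriv 1 ?g y) < \<epsilon> / 2"
    "\<And>x y. dist x y < d2 \<Longrightarrow> norm (partial_deriv \<i> ?g x - partial_deriv \<i> ?g y) < \<epsilon> / 2"
    by (auto simp: Basis_complex_def)
  show ?thesis
  proof (rule that[of "min d1 d2"])
    fix \<zeta> h assume h: "cmod h < min d1 d2"
    \<comment> \<open>The linear term is added to the function before the mean value theorem is
      used, so that its derivative is a difference of partial derivatives at nearby points.\<close>
    have der: "((\<lambda>t. ?g (\<zeta> - t *\<^sub>R h) + t * partial_deriv h ?g \<zeta>) has_derivative
        (\<lambda>u. partial_deriv (- (u *\<^sub>R h)) ?g (\<zeta> - t *\<^sub>R h) + u * partial_deriv h ?g \<zeta>)) (at t)" for t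
    proof -
      have "((\<lambda>t. \<zeta> - t *\<^sub>R h) has_derivative (\<lambda>u. - (u *\<^sub>R h))) (at t)" by (auto intro!: derivative_eq_intros)
      from has_derivative_compose[OF this test_function_has_derivative[OF test]]
      show ?thesis by (auto intro!: derivative_eq_intros)
    qed
    obtain t where t: "t \<in> {0<..<1}" "norm ((?g (\<zeta> - 1 *\<^sub>R h) + 1 * partial_deriv h ?g \<zeta>) - (?g (\<zeta> - 0 *\<^sub>R h) + 0 * partial_deriv h ?g \<zeta>))
        \<le> norm (partial_deriv (- ((1 - 0) *\<^sub>R h)) ?g (\<zeta> - t *\<^sub>R h) + (1 - 0) * partial_deriv h ?g \<zeta>)"
      using mvt_general[OF zero_less_one continuous_at_imp_continuous_on der] has_derivative_continuous[OF der] by blast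
    have "t * cmod h \<le> cmod h" using t(1) by (simp add: mult_left_le_one_le)
    then have dd: "dist \<zeta> (\<zeta> - t *\<^sub>R h) < d1" "dist \<zeta> (\<zeta> - t *\<^sub>R h) < d2" using h t(1) by (auto simp: dist_norm)
    have "\<bar>?g (\<zeta> - h) - ?g \<zeta> + partial_deriv h ?g \<zeta>\<bar> \<le> \<bar>partial_deriv (- h) ?g (\<zeta> - t *\<^sub>R h) + partial_deriv h ?g \<zeta>\<bar>"
      using t(2) by (simp add: algebra_simps)
    also have "\<dots> = \<bar>Re h * (partial_deriv 1 ?g \<zeta> - partial_deriv 1 ?g (\<zeta> - t *\<^sub>R h)) + Im h * (partial_deriv \<i> ?g \<zeta> - partial_deriv \<i> ?g (\<zeta> - t *\<^sub>R h))\<bar>"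
      unfolding lin[of h] lin[of "- h"] by (simp add: algebra_simps)
    also have "\<dots> \<le> \<bar>Re h\<bar> * (\<epsilon> / 2) + \<bar>Im h\<bar> * (\<epsilon> / 2)"
      using d(3)[OF dd(1), unfolded real_norm_def, THEN less_imp_le] d(4)[OF dd(2), unfolded real_norm_def, THEN less_imp_le]
      by (intro order_trans[OF abs_triangle_ineq] add_mono; unfold abs_mult; intro mult_left_mono abs_ge_zero)
    also have "\<dots> \<le> cmod h * (\<epsilon> / 2) + cmod h * (\<epsilon> / 2)"
      using \<epsilon> abs_Re_le_cmod[of h] abs_Im_le_cmod[of h] by (intro add_mono mult_right_mono) auto
    also have "\<dots> = \<epsilon> * cmod h" by simp
    finally show "\<bar>?g (\<zeta> - h) - ?g \<zeta> + (Re h * partial_deriv 1 ?g \<zeta> + Im h * partial_deriv \<i> ?g \<zeta>)\<bar> \<le> \<epsilon> * cmod h"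
      unfolding lin[of h] .
  qed (use d in simp)
qed

text \<open>Differentiation under the integral gives the real derivative h \<mapsto> -(Re h A + Im h
  B). The mollifier centred at z is an admissible test function, and the weak Cauchy-Riemann
  equation for it makes this map complex linear.\<close>

lemma mollification_has_field_derivative:
  assumes \<Omega>: "open \<Omega>" "bounded \<Omega>" and f: "f \<in> l2 (lebesgue_on \<Omega>)" "weakly_holomorphic \<Omega> f"
    and e: "e > 0" "cball z (2 * e) \<subseteq> \<Omega>"
  shows "(mollify \<Omega> e f has_field_derivative
    - (LINT w|lebesgue_on \<Omega>. partial_deriv 1 (mollifier e) (w - z) *\<^sub>R f w)) (at z)"
proof -
  let ?M = "lebesgue_on \<Omega>" and ?g = "mollifier e"
  let ?a = "partial_deriv 1 ?g" and ?b = "partial_deriv \<i> ?g"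
  define A where "A = (LINT w|?M. ?a (w - z) *\<^sub>R f w)"
  define B where "B = (LINT w|?M. ?b (w - z) *\<^sub>R f w)"
  have fin: "finite_measure ?M" using finite_measure_bounded_open[OF \<Omega>] .
  have int: "integrable ?M f" by (rule l2_imp_integrable[OF fin f(1)])
  have idm [measurable]: "(\<lambda>x. x) \<in> borel_measurable ?M" using measurable_lebesgue_on_borel[OF \<Omega>(1), of "\<lambda>x. x"] by simp
  have test0: "?g \<in> test_functions UNIV" using mollifier_test_function[OF e(1), of 0 UNIV] by simp
  have test: "(\<lambda>w. ?g (w - z)) \<in> test_functions \<Omega>" by (rule mollifier_test_function[OF e])
  have pd: "partial_deriv c (\<lambda>w. ?g (w - z)) w = partial_deriv c ?g (w - z)" for c w
  proof (rule partial_deriv_eq)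
    have "((\<lambda>w. w - z) has_derivative (\<lambda>h. h)) (at w)" by (auto intro!: derivative_eq_intros)
    from has_derivative_compose[OF this test_function_has_derivative[OF test0]]
    show "((\<lambda>w. ?g (w - z)) has_derivative (\<lambda>c. partial_deriv c ?g (w - z))) (at w)" .
  qed
  have pbound: "\<exists>C. \<forall>x. \<bar>partial_deriv c ?g x\<bar> \<le> C" if "c \<in> Basis" for c
  proof -
    obtain K where K: "compact K" "\<And>x b. x \<notin> K \<Longrightarrow> partial_deriv b ?g x = 0"
      using test_functionE[OF test0] by metis
    have "bounded (partial_deriv c ?g ` K)"
      by (intro compact_imp_bounded compact_continuous_image continuous_on_subset[OF test_function_partial_continuous[OF test0 that]] K) auto
    then obtain C where C: "\<And>x. x \<in> K \<Longrightarrow> norm (partial_deriv c ?g x) \<le> C" unfolding bounded_iff by blast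
    have "\<bar>partial_deriv c ?g x\<bar> \<le> max C 0" for x using C[of x] K(2)[of x c] by (cases "x \<in> K") auto
    then show ?thesis by blast
  qed
  have pint: "integrable ?M (\<lambda>w. partial_deriv c ?g (w - z) *\<^sub>R f w)" if c: "c \<in> Basis" for c
  proof -
    have [measurable]: "partial_deriv c ?g \<in> borel_measurable borel"
      using test_function_partial_continuous[OF test0 c] by (rule borel_measurable_continuous_onI)
    have m: "(\<lambda>w. partial_deriv c ?g (w - z)) \<in> borel_measurable ?M" by measurable
    obtain C where "\<And>x. \<bar>partial_deriv c ?g x\<bar> \<le> C" using pbound[OF c] by blast
    then show ?thesis by (rule integrable_bounded_scaleR[OF int m])
  qed
  have p1: "integrable ?M (\<lambda>w. ?a (w - z) *\<^sub>R f w)" and p2: "integrable ?M (\<lambda>w. ?b (w - z) *\<^sub>R f w)"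
    by (auto intro!: pint simp: Basis_complex_def)
  have gint: "integrable ?M (\<lambda>w. ?g (w - y) *\<^sub>R f w)" for y
  proof -
    obtain C where "\<And>z. ?g z \<le> C" using mollifier_bounded[OF e(1)] by metis
    then show ?thesis using mollifier_nonneg by (intro integrable_bounded_scaleR[OF int, of _ C]) auto
  qed
  \<comment> \<open>The inclusion of the disc in \<open>\<Omega>\<close> enters here. The identity
    says B = \<i> A, whence the real derivative is multiplication by -A.\<close>
  have AB: "A + \<i> * B = 0"
  proof -
    have "0 = (LINT w|?M. f w * Complex (?a (w - z)) (?b (w - z)))"
      using f(2) test unfolding weakly_holomorphic_def pd[symmetric] by simp
    also have "\<dots> = (LINT w|?M. ?a (w - z) *\<^sub>R f w + \<i> * (?b (w - z) *\<^sub>R f w))"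
      by (simp add: Complex_eq scaleR_conv_of_real algebra_simps)
    also have "\<dots> = A + \<i> * B"
      unfolding A_def B_def by (simp only: Bochner_Integration.integral_add[OF p1 integrable_mult_right[OF p2]] integral_mult_right_zero)
    finally show ?thesis by simp
  qed
  have AB': "of_real (Re h) * A + of_real (Im h) * B = A * h" for h
  proof -
    have "B = \<i> * A" using AB by (simp add: complex_eq_iff)
    then show ?thesis by (simp add: complex_eq_iff algebra_simps)
  qed
  define I where "I = (LINT w|?M. norm (f w))"
  have I: "I \<ge> 0" unfolding I_def by (intro integral_nonneg_AE) auto
  have "((\<lambda>y. LINT w|?M. ?g (w - y) *\<^sub>R f w) has_derivative (\<lambda>h. - A * h)) (at z)"
    unfolding has_derivative_at_alt
  proof (intro conjI allI impI)
    show "bounded_linear (\<lambda>h. - A * h)" by (rule bounded_linear_mult_right)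
    fix r :: real assume r: "r > 0"
    define \<epsilon> where "\<epsilon> = r / (I + 1)"
    have \<epsilon>: "\<epsilon> > 0" using r I by (simp add: \<epsilon>_def)
    obtain \<delta> where \<delta>: "\<delta> > 0" "\<And>\<zeta> h. cmod h < \<delta> \<Longrightarrow> \<bar>?g (\<zeta> - h) - ?g \<zeta> + (Re h * ?a \<zeta> + Im h * ?b \<zeta>)\<bar> \<le> \<epsilon> * cmod h"
      using mollifier_uniform_derivative[OF e(1) \<epsilon>] by metis
    show "\<exists>d>0. \<forall>y. norm (y - z) < d \<longrightarrow>
        norm ((LINT w|?M. ?g (w - y) *\<^sub>R f w) - (LINT w|?M. ?g (w - z) *\<^sub>R f w) - (- A * (y - z))) \<le> r * norm (y - z)"
    proof (intro exI[of _ \<delta>] conjI allI impI \<delta>(1))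
      fix y assume y: "norm (y - z) < \<delta>"
      let ?h = "y - z"
      let ?L = "\<lambda>w. Re ?h *\<^sub>R (?a (w - z) *\<^sub>R f w) + Im ?h *\<^sub>R (?b (w - z) *\<^sub>R f w)"
      have eq: "(LINT w|?M. ?g (w - y) *\<^sub>R f w) - (LINT w|?M. ?g (w - z) *\<^sub>R f w) - (- A * ?h)
        = (LINT w|?M. ?g (w - y) *\<^sub>R f w - ?g (w - z) *\<^sub>R f w + ?L w)"
        using gint p1 p2 AB'[of ?h] by (simp add: A_def B_def scaleR_conv_of_real)
      have le: "norm (?g (w - y) *\<^sub>R f w - ?g (w - z) *\<^sub>R f w + ?L w)
          \<le> (\<epsilon> * norm ?h) * norm (f w)" for w
      proof -
        have "?g (w - y) *\<^sub>R f w - ?g (w - z) *\<^sub>R f w + ?L w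
          = (?g ((w - z) - ?h) - ?g (w - z) + (Re ?h * ?a (w - z) + Im ?h * ?b (w - z))) *\<^sub>R f w"
          by (simp add: scaleR_left.diff scaleR_add_left)
        then show ?thesis using \<delta>(2)[OF y, of "w - z"] by (simp add: mult_right_mono)
      qed
      have "norm (LINT w|?M. ?g (w - y) *\<^sub>R f w - ?g (w - z) *\<^sub>R f w + ?L w)
         \<le> (LINT w|?M. (\<epsilon> * norm ?h) * norm (f w))"
      proof (rule integral_norm_bound[THEN order_trans], rule integral_mono[OF _ _ le])
        show "integrable ?M (\<lambda>w. norm (?g (w - y) *\<^sub>R f w - ?g (w - z) *\<^sub>R f w + ?L w))"
          by (intro integrable_norm Bochner_Integration.integrable_add Bochner_Integration.integrable_diff integrable_scaleR_right gint p1 p2)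
        show "integrable ?M (\<lambda>w. (\<epsilon> * norm ?h) * norm (f w))" using int by simp
      qed
      also have "\<dots> = \<epsilon> * I * norm ?h" by (simp add: I_def)
      also have "\<dots> \<le> r * norm ?h"
      proof (rule mult_right_mono)
        show "\<epsilon> * I \<le> r" using r I by (simp add: \<epsilon>_def field_simps)
      qed simp
      finally show "norm ((LINT w|?M. ?g (w - y) *\<^sub>R f w) - (LINT w|?M. ?g (w - z) *\<^sub>R f w) - (- A * ?h)) \<le> r * norm ?h"
        unfolding eq .
    qed
  qed
  then show ?thesis unfolding has_field_derivative_def mollify_def[abs_def] A_def .
qed

text \<open>As the mollified value does not depend on the admissible radius, it defines one function
  \<open>F\<close> on all of \<open>\<Omega>\<close>. Near each point \<open>F\<close> agrees with a
  mollification of fixed radius, which is differentiable; equality with \<open>f\<close> is tested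
  on compactly supported functions.\<close>

lemma weakly_holomorphic_imp_holomorphic:
  assumes \<Omega>: "open \<Omega>" "bounded \<Omega>" and f: "f \<in> l2 (lebesgue_on \<Omega>)" "weakly_holomorphic \<Omega> f"
  obtains F where "F holomorphic_on \<Omega>" "AE z in lebesgue_on \<Omega>. f z = F z"
proof -
  let ?M = "lebesgue_on \<Omega>"
  have cb: "\<exists>d>0. cball z d \<subseteq> \<Omega>" if "z \<in> \<Omega>" for z
    using \<Omega>(1) that by (simp add: open_contains_cball)
  have "\<exists>e>0. cball z (2 * e) \<subseteq> \<Omega>" if z: "z \<in> \<Omega>" for z
  proof -
    obtain d where "d > 0" "cball z d \<subseteq> \<Omega>" using cb[OF z] by metis
    then show ?thesis by (intro exI[of _ "d / 2"]) simp
  qed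
  then obtain rad where rad: "\<And>z. z \<in> \<Omega> \<Longrightarrow> rad z > 0 \<and> cball z (2 * rad z) \<subseteq> \<Omega>" by metis
  define F where "F z = mollify \<Omega> (rad z) f z" for z
  have F_eq: "F z = mollify \<Omega> e f z" if "z \<in> \<Omega>" "e > 0" "cball z (2 * e) \<subseteq> \<Omega>" for z e
    unfolding F_def using mollifier_independent_radius[OF \<Omega>(1) f] rad[OF that(1)] that by blast
  have der: "F field_differentiable (at z)" if z: "z \<in> \<Omega>" for z
  proof -
    \<comment> \<open>A disc of radius 2e around a point of \<open>ball z e\<close> stays within
      distance 3e of z, so the radius 4e leaves room for one fixed e near z.\<close>
    obtain e where e: "e > 0" "cball z (4 * e) \<subseteq> \<Omega>"
    proof -
      obtain d where "d > 0" "cball z d \<subseteq> \<Omega>" using cb[OF z] by metis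
      then show ?thesis by (intro that[of "d / 4"]) auto
    qed
    have sub: "cball y (2 * e) \<subseteq> \<Omega>" if "y \<in> ball z e" for y
    proof -
      have "cball y (2 * e) \<subseteq> cball z (4 * e)"
        using that e(1) by (auto simp: subset_iff intro: order_trans[OF dist_triangle[of z _ y]])
      then show ?thesis using e(2) by blast
    qed
    have "(F has_field_derivative - (LINT w|?M. partial_deriv 1 (mollifier e) (w - z) *\<^sub>R f w)) (at z)"
    proof (rule has_field_derivative_transform_within_open[OF mollification_has_field_derivative[OF \<Omega> f e(1)]])
      show "cball z (2 * e) \<subseteq> \<Omega>" using sub[of z] e by simp
      show "open (ball z e)" "z \<in> ball z e" using e by auto
      fix y assume y: "y \<in> ball z e"
      have "y \<in> cball y (2 * e)" using e(1) by simp
      then have "y \<in> \<Omega>" using sub[OF y] by blast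
      then show "mollify \<Omega> e f y = F y" using F_eq[OF _ e(1) sub[OF y]] by simp
    qed
    then show ?thesis by (auto simp: field_differentiable_def)
  qed
  have hol: "F holomorphic_on \<Omega>"
    using der by (auto simp: holomorphic_on_def intro: field_differentiable_at_within)
  have Fc: "continuous_on \<Omega> F" using hol by (rule holomorphic_on_imp_continuous_on)
  \<comment> \<open>On the support of \<phi> the mollifications of small radius coincide with
    \<open>F\<close>, so the sequence of pairings is eventually constant, while its limit is the
    pairing with \<open>f\<close>.\<close>
  have same: "(LINT z|?M. \<phi> z *\<^sub>R F z) = (LINT z|?M. \<phi> z *\<^sub>R f z)" if \<phi>: "\<phi> \<in> test_functions \<Omega>" for \<phi>
  proof -
    obtain K where K: "compact K" "K \<subseteq> \<Omega>" "\<And>x. x \<notin> K \<Longrightarrow> \<phi> x = 0" using test_functionE[OF \<phi>] by metis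
    have "\<forall>\<^sub>F n in sequentially. (LINT z|?M. \<phi> z *\<^sub>R mollify \<Omega> (1 / real (Suc n)) f z) = (LINT z|?M. \<phi> z *\<^sub>R F z)"
      using eventually_cball_subset[OF \<Omega>(1) K(1,2)]
    proof eventually_elim
      case (elim n)
      have "\<phi> z *\<^sub>R mollify \<Omega> (1 / real (Suc n)) f z = \<phi> z *\<^sub>R F z" for z
      proof (cases "z \<in> K")
        case True
        then show ?thesis using F_eq[of z "1 / real (Suc n)"] elim K(2) by auto
      qed (use K in simp)
      then show ?case by (simp only:)
    qed
    then have "(\<lambda>n. LINT z|?M. \<phi> z *\<^sub>R mollify \<Omega> (1 / real (Suc n)) f z) \<longlonglongrightarrow> (LINT z|?M. \<phi> z *\<^sub>R F z)"
      by (rule tendsto_eventually)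
    from LIMSEQ_unique[OF this mollification_tendsto[OF \<Omega> f(1) test_function_continuous[OF \<phi>] K]] show ?thesis .
  qed
  \<comment> \<open>\<open>F\<close> is not yet known to be square integrable on
    \<open>\<Omega>\<close>. On \<open>U n\<close>, which lies in a compact subset of
    \<open>\<Omega>\<close>, it is bounded, so the fundamental lemma applies to f - F there.\<close>
  define U where "U n = {z. infdist z (- \<Omega>) > 1 / real (Suc n)}" for n
  \<comment> \<open>The complement must be nonempty for \<open>infdist\<close> to be a genuine
    distance to it.\<close>
  have "\<Omega> \<noteq> UNIV" using \<Omega>(2) not_bounded_UNIV[where 'a = complex] by auto
  then have ne: "- \<Omega> \<noteq> {}" by blast
  have pos: "infdist z (- \<Omega>) > 0 \<longleftrightarrow> z \<in> \<Omega>" for z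
    using in_closed_iff_infdist_zero[of "- \<Omega>" z] ne \<Omega>(1) infdist_nonneg[of z "- \<Omega>"]
    by (auto simp: closed_Compl less_le)
  have ae: "AE z in lebesgue_on (U n). f z = F z" for n
  proof -
    let ?N = "lebesgue_on (U n)"
    have Uo: "open (U n)" unfolding U_def by (intro open_Collect_less continuous_intros)
    have in\<Omega>: "z \<in> \<Omega>" if "infdist z (- \<Omega>) \<ge> 1 / real (Suc n)" for z
    proof -
      have "0 < 1 / real (Suc n)" by simp
      then have "infdist z (- \<Omega>) > 0" using that by linarith
      then show ?thesis using pos by blast
    qed
    have U\<Omega>: "U n \<subseteq> \<Omega>" using in\<Omega> by (auto simp: U_def)
    have Ub: "bounded (U n)" using \<Omega>(2) U\<Omega> bounded_subset by blast
    have fin: "finite_measure ?N" by (rule finite_measure_bounded_open[OF Uo Ub])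
    define C where "C = {z. infdist z (- \<Omega>) \<ge> 1 / real (Suc n)}"
    have C\<Omega>: "C \<subseteq> \<Omega>" using in\<Omega> by (auto simp: C_def)
    have "closed C" unfolding C_def by (intro closed_Collect_le continuous_intros)
    then have "compact C" using C\<Omega> \<Omega>(2) bounded_subset by (auto simp: compact_eq_bounded_closed)
    then have "bounded (F ` C)" by (intro compact_imp_bounded compact_continuous_image continuous_on_subset[OF Fc C\<Omega>])
    then obtain B where B: "\<And>z. z \<in> C \<Longrightarrow> norm (F z) \<le> B" unfolding bounded_iff by blast
    have F2: "F \<in> l2 ?N"
    proof (rule l2_bounded[OF fin])
      show "F \<in> borel_measurable ?N"
        using Uo by (intro continuous_imp_measurable_on_sets_lebesgue continuous_on_subset[OF Fc U\<Omega>]) simp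
      show "norm (F x) \<le> B" if "x \<in> space ?N" for x using that B[of x] by (simp add: U_def C_def)
    qed
    have f2: "f \<in> l2 ?N" by (rule l2_subset[OF f(1) Uo \<Omega>(1) U\<Omega>])
    have D2: "(\<lambda>z. f z - F z) \<in> l2 ?N" by (rule l2_diff[OF f2 F2])
    have Dint: "integrable ?N (\<lambda>z. f z - F z)" by (rule l2_imp_integrable[OF fin D2])
    have zero: "(LINT z|?N. \<phi> z *\<^sub>R (f z - F z)) = 0 \<and> integrable ?N (\<lambda>z. \<phi> z *\<^sub>R (f z - F z))"
      if \<phi>: "\<phi> \<in> test_functions (U n)" for \<phi>
    proof -
      obtain K where K: "compact K" "K \<subseteq> U n" "\<And>x. x \<notin> K \<Longrightarrow> \<phi> x = 0" using test_functionE[OF \<phi>] by metis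
      have "bounded (\<phi> ` K)"
        by (intro compact_imp_bounded compact_continuous_image continuous_on_subset[OF test_function_continuous[OF \<phi>]] K) auto
      then obtain B where "\<And>x. x \<in> K \<Longrightarrow> norm (\<phi> x) \<le> B" unfolding bounded_iff by blast
      then have \<phi>B: "\<bar>\<phi> x\<bar> \<le> max B 0" for x using K(3)[of x] by (cases "x \<in> K") (auto simp: max.coboundedI1)
      have \<phi>m: "\<phi> \<in> borel_measurable ?N"
        using test_function_l2(1)[OF Uo \<phi>] l2D(1) by blast
      have i: "integrable ?N (\<lambda>z. \<phi> z *\<^sub>R g z)" if "g \<in> l2 ?N" for g :: "complex \<Rightarrow> complex"
        by (rule integrable_bounded_scaleR[OF l2_imp_integrable[OF fin that] \<phi>m \<phi>B])
      have z: "\<phi> x = 0" if "x \<notin> U n" for x using K that by blast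
      have "(LINT z|?N. \<phi> z *\<^sub>R F z) = (LINT z|?N. \<phi> z *\<^sub>R f z)"
        using same[of \<phi>] test_functions_mono[OF U\<Omega>] \<phi> z
        by (subst (1 2) integral_lebesgue_on_subset[OF Uo \<Omega>(1) U\<Omega>]) auto
      then show ?thesis using i[OF f2] i[OF F2] i[OF D2] by (simp add: scaleR_diff_right)
    qed
    \<comment> \<open>The fundamental lemma is stated for real functions; \<open>L\<close> will be
      \<open>Re\<close> and \<open>Im\<close>.\<close>
    have comp: "AE z in ?N. L (f z - F z) = 0" if L: "bounded_linear L" "L \<in> borel_measurable borel" "\<And>z. \<bar>L z\<bar> \<le> cmod z" for L :: "complex \<Rightarrow> real"
    proof (rule fundamental_lemma[OF Uo Ub])
      show "(\<lambda>z. L (f z - F z)) \<in> l2 ?N"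
      proof -
        have sqle: "(L z)\<^sup>2 \<le> (cmod z)\<^sup>2" for z
          using L(3)[of z] abs_le_square_iff[of "L z" "cmod z"] by simp
        have m: "(\<lambda>z. f z - F z) \<in> borel_measurable ?N" using l2D(1)[OF D2] .
        have Lm: "(\<lambda>z. L (f z - F z)) \<in> borel_measurable ?N" using measurable_compose[OF m L(2)] .
        have "integrable ?N (\<lambda>z. (norm (L (f z - F z)))\<^sup>2)"
          by (rule Bochner_Integration.integrable_bound[OF l2D(2)[OF D2]])
            (use sqle Lm in auto)
        then show ?thesis using Lm by (simp add: l2_def)
      qed
      show "\<forall>\<phi>\<in>test_functions (U n). (LINT x|?N. L (f x - F x) * \<phi> x) = 0"
      proof
        fix \<phi> assume "\<phi> \<in> test_functions (U n)"
        note z = zero[OF this]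
        have "(LINT x|?N. L (f x - F x) * \<phi> x) = (LINT x|?N. L (\<phi> x *\<^sub>R (f x - F x)))"
          using linear_cmul[OF bounded_linear.linear[OF L(1)]] by (simp add: mult.commute)
        also have "\<dots> = L (LINT x|?N. \<phi> x *\<^sub>R (f x - F x))" using z by (intro integral_bounded_linear[OF L(1)]) simp
        also have "\<dots> = 0" using z linear_0[OF bounded_linear.linear[OF L(1)]] by simp
        finally show "(LINT x|?N. L (f x - F x) * \<phi> x) = 0" .
      qed
    qed
    have "AE z in ?N. Re (f z - F z) = 0" "AE z in ?N. Im (f z - F z) = 0"
      by (rule comp; auto intro: bounded_linear_Re bounded_linear_Im abs_Re_le_cmod abs_Im_le_cmod)+
    then show ?thesis by eventually_elim (simp add: complex_eq_iff)
  qed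
  have "AE z in lebesgue. \<forall>n. z \<in> U n \<longrightarrow> f z = F z"
    unfolding AE_all_countable
  proof
    fix n
    have "open (U n)" unfolding U_def by (intro open_Collect_less continuous_intros)
    then show "AE z in lebesgue. z \<in> U n \<longrightarrow> f z = F z" using ae[of n] by (simp add: AE_restrict_space_iff)
  qed
  then have "AE z in lebesgue. z \<in> \<Omega> \<longrightarrow> f z = F z"
  proof eventually_elim
    case (elim z)
    show ?case
    proof
      assume "z \<in> \<Omega>"
      then have "infdist z (- \<Omega>) > 0" using pos by simp
      then obtain n where "1 / real (Suc n) < infdist z (- \<Omega>)" using reals_Archimedean[of "infdist z (- \<Omega>)"] by (auto simp: inverse_eq_divide)
      then show "f z = F z" using elim by (auto simp: U_def)
    qed
  qed
  then have "AE z in ?M. f z = F z" using \<Omega>(1) by (simp add: AE_restrict_space_iff)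
  with hol show ?thesis by (rule that)
qed

section \<open>The closure of the divergence-curl range and its orthogonal complement\<close>

text \<open>This is (\<partial>1 - \<i> \<partial>2)(v + \<i> w), twice the holomorphic Wirtinger
  derivative. Its formal adjoint for the real inner product is -(\<partial>1 + \<i> \<partial>2),
  which is why its orthogonal complement consists of holomorphic functions.\<close>

definition div_curl :: "(complex \<Rightarrow> real) \<Rightarrow> (complex \<Rightarrow> real) \<Rightarrow> complex \<Rightarrow> complex" where
  "div_curl v w x = Complex (partial_deriv 1 v x + partial_deriv \<i> w x) (partial_deriv 1 w x - partial_deriv \<i> v x)"

text \<open>Closing the range on test functions keeps the Hilbert space argument free of Sobolev
  spaces; \<open>H1_0_div_curl_closure\<close> and \<open>div_curl_closure_H1_0\<close> translate in
  the two directions.\<close>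

definition div_curl_closure :: "complex set \<Rightarrow> (complex \<Rightarrow> complex) set" where
  "div_curl_closure \<Omega> = {X \<in> l2 (lebesgue_on \<Omega>). \<forall>\<epsilon>>0. \<exists>\<phi>\<in>test_functions \<Omega>. \<exists>\<psi>\<in>test_functions \<Omega>.
     l2norm (lebesgue_on \<Omega>) (\<lambda>x. div_curl \<phi> \<psi> x - X x) < \<epsilon>}"

definition div_curl_orthogonal :: "complex set \<Rightarrow> (complex \<Rightarrow> complex) set" where
  "div_curl_orthogonal \<Omega> = {a \<in> l2 (lebesgue_on \<Omega>). \<forall>\<phi>\<in>test_functions \<Omega>. \<forall>\<psi>\<in>test_functions \<Omega>.
     (LINT x|lebesgue_on \<Omega>. a x \<bullet> div_curl \<phi> \<psi> x) = 0}"

lemma L2_eq_l2: "L2 \<Omega> = l2 (lebesgue_on \<Omega>)"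
  by (simp add: L2_def l2_def)

lemma L2_norm_eq_l2norm: "L2_norm \<Omega> q = l2norm (lebesgue_on \<Omega>) q"
  by (simp add: L2_norm_def l2norm_def)

lemma zero_test_function: "(\<lambda>x. 0) \<in> test_functions \<Omega>"
  by (rule test_functionI[of _ "{}"]) (auto intro: C_diff_const)

lemma partial_deriv_const: "partial_deriv b (\<lambda>x. c) x = 0"
  by (rule partial_deriv_eq) auto

lemma one_i_Basis: "1 \<in> (Basis :: complex set)" "\<i> \<in> (Basis :: complex set)"
  by (auto simp: Basis_complex_def)

lemma sum_Basis_complex: "(\<Sum>b\<in>(Basis :: complex set). F b) = F 1 + F \<i>"
  by (simp add: Basis_complex_def)

lemma l2_Re_Im:
  assumes "f \<in> l2 M"
  shows "(\<lambda>x. Re (f x)) \<in> l2 M" "(\<lambda>x. Im (f x)) \<in> l2 M"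
    and "(l2norm M f)\<^sup>2 = (l2norm M (\<lambda>x. Re (f x)))\<^sup>2 + (l2norm M (\<lambda>x. Im (f x)))\<^sup>2"
proof -
  note [measurable] = l2D(1)[OF assms]
  have i: "integrable M (\<lambda>x. (norm (Re (f x)))\<^sup>2)" "integrable M (\<lambda>x. (norm (Im (f x)))\<^sup>2)"
    by (rule Bochner_Integration.integrable_bound[OF l2D(2)[OF assms]], measurable, simp add: cmod_power2)+
  then show "(\<lambda>x. Re (f x)) \<in> l2 M" "(\<lambda>x. Im (f x)) \<in> l2 M"
    by (simp_all add: l2_def)
  show "(l2norm M f)\<^sup>2 = (l2norm M (\<lambda>x. Re (f x)))\<^sup>2 + (l2norm M (\<lambda>x. Im (f x)))\<^sup>2"
    using i by (simp add: l2norm_power2 cmod_power2)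
qed

lemma l2norm_Complex_le:
  assumes "f \<in> l2 M" "g \<in> l2 M"
  shows "l2norm M (\<lambda>x. Complex (f x) (g x)) \<le> l2norm M f + l2norm M g"
proof (rule power2_le_imp_le)
  show "(l2norm M (\<lambda>x. Complex (f x) (g x)))\<^sup>2 \<le> (l2norm M f + l2norm M g)\<^sup>2"
    using l2_Re_Im(3)[OF l2_Complex[OF assms]] by (simp add: power2_sum)
qed simp

lemma div_curl_l2:
  assumes "open \<Omega>" "\<phi> \<in> test_functions \<Omega>" "\<psi> \<in> test_functions \<Omega>"
  shows "div_curl \<phi> \<psi> \<in> l2 (lebesgue_on \<Omega>)"
  unfolding div_curl_def[abs_def]
  by (intro l2_Complex l2_add l2_diff
      test_function_l2(2)[OF assms(1)] assms one_i_Basis)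

lemma div_curl_add_scaled:
  assumes "\<phi> \<in> test_functions \<Omega>" "\<psi> \<in> test_functions \<Omega>" "\<phi>' \<in> test_functions \<Omega>" "\<psi>' \<in> test_functions \<Omega>"
  shows "div_curl (\<lambda>x. \<phi> x + c * \<phi>' x) (\<lambda>x. \<psi> x + c * \<psi>' x) x = div_curl \<phi> \<psi> x + c *\<^sub>R div_curl \<phi>' \<psi>' x"
  unfolding div_curl_def test_function_add_scaled(2)[OF assms(1,3)] test_function_add_scaled(2)[OF assms(2,4)]
  by (simp add: complex_eq_iff algebra_simps)

text \<open>Expanding the square gives all squared partial derivatives and twice the Jacobian
  determinant of (\<phi>, \<psi>), whose integral vanishes by
  \<open>integral_partial_derivs_swap\<close>.\<close>

lemma div_curl_norm:
  assumes "open \<Omega>" "\<phi> \<in> test_functions \<Omega>" "\<psi> \<in> test_functions \<Omega>"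
  shows "(l2norm (lebesgue_on \<Omega>) (div_curl \<phi> \<psi>))\<^sup>2 =
    (\<Sum>b\<in>Basis. (l2norm (lebesgue_on \<Omega>) (partial_deriv b \<phi>))\<^sup>2 + (l2norm (lebesgue_on \<Omega>) (partial_deriv b \<psi>))\<^sup>2)"
proof -
  let ?M = "lebesgue_on \<Omega>"
  note sq = test_function_l2(2)[OF assms(1,2)] test_function_l2(2)[OF assms(1,3)]
  have i: "integrable ?M (\<lambda>x. (partial_deriv b \<phi> x)\<^sup>2)" "integrable ?M (\<lambda>x. (partial_deriv b \<psi> x)\<^sup>2)" if "b \<in> Basis" for b
    using sq[OF that, THEN l2D(2)] by simp_all
  have m: "integrable ?M (\<lambda>x. partial_deriv b \<phi> x * partial_deriv c \<psi> x)" if "b \<in> Basis" "c \<in> Basis" for b c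
    by (intro l2_real_mult sq that)
  have "(norm (div_curl \<phi> \<psi> x))\<^sup>2 = ((partial_deriv 1 \<phi> x)\<^sup>2 + (partial_deriv \<i> \<phi> x)\<^sup>2 + (partial_deriv 1 \<psi> x)\<^sup>2 + (partial_deriv \<i> \<psi> x)\<^sup>2)
    + 2 * (partial_deriv 1 \<phi> x * partial_deriv \<i> \<psi> x) - 2 * (partial_deriv \<i> \<phi> x * partial_deriv 1 \<psi> x)" for x
    unfolding cmod_power2 by (simp add: div_curl_def power2_eq_square algebra_simps)
  then have "(l2norm ?M (div_curl \<phi> \<psi>))\<^sup>2 =
    (LINT x|?M. (partial_deriv 1 \<phi> x)\<^sup>2) + (LINT x|?M. (partial_deriv \<i> \<phi> x)\<^sup>2) + (LINT x|?M. (partial_deriv 1 \<psi> x)\<^sup>2) + (LINT x|?M. (partial_deriv \<i> \<psi> x)\<^sup>2)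
    + 2 * (LINT x|?M. partial_deriv 1 \<phi> x * partial_deriv \<i> \<psi> x) - 2 * (LINT x|?M. partial_deriv \<i> \<phi> x * partial_deriv 1 \<psi> x)"
    using i[OF one_i_Basis(1)] i[OF one_i_Basis(2)] m[OF one_i_Basis] m[OF one_i_Basis(2,1)]
    by (simp add: l2norm_power2)
  then show ?thesis
    using integral_partial_derivs_swap[OF assms one_i_Basis] by (simp add: sum_Basis_complex l2norm_power2)
qed

text \<open>Testing with the fields (\<phi>, 0) and (0, \<phi>) yields the real and the imaginary
  part of the weak Cauchy-Riemann equation.\<close>

lemma div_curl_orthogonal_weakly_holomorphic:
  assumes "open \<Omega>" "a \<in> div_curl_orthogonal \<Omega>"
  shows "weakly_holomorphic \<Omega> a"
  unfolding weakly_holomorphic_def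
proof
  let ?M = "lebesgue_on \<Omega>"
  fix \<phi> assume \<phi>: "\<phi> \<in> test_functions \<Omega>"
  have a: "a \<in> l2 ?M" using assms(2) by (simp add: div_curl_orthogonal_def)
  have sq: "(\<lambda>x. Complex (partial_deriv 1 \<phi> x) (partial_deriv \<i> \<phi> x)) \<in> l2 ?M"
    by (intro l2_Complex test_function_l2(2)[OF assms(1) \<phi>] one_i_Basis)
  let ?f = "\<lambda>x. a x * Complex (partial_deriv 1 \<phi> x) (partial_deriv \<i> \<phi> x)"
  have int: "integrable ?M ?f" by (rule l2_mult[OF a sq])
  have e: "a x \<bullet> div_curl \<phi> (\<lambda>x. 0) x = Re (?f x)" "a x \<bullet> div_curl (\<lambda>x. 0) \<phi> x = Im (?f x)" for x
    by (simp_all add: div_curl_def partial_deriv_const inner_complex_def)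
  have "(LINT x|?M. Re (?f x)) = 0" "(LINT x|?M. Im (?f x)) = 0"
    using assms(2) \<phi> zero_test_function unfolding e[symmetric] div_curl_orthogonal_def by blast+
  then show "(LINT x|?M. ?f x) = 0"
    using int by (simp add: complex_eq_iff integral_Re[symmetric] integral_Im[symmetric])
qed

text \<open>After integration by parts the derivative of \<open>w\<close> in direction b is
  \<open>deriv w x * b\<close>; the factor \<i> for the second direction makes the four terms cancel
  in pairs.\<close>

lemma holomorphic_div_curl_orthogonal:
  assumes "open \<Omega>" "w holomorphic_on \<Omega>" "w \<in> l2 (lebesgue_on \<Omega>)"
  shows "w \<in> div_curl_orthogonal \<Omega>"
  unfolding div_curl_orthogonal_def
proof (intro CollectI conjI ballI assms(3))
  let ?M = "lebesgue_on \<Omega>"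
  fix \<phi> \<psi> assume test: "\<phi> \<in> test_functions \<Omega>" "\<psi> \<in> test_functions \<Omega>"
  have dc: "continuous_on \<Omega> (deriv w)"
    using holomorphic_on_imp_continuous_on[OF holomorphic_deriv[OF assms(2,1)]] .
  have der: "(w has_derivative (\<lambda>h. deriv w x * h)) (at x)" if "x \<in> \<Omega>" for x
    using holomorphic_derivI[OF assms(2,1) that] by (simp add: has_field_derivative_def)
  have R: "(LINT x|?M. Re (w x) * partial_deriv b \<phi> x) = - (LINT x|?M. Re (deriv w x * b) * \<phi> x)"
    if "b \<in> Basis" "\<phi> \<in> test_functions \<Omega>" for b \<phi>
    by (rule integration_by_parts[OF assms(1) that(2,1)])
      (intro has_derivative_Re der continuous_intros dc; assumption)+
  have I: "(LINT x|?M. Im (w x) * partial_deriv b \<phi> x) = - (LINT x|?M. Im (deriv w x * b) * \<phi> x)"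
    if "b \<in> Basis" "\<phi> \<in> test_functions \<Omega>" for b \<phi>
    by (rule integration_by_parts[OF assms(1) that(2,1)])
      (intro has_derivative_Im der continuous_intros dc; assumption)+
  note wsq = l2_Re_Im(1,2)[OF assms(3)]
  have i: "integrable ?M (\<lambda>x. Re (w x) * partial_deriv b \<phi> x)" "integrable ?M (\<lambda>x. Im (w x) * partial_deriv b \<phi> x)"
    if "b \<in> Basis" "\<phi> \<in> test_functions \<Omega>" for b \<phi>
    using that by (auto intro!: l2_real_mult wsq test_function_l2(2)[OF assms(1)])
  have "(LINT x|?M. w x \<bullet> div_curl \<phi> \<psi> x) =
     (LINT x|?M. Re (w x) * partial_deriv 1 \<phi> x + Re (w x) * partial_deriv \<i> \<psi> x + Im (w x) * partial_deriv 1 \<psi> x - Im (w x) * partial_deriv \<i> \<phi> x)"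
    by (simp add: div_curl_def inner_complex_def algebra_simps)
  also have "\<dots> = (LINT x|?M. Re (w x) * partial_deriv 1 \<phi> x) + (LINT x|?M. Re (w x) * partial_deriv \<i> \<psi> x)
     + (LINT x|?M. Im (w x) * partial_deriv 1 \<psi> x) - (LINT x|?M. Im (w x) * partial_deriv \<i> \<phi> x)"
    using i test one_i_Basis by simp
  also have "\<dots> = 0"
    by (simp add: R[OF one_i_Basis(1) test(1)] R[OF one_i_Basis(2) test(2)] I[OF one_i_Basis(1) test(2)] I[OF one_i_Basis(2) test(1)])
  finally show "(LINT x|?M. w x \<bullet> div_curl \<phi> \<psi> x) = 0" .
qed

lemma div_curl_closure_approximation:
  assumes "X \<in> div_curl_closure \<Omega>"
  shows "\<exists>\<phi> \<psi>. (\<forall>n::nat. \<phi> n \<in> test_functions \<Omega> \<and> \<psi> n \<in> test_functions \<Omega>) \<and>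
    (\<lambda>n. l2norm (lebesgue_on \<Omega>) (\<lambda>x. div_curl (\<phi> n) (\<psi> n) x - X x)) \<longlonglongrightarrow> 0"
proof -
  have "\<forall>n::nat. \<exists>\<phi>\<in>test_functions \<Omega>. \<exists>\<psi>\<in>test_functions \<Omega>.
     l2norm (lebesgue_on \<Omega>) (\<lambda>x. div_curl \<phi> \<psi> x - X x) < 1 / real (Suc n)"
    using assms by (auto simp: div_curl_closure_def)
  then obtain \<phi> \<psi> where t: "\<And>n::nat. \<phi> n \<in> test_functions \<Omega>" "\<And>n. \<psi> n \<in> test_functions \<Omega>"
    and l: "\<And>n. l2norm (lebesgue_on \<Omega>) (\<lambda>x. div_curl (\<phi> n) (\<psi> n) x - X x) < 1 / real (Suc n)" by metis
  have "(\<lambda>n. l2norm (lebesgue_on \<Omega>) (\<lambda>x. div_curl (\<phi> n) (\<psi> n) x - X x)) \<longlonglongrightarrow> 0"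
    by (rule Lim_null_comparison[OF always_eventually LIMSEQ_Suc[OF lim_1_over_n]]) (use l less_imp_le in auto)
  with t show ?thesis by blast
qed

lemma div_curl_closureI:
  assumes "X \<in> l2 (lebesgue_on \<Omega>)" "\<And>n::nat. \<phi> n \<in> test_functions \<Omega>" "\<And>n. \<psi> n \<in> test_functions \<Omega>"
    "(\<lambda>n. l2norm (lebesgue_on \<Omega>) (\<lambda>x. div_curl (\<phi> n) (\<psi> n) x - X x)) \<longlonglongrightarrow> 0"
  shows "X \<in> div_curl_closure \<Omega>"
  unfolding div_curl_closure_def
proof (intro CollectI conjI allI impI assms(1))
  fix \<epsilon> :: real assume "\<epsilon> > 0"
  from order_tendstoD(2)[OF assms(4) this]
  obtain n where "l2norm (lebesgue_on \<Omega>) (\<lambda>x. div_curl (\<phi> n) (\<psi> n) x - X x) < \<epsilon>"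
    by (auto simp: eventually_sequentially)
  then show "\<exists>\<phi>\<in>test_functions \<Omega>. \<exists>\<psi>\<in>test_functions \<Omega>. l2norm (lebesgue_on \<Omega>) (\<lambda>x. div_curl \<phi> \<psi> x - X x) < \<epsilon>"
    using assms(2,3) by blast
qed

lemma div_curl_closure_orthogonal:
  assumes "open \<Omega>" "a \<in> div_curl_orthogonal \<Omega>" "X \<in> div_curl_closure \<Omega>"
  shows "(LINT x|lebesgue_on \<Omega>. a x \<bullet> X x) = 0"
proof -
  obtain \<phi> \<psi> where t: "\<And>n::nat. \<phi> n \<in> test_functions \<Omega>" "\<And>n. \<psi> n \<in> test_functions \<Omega>"
    "(\<lambda>n. l2norm (lebesgue_on \<Omega>) (\<lambda>x. div_curl (\<phi> n) (\<psi> n) x - X x)) \<longlonglongrightarrow> 0"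
    using div_curl_closure_approximation[OF assms(3)] by auto
  have "(\<lambda>n. LINT x|lebesgue_on \<Omega>. div_curl (\<phi> n) (\<psi> n) x \<bullet> a x) \<longlonglongrightarrow> (LINT x|lebesgue_on \<Omega>. X x \<bullet> a x)"
    using assms(2,3) t by (intro l2_tendsto_inner div_curl_l2[OF assms(1)])
      (auto simp: div_curl_orthogonal_def div_curl_closure_def)
  moreover have "(LINT x|lebesgue_on \<Omega>. div_curl (\<phi> n) (\<psi> n) x \<bullet> a x) = 0" for n
    using assms(2) t by (simp add: div_curl_orthogonal_def inner_commute)
  ultimately show ?thesis by (simp add: LIMSEQ_const_iff inner_commute)
qed

text \<open>On a bounded set the constants 1 and \<i> are square integrable holomorphic functions,
  hence orthogonal to the closure.\<close>

lemma div_curl_closure_mean_zero: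
  assumes "open \<Omega>" "bounded \<Omega>" "X \<in> div_curl_closure \<Omega>"
  shows "(LINT x|lebesgue_on \<Omega>. Re (X x)) = 0" "(LINT x|lebesgue_on \<Omega>. Im (X x)) = 0"
proof -
  have "(\<lambda>x. c) \<in> div_curl_orthogonal \<Omega>" for c
    by (rule holomorphic_div_curl_orthogonal[OF assms(1)])
      (use l2_bounded[OF finite_measure_bounded_open[OF assms(1,2)], of "\<lambda>x. c" "norm c"] in auto)
  from div_curl_closure_orthogonal[OF assms(1) this assms(3)]
  have "(LINT x|lebesgue_on \<Omega>. c \<bullet> X x) = 0" for c .
  from this[of 1] this[of \<i>]
  show "(LINT x|lebesgue_on \<Omega>. Re (X x)) = 0" "(LINT x|lebesgue_on \<Omega>. Im (X x)) = 0"
    by (simp_all add: inner_complex_def)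
qed

text \<open>The isometry passes to limits of gradients. Here \<open>v b\<close> and
  \<open>w b\<close> stand for weak partial derivatives, so that the lemma serves both translations
  between \<open>H1_0\<close> and the closure.\<close>

lemma div_curl_limit:
  assumes "open \<Omega>" and test: "\<And>n::nat. \<phi> n \<in> test_functions \<Omega>" "\<And>n. \<psi> n \<in> test_functions \<Omega>"
    and sq: "\<And>b. b \<in> Basis \<Longrightarrow> v b \<in> l2 (lebesgue_on \<Omega>)" "\<And>b. b \<in> Basis \<Longrightarrow> w b \<in> l2 (lebesgue_on \<Omega>)"
    and lim: "\<And>b. b \<in> Basis \<Longrightarrow> (\<lambda>n. l2norm (lebesgue_on \<Omega>) (\<lambda>x. partial_deriv b (\<phi> n) x - v b x)) \<longlonglongrightarrow> 0"
      "\<And>b. b \<in> Basis \<Longrightarrow> (\<lambda>n. l2norm (lebesgue_on \<Omega>) (\<lambda>x. partial_deriv b (\<psi> n) x - w b x)) \<longlonglongrightarrow> 0"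
  defines "X \<equiv> \<lambda>x. Complex (v 1 x + w \<i> x) (w 1 x - v \<i> x)"
  shows "X \<in> l2 (lebesgue_on \<Omega>)"
    and "(\<lambda>n. l2norm (lebesgue_on \<Omega>) (\<lambda>x. div_curl (\<phi> n) (\<psi> n) x - X x)) \<longlonglongrightarrow> 0"
    and "(l2norm (lebesgue_on \<Omega>) X)\<^sup>2 = (\<Sum>b\<in>Basis. (l2norm (lebesgue_on \<Omega>) (v b))\<^sup>2 + (l2norm (lebesgue_on \<Omega>) (w b))\<^sup>2)"
proof -
  let ?M = "lebesgue_on \<Omega>"
  note B = one_i_Basis
  show X: "X \<in> l2 ?M" unfolding X_def
    by (intro l2_Complex l2_add l2_diff sq B)
  have p: "partial_deriv b (\<phi> n) \<in> l2 ?M" "partial_deriv b (\<psi> n) \<in> l2 ?M" if "b \<in> Basis" for b n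
    using that test by (auto intro: test_function_l2(2)[OF assms(1)])
  let ?p = "\<lambda>b n x. partial_deriv b (\<phi> n) x - v b x" and ?q = "\<lambda>b n x. partial_deriv b (\<psi> n) x - w b x"
  have pq: "?p b n \<in> l2 ?M" "?q b n \<in> l2 ?M" if "b \<in> Basis" for b n
    using that by (auto intro!: l2_diff p sq)
  show l: "(\<lambda>n. l2norm ?M (\<lambda>x. div_curl (\<phi> n) (\<psi> n) x - X x)) \<longlonglongrightarrow> 0"
  proof (rule Lim_null_comparison)
    have "(\<lambda>n. (l2norm ?M (?p 1 n) + l2norm ?M (?q \<i> n)) + (l2norm ?M (?q 1 n) + l2norm ?M (?p \<i> n))) \<longlonglongrightarrow> (0 + 0) + (0 + 0)"
      by (intro tendsto_add lim B)
    then show "(\<lambda>n. (l2norm ?M (?p 1 n) + l2norm ?M (?q \<i> n)) + (l2norm ?M (?q 1 n) + l2norm ?M (?p \<i> n))) \<longlonglongrightarrow> 0" by simp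
    have "l2norm ?M (\<lambda>x. div_curl (\<phi> n) (\<psi> n) x - X x) \<le> (l2norm ?M (?p 1 n) + l2norm ?M (?q \<i> n)) + (l2norm ?M (?q 1 n) + l2norm ?M (?p \<i> n))" for n
    proof -
      have "(\<lambda>x. div_curl (\<phi> n) (\<psi> n) x - X x) = (\<lambda>x. Complex (?p 1 n x + ?q \<i> n x) (?q 1 n x - ?p \<i> n x))"
        by (auto simp: X_def div_curl_def fun_eq_iff complex_eq_iff)
      then have "l2norm ?M (\<lambda>x. div_curl (\<phi> n) (\<psi> n) x - X x) \<le> l2norm ?M (\<lambda>x. ?p 1 n x + ?q \<i> n x) + l2norm ?M (\<lambda>x. ?q 1 n x - ?p \<i> n x)"
        by (simp only:) (intro l2norm_Complex_le l2_add l2_diff[OF pq(2) pq(1)] pq B)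
      also have "\<dots> \<le> (l2norm ?M (?p 1 n) + l2norm ?M (?q \<i> n)) + (l2norm ?M (?q 1 n) + l2norm ?M (?p \<i> n))"
      proof (rule add_mono)
        show "l2norm ?M (\<lambda>x. ?p 1 n x + ?q \<i> n x) \<le> l2norm ?M (?p 1 n) + l2norm ?M (?q \<i> n)"
          by (intro l2norm_triangle pq B)
        show "l2norm ?M (\<lambda>x. ?q 1 n x - ?p \<i> n x) \<le> l2norm ?M (?q 1 n) + l2norm ?M (?p \<i> n)"
          by (intro l2norm_triangle_diff pq B)
      qed
      finally show ?thesis .
    qed
    then show "\<forall>\<^sub>F n in sequentially. norm (l2norm ?M (\<lambda>x. div_curl (\<phi> n) (\<psi> n) x - X x)) \<le>
        (l2norm ?M (?p 1 n) + l2norm ?M (?q \<i> n)) + (l2norm ?M (?q 1 n) + l2norm ?M (?p \<i> n))" by simp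
  qed
  have "(\<lambda>n. (l2norm ?M (div_curl (\<phi> n) (\<psi> n)))\<^sup>2) \<longlonglongrightarrow> (l2norm ?M X)\<^sup>2"
    by (intro tendsto_power l2_tendsto_norm[OF _ X l] div_curl_l2[OF assms(1)] test)
  moreover have "(\<lambda>n. \<Sum>b\<in>Basis. (l2norm ?M (partial_deriv b (\<phi> n)))\<^sup>2 + (l2norm ?M (partial_deriv b (\<psi> n)))\<^sup>2)
      \<longlonglongrightarrow> (\<Sum>b\<in>Basis. (l2norm ?M (v b))\<^sup>2 + (l2norm ?M (w b))\<^sup>2)"
    by (intro tendsto_sum tendsto_add tendsto_power l2_tendsto_norm p sq lim)
  ultimately show "(l2norm ?M X)\<^sup>2 = (\<Sum>b\<in>Basis. (l2norm ?M (v b))\<^sup>2 + (l2norm ?M (w b))\<^sup>2)"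
    unfolding div_curl_norm[OF assms(1) test] by (rule LIMSEQ_unique)
qed

section \<open>Weak derivatives and \<open>H1_0\<close> as a space of limits of test
  functions\<close>

lemma weak_deriv_unique:
  assumes "open \<Omega>" "bounded \<Omega>" "w \<in> L2 \<Omega>" "w' \<in> L2 \<Omega>" "is_weak_deriv \<Omega> b u w" "is_weak_deriv \<Omega> b u w'"
  shows "AE x in lebesgue_on (\<Omega> :: complex set). w x = w' x"
proof -
  have sq: "w \<in> l2 (lebesgue_on \<Omega>)" "w' \<in> l2 (lebesgue_on \<Omega>)"
    using assms by (simp_all add: L2_eq_l2)
  have "AE x in lebesgue_on \<Omega>. w x - w' x = 0"
  proof (rule fundamental_lemma[OF assms(1,2) l2_diff[OF sq]], rule ballI)
    fix \<phi> assume \<phi>: "\<phi> \<in> test_functions \<Omega>"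
    have "integrable (lebesgue_on \<Omega>) (\<lambda>x. w x * \<phi> x)" "integrable (lebesgue_on \<Omega>) (\<lambda>x. w' x * \<phi> x)"
      by (intro l2_real_mult sq test_function_l2(1)[OF assms(1) \<phi>])+
    then show "(LINT x|lebesgue_on \<Omega>. (w x - w' x) * \<phi> x) = 0"
      using assms(5,6) \<phi> by (simp add: is_weak_deriv_def left_diff_distrib)
  qed
  then show ?thesis by simp
qed

lemma weak_deriv_properties:
  assumes "u \<in> H1 \<Omega>" "b \<in> Basis"
  shows "weak_deriv \<Omega> b u \<in> L2 \<Omega>" "is_weak_deriv \<Omega> b u (weak_deriv \<Omega> b u)"
proof -
  have "\<exists>w. w \<in> L2 \<Omega> \<and> is_weak_deriv \<Omega> b u w" using assms by (auto simp: H1_def)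
  from someI_ex[OF this] show "weak_deriv \<Omega> b u \<in> L2 \<Omega>" "is_weak_deriv \<Omega> b u (weak_deriv \<Omega> b u)"
    by (simp_all add: weak_deriv_def)
qed

text \<open>\<open>weak_deriv\<close> is an arbitrary choice, so it can be identified only almost
  everywhere, and every computation with it has to go through norms or AE statements.\<close>

lemma weak_deriv_eqI:
  assumes "open \<Omega>" "bounded \<Omega>" "w \<in> L2 \<Omega>" "is_weak_deriv \<Omega> b u w"
  shows "weak_deriv \<Omega> b u \<in> L2 \<Omega>" "AE x in lebesgue_on (\<Omega> :: complex set). weak_deriv \<Omega> b u x = w x"
proof -
  have "\<exists>w. w \<in> L2 \<Omega> \<and> is_weak_deriv \<Omega> b u w" using assms by auto
  from someI_ex[OF this] have *: "weak_deriv \<Omega> b u \<in> L2 \<Omega>" "is_weak_deriv \<Omega> b u (weak_deriv \<Omega> b u)"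
    by (simp_all add: weak_deriv_def)
  then show "weak_deriv \<Omega> b u \<in> L2 \<Omega>" by simp
  show "AE x in lebesgue_on \<Omega>. weak_deriv \<Omega> b u x = w x"
    by (rule weak_deriv_unique[OF assms(1,2) *(1) assms(3) *(2) assms(4)])
qed

lemma is_weak_deriv_diff_test_function:
  assumes "open \<Omega>" "u \<in> L2 \<Omega>" "w \<in> L2 \<Omega>" "is_weak_deriv \<Omega> b u w" "\<phi> \<in> test_functions \<Omega>" "b \<in> Basis"
  shows "is_weak_deriv \<Omega> b (\<lambda>x. u x - \<phi> x) (\<lambda>x. w x - partial_deriv b \<phi> x)"
  unfolding is_weak_deriv_def
proof
  fix \<psi> assume \<psi>: "\<psi> \<in> test_functions \<Omega>"
  note t = test_function_l2[OF assms(1)]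
  have "integrable (lebesgue_on \<Omega>) (\<lambda>x. u x * partial_deriv b \<psi> x)" "integrable (lebesgue_on \<Omega>) (\<lambda>x. \<phi> x * partial_deriv b \<psi> x)"
    "integrable (lebesgue_on \<Omega>) (\<lambda>x. w x * \<psi> x)" "integrable (lebesgue_on \<Omega>) (\<lambda>x. partial_deriv b \<phi> x * \<psi> x)"
    by (intro l2_real_mult assms(2,3)[unfolded L2_eq_l2]
        t(1)[OF \<psi>] t(1)[OF assms(5)] t(2)[OF \<psi> assms(6)] t(2)[OF assms(5,6)])+
  then show "(LINT x|lebesgue_on \<Omega>. (u x - \<phi> x) * partial_deriv b \<psi> x) = - (LINT x|lebesgue_on \<Omega>. (w x - partial_deriv b \<phi> x) * \<psi> x)"
    using assms(4) is_weak_deriv_test_function[OF assms(1,5,6)] \<psi> by (simp add: is_weak_deriv_def left_diff_distrib)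
qed

text \<open>\<open>H1_norm\<close> of u - \<phi> refers to the derivative chosen for the difference,
  which has no formal relation to the one chosen for u; uniqueness almost everywhere links
  them.\<close>

lemma l2norm_weak_deriv_diff_test_function:
  assumes "open \<Omega>" "bounded \<Omega>" "u \<in> L2 \<Omega>" "w \<in> L2 \<Omega>" "is_weak_deriv \<Omega> b u w" "\<phi> \<in> test_functions \<Omega>" "b \<in> Basis"
  shows "l2norm (lebesgue_on (\<Omega> :: complex set)) (weak_deriv \<Omega> b (\<lambda>x. u x - \<phi> x)) = l2norm (lebesgue_on \<Omega>) (\<lambda>x. partial_deriv b \<phi> x - w x)"
proof -
  have L: "(\<lambda>x. w x - partial_deriv b \<phi> x) \<in> L2 \<Omega>"
    using assms(4) test_function_l2(2)[OF assms(1,6,7)]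
    by (auto simp: L2_eq_l2 intro: l2_diff)
  note e = weak_deriv_eqI[OF assms(1,2) L is_weak_deriv_diff_test_function[OF assms(1,3-7)]]
  have "l2norm (lebesgue_on \<Omega>) (weak_deriv \<Omega> b (\<lambda>x. u x - \<phi> x)) = l2norm (lebesgue_on \<Omega>) (\<lambda>x. w x - partial_deriv b \<phi> x)"
    using e L by (intro l2norm_cong_AE) (auto simp: L2_def)
  then show ?thesis by (simp add: l2norm_minus_commute)
qed

lemma H1_0_approximation:
  assumes "open \<Omega>" "bounded \<Omega>" "u \<in> H1_0 \<Omega>"
  shows "\<exists>\<phi>. (\<forall>n::nat. \<phi> n \<in> test_functions (\<Omega> :: complex set)) \<and> (\<forall>b\<in>Basis.
    (\<lambda>n. l2norm (lebesgue_on \<Omega>) (\<lambda>x. partial_deriv b (\<phi> n) x - weak_deriv \<Omega> b u x)) \<longlonglongrightarrow> 0)"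
proof -
  have u: "u \<in> H1 \<Omega>" "u \<in> L2 \<Omega>" using assms(3) by (auto simp: H1_0_def H1_def)
  have "\<forall>n::nat. \<exists>\<phi>\<in>test_functions \<Omega>. H1_norm \<Omega> (\<lambda>x. u x - \<phi> x) < 1 / real (Suc n)"
    using assms(3) by (simp add: H1_0_def)
  then obtain \<phi> where \<phi>: "\<And>n::nat. \<phi> n \<in> test_functions \<Omega>" "\<And>n. H1_norm \<Omega> (\<lambda>x. u x - \<phi> n x) < 1 / real (Suc n)"
    by metis
  have "(\<lambda>n. l2norm (lebesgue_on \<Omega>) (\<lambda>x. partial_deriv b (\<phi> n) x - weak_deriv \<Omega> b u x)) \<longlonglongrightarrow> 0" if b: "b \<in> Basis" for b
  proof (rule Lim_null_comparison[OF always_eventually LIMSEQ_Suc[OF lim_1_over_n]], rule allI)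
    fix n
    have "l2norm (lebesgue_on \<Omega>) (\<lambda>x. partial_deriv b (\<phi> n) x - weak_deriv \<Omega> b u x) = l2norm (lebesgue_on \<Omega>) (weak_deriv \<Omega> b (\<lambda>x. u x - \<phi> n x))"
      by (rule l2norm_weak_deriv_diff_test_function[symmetric, OF assms(1,2) u(2) weak_deriv_properties[OF u(1) b] \<phi>(1) b])
    also have "\<dots> \<le> H1_norm \<Omega> (\<lambda>x. u x - \<phi> n x)"
      unfolding H1_norm_def L2_norm_eq_l2norm
    proof (rule real_le_rsqrt)
      have "(l2norm (lebesgue_on \<Omega>) (weak_deriv \<Omega> b (\<lambda>x. u x - \<phi> n x)))\<^sup>2
         \<le> (\<Sum>b\<in>Basis. (l2norm (lebesgue_on \<Omega>) (weak_deriv \<Omega> b (\<lambda>x. u x - \<phi> n x)))\<^sup>2)"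
        using b by (intro member_le_sum[where f = "\<lambda>b. (l2norm (lebesgue_on \<Omega>) (weak_deriv \<Omega> b (\<lambda>x. u x - \<phi> n x)))\<^sup>2"]) auto
      then show "(l2norm (lebesgue_on \<Omega>) (weak_deriv \<Omega> b (\<lambda>x. u x - \<phi> n x)))\<^sup>2 \<le> (l2norm (lebesgue_on \<Omega>) (\<lambda>x. u x - \<phi> n x))\<^sup>2
         + (\<Sum>b\<in>Basis. (l2norm (lebesgue_on \<Omega>) (weak_deriv \<Omega> b (\<lambda>x. u x - \<phi> n x)))\<^sup>2)"
        by (simp add: add_increasing)
    qed
    finally show "norm (l2norm (lebesgue_on \<Omega>) (\<lambda>x. partial_deriv b (\<phi> n) x - weak_deriv \<Omega> b u x)) \<le> 1 / real (Suc n)"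
      using \<phi>(2)[of n] by simp
  qed
  with \<phi>(1) show ?thesis by blast
qed

text \<open>Both sides of the defining equation of a weak derivative are inner products with fixed
  square integrable functions, so the equation survives the limit.\<close>

lemma H1_0_limit:
  assumes \<Omega>: "open \<Omega>" "bounded \<Omega>" and \<phi>: "\<And>n::nat. \<phi> n \<in> test_functions (\<Omega> :: complex set)"
    and u: "u \<in> l2 (lebesgue_on \<Omega>)" "(\<lambda>n. l2norm (lebesgue_on \<Omega>) (\<lambda>x. \<phi> n x - u x)) \<longlonglongrightarrow> 0"
    and w: "\<And>b. b \<in> Basis \<Longrightarrow> w b \<in> l2 (lebesgue_on \<Omega>)"
      "\<And>b. b \<in> Basis \<Longrightarrow> (\<lambda>n. l2norm (lebesgue_on \<Omega>) (\<lambda>x. partial_deriv b (\<phi> n) x - w b x)) \<longlonglongrightarrow> 0"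
  shows "u \<in> H1_0 \<Omega>" "\<And>b. b \<in> Basis \<Longrightarrow> AE x in lebesgue_on \<Omega>. weak_deriv \<Omega> b u x = w b x"
proof -
  let ?M = "lebesgue_on \<Omega>"
  note t = test_function_l2[OF \<Omega>(1)]
  have uL: "u \<in> L2 \<Omega>" and wL: "\<And>b. b \<in> Basis \<Longrightarrow> w b \<in> L2 \<Omega>" using u w by (simp_all add: L2_eq_l2)
  have wd: "is_weak_deriv \<Omega> b u (w b)" if b: "b \<in> Basis" for b
    unfolding is_weak_deriv_def
  proof
    fix \<psi> assume \<psi>: "\<psi> \<in> test_functions \<Omega>"
    have "(\<lambda>n. LINT x|?M. \<phi> n x * partial_deriv b \<psi> x) \<longlonglongrightarrow> (LINT x|?M. u x * partial_deriv b \<psi> x)"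
      using l2_tendsto_inner[OF t(1)[OF \<phi>] u(1) t(2)[OF \<psi> b] u(2)] by simp
    moreover have "(\<lambda>n. - (LINT x|?M. partial_deriv b (\<phi> n) x * \<psi> x)) \<longlonglongrightarrow> - (LINT x|?M. w b x * \<psi> x)"
      using l2_tendsto_inner[OF t(2)[OF \<phi> b] w(1)[OF b] t(1)[OF \<psi>] w(2)[OF b]] by (intro tendsto_minus) simp
    moreover have "(LINT x|?M. \<phi> n x * partial_deriv b \<psi> x) = - (LINT x|?M. partial_deriv b (\<phi> n) x * \<psi> x)" for n
      using is_weak_deriv_test_function[OF \<Omega>(1) \<phi> b] \<psi> by (simp add: is_weak_deriv_def)
    ultimately show "(LINT x|?M. u x * partial_deriv b \<psi> x) = - (LINT x|?M. w b x * \<psi> x)"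
      by (simp add: LIMSEQ_unique)
  qed
  show "AE x in ?M. weak_deriv \<Omega> b u x = w b x" if "b \<in> Basis" for b
    by (rule weak_deriv_eqI(2)[OF \<Omega> wL[OF that] wd[OF that]])
  have H1: "u \<in> H1 \<Omega>" using uL wL wd by (auto simp: H1_def)
  have "(\<lambda>n. H1_norm \<Omega> (\<lambda>x. u x - \<phi> n x)) \<longlonglongrightarrow> 0"
  proof -
    have "H1_norm \<Omega> (\<lambda>x. u x - \<phi> n x) = sqrt ((l2norm ?M (\<lambda>x. \<phi> n x - u x))\<^sup>2 + (\<Sum>b\<in>Basis. (l2norm ?M (\<lambda>x. partial_deriv b (\<phi> n) x - w b x))\<^sup>2))" for n
      unfolding H1_norm_def L2_norm_eq_l2norm
      using l2norm_weak_deriv_diff_test_function[OF \<Omega> uL wL wd \<phi>] by (simp add: l2norm_minus_commute[of ?M u])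
    moreover have "(\<lambda>n. sqrt ((l2norm ?M (\<lambda>x. \<phi> n x - u x))\<^sup>2 + (\<Sum>b\<in>Basis. (l2norm ?M (\<lambda>x. partial_deriv b (\<phi> n) x - w b x))\<^sup>2)))
       \<longlonglongrightarrow> sqrt (0\<^sup>2 + (\<Sum>b\<in>(Basis :: complex set). 0\<^sup>2))"
      by (intro tendsto_intros u w)
    ultimately show ?thesis by simp
  qed
  then have "\<exists>\<phi>\<in>test_functions \<Omega>. H1_norm \<Omega> (\<lambda>x. u x - \<phi> x) < \<epsilon>" if "\<epsilon> > 0" for \<epsilon>
  proof -
    from order_tendstoD(2)[OF \<open>(\<lambda>n. H1_norm \<Omega> (\<lambda>x. u x - \<phi> n x)) \<longlonglongrightarrow> 0\<close> that]
    obtain n where "H1_norm \<Omega> (\<lambda>x. u x - \<phi> n x) < \<epsilon>" by (auto simp: eventually_sequentially)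
    then show ?thesis using \<phi> by blast
  qed
  with H1 show "u \<in> H1_0 \<Omega>" by (simp add: H1_0_def)
qed

lemma l2norm_Re_le: "f \<in> l2 M \<Longrightarrow> l2norm M (\<lambda>x. Re (f x)) \<le> l2norm M f"
  and l2norm_Im_le: "f \<in> l2 M \<Longrightarrow> l2norm M (\<lambda>x. Im (f x)) \<le> l2norm M f"
  by (rule power2_le_imp_le; simp add: l2_Re_Im(3))+

lemma H1_0_div_curl_closure:
  assumes \<Omega>: "open \<Omega>" "bounded \<Omega>" and u: "u\<^sub>1 \<in> H1_0 \<Omega>" "u\<^sub>2 \<in> H1_0 \<Omega>"
  shows "\<exists>X\<in>div_curl_closure \<Omega>. (\<forall>x. Re (X x) = weak_div \<Omega> (u\<^sub>1, u\<^sub>2) x) \<and>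
    (l2norm (lebesgue_on \<Omega>) X)\<^sup>2 = (H1_seminorm \<Omega> (u\<^sub>1, u\<^sub>2))\<^sup>2"
proof -
  let ?M = "lebesgue_on \<Omega>"
  obtain \<phi> where \<phi>: "\<And>n::nat. \<phi> n \<in> test_functions \<Omega>"
    "\<And>b. b \<in> Basis \<Longrightarrow> (\<lambda>n. l2norm ?M (\<lambda>x. partial_deriv b (\<phi> n) x - weak_deriv \<Omega> b u\<^sub>1 x)) \<longlonglongrightarrow> 0"
    using H1_0_approximation[OF \<Omega> u(1)] by auto
  obtain \<psi> where \<psi>: "\<And>n::nat. \<psi> n \<in> test_functions \<Omega>"
    "\<And>b. b \<in> Basis \<Longrightarrow> (\<lambda>n. l2norm ?M (\<lambda>x. partial_deriv b (\<psi> n) x - weak_deriv \<Omega> b u\<^sub>2 x)) \<longlonglongrightarrow> 0"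
    using H1_0_approximation[OF \<Omega> u(2)] by auto
  have L: "weak_deriv \<Omega> b u\<^sub>1 \<in> l2 ?M" "weak_deriv \<Omega> b u\<^sub>2 \<in> l2 ?M" if "b \<in> Basis" for b
    using weak_deriv_properties(1)[of u\<^sub>1 \<Omega> b] weak_deriv_properties(1)[of u\<^sub>2 \<Omega> b] u that
    by (auto simp: L2_eq_l2 H1_0_def)
  note lim = div_curl_limit[OF \<Omega>(1) \<phi>(1) \<psi>(1) L \<phi>(2) \<psi>(2)]
  show ?thesis
    by (rule bexI[OF _ div_curl_closureI[OF lim(1) \<phi>(1) \<psi>(1) lim(2)]])
      (use lim(3) in \<open>auto simp: weak_div_def H1_seminorm_def L2_norm_eq_l2norm sum_nonneg\<close>)
qed

text \<open>The Poincare inequality on the bounded set turns control of the gradients into control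
  of the functions, so that the latter converge as well.\<close>

lemma H1_0_Cauchy_gradients:
  assumes \<Omega>: "open \<Omega>" "bounded \<Omega>" and \<phi>: "\<And>n::nat. \<phi> n \<in> test_functions (\<Omega> :: complex set)"
    and Cauchy: "\<And>b e. b \<in> Basis \<Longrightarrow> e > 0 \<Longrightarrow>
      \<exists>N. \<forall>m\<ge>N. \<forall>n\<ge>N. l2norm (lebesgue_on \<Omega>) (\<lambda>x. partial_deriv b (\<phi> m) x - partial_deriv b (\<phi> n) x) < e"
  shows "\<exists>u\<in>H1_0 \<Omega>. \<forall>b\<in>Basis. (\<lambda>n. l2norm (lebesgue_on \<Omega>) (\<lambda>x. partial_deriv b (\<phi> n) x - weak_deriv \<Omega> b u x)) \<longlonglongrightarrow> 0"
proof -
  let ?M = "lebesgue_on \<Omega>"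
  note ts = test_function_l2[OF \<Omega>(1) \<phi>]
  have "\<exists>g\<in>l2 ?M. (\<lambda>n. l2norm ?M (\<lambda>x. partial_deriv b (\<phi> n) x - g x)) \<longlonglongrightarrow> 0" if b: "b \<in> Basis" for b
    using l2_complete[of "\<lambda>n. partial_deriv b (\<phi> n)" ?M, OF ts(2)[OF b] Cauchy[OF b]] by blast
  then obtain v where v: "\<And>b. b \<in> Basis \<Longrightarrow> v b \<in> l2 ?M"
    "\<And>b. b \<in> Basis \<Longrightarrow> (\<lambda>n. l2norm ?M (\<lambda>x. partial_deriv b (\<phi> n) x - v b x)) \<longlonglongrightarrow> 0" by metis
  obtain R where R: "R > 0" "\<Omega> \<subseteq> ball 0 R" using bounded_subset_ballD[OF \<Omega>(2), of 0] by auto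
  have R': "\<Omega> \<subseteq> cball 0 R" "0 \<le> R" using R ball_subset_cball by auto
  have C: "\<exists>N. \<forall>m\<ge>N. \<forall>n\<ge>N. l2norm ?M (\<lambda>x. \<phi> m x - \<phi> n x) < e" if e: "e > 0" for e
  proof -
    have "e / (2 * R) > 0" using e R(1) by simp
    from Cauchy[OF one_i_Basis(1) this] obtain N where N: "\<And>m n. m \<ge> N \<Longrightarrow> n \<ge> N \<Longrightarrow>
      l2norm ?M (\<lambda>x. partial_deriv 1 (\<phi> m) x - partial_deriv 1 (\<phi> n) x) < e / (2 * R)" by blast
    have "l2norm ?M (\<lambda>x. \<phi> m x - \<phi> n x) < e" if mn: "m \<ge> N" "n \<ge> N" for m n
    proof -
      have "partial_deriv 1 (\<lambda>x. \<phi> m x - \<phi> n x) = (\<lambda>x. partial_deriv 1 (\<phi> m) x - partial_deriv 1 (\<phi> n) x)"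
        using test_function_diff(2)[OF \<phi> \<phi>] by auto
      then have "l2norm ?M (\<lambda>x. \<phi> m x - \<phi> n x) \<le> 2 * R * l2norm ?M (\<lambda>x. partial_deriv 1 (\<phi> m) x - partial_deriv 1 (\<phi> n) x)"
        using Poincare_inequality[OF \<Omega>(1) test_function_diff(1)[OF \<phi> \<phi>] one_i_Basis(1) R', of m n] by simp
      also have "\<dots> < e" using N[OF mn] R(1) by (simp add: field_simps)
      finally show ?thesis .
    qed
    then show ?thesis by blast
  qed
  obtain u where u: "u \<in> l2 ?M" "(\<lambda>n. l2norm ?M (\<lambda>x. \<phi> n x - u x)) \<longlonglongrightarrow> 0"
    using l2_complete[of \<phi> ?M, OF ts(1) C] by blast
  have h: "u \<in> H1_0 \<Omega>" "\<And>b. b \<in> Basis \<Longrightarrow> AE x in ?M. weak_deriv \<Omega> b u x = v b x"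
    using H1_0_limit[OF \<Omega> \<phi> u v] by blast+
  have "(\<lambda>n. l2norm ?M (\<lambda>x. partial_deriv b (\<phi> n) x - weak_deriv \<Omega> b u x)) \<longlonglongrightarrow> 0" if b: "b \<in> Basis" for b
  proof -
    have "u \<in> H1 \<Omega>" using h(1) by (simp add: H1_0_def)
    then have "weak_deriv \<Omega> b u \<in> l2 ?M"
      using weak_deriv_properties(1)[OF _ b] by (simp add: L2_eq_l2)
    note m = l2D(1)[OF this] l2D(1)[OF v(1)[OF b]] l2D(1)[OF ts(2)[OF b]]
    have "l2norm ?M (\<lambda>x. partial_deriv b (\<phi> n) x - weak_deriv \<Omega> b u x) = l2norm ?M (\<lambda>x. partial_deriv b (\<phi> n) x - v b x)" for n
      by (rule l2norm_cong_AE) (use m h(2)[OF b] in auto)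
    then show ?thesis using v(2)[OF b] by simp
  qed
  with h(1) show ?thesis by blast
qed

text \<open>The isometry, applied to differences of approximating fields, shows that convergence of
  div and curl forces each partial derivative to be Cauchy. The limit fields reproduce
  \<open>X\<close> only up to a null set.\<close>

lemma div_curl_closure_H1_0:
  assumes \<Omega>: "open \<Omega>" "bounded \<Omega>" and X: "X \<in> div_curl_closure \<Omega>"
  shows "\<exists>u\<in>H1_0 \<Omega> \<times> H1_0 \<Omega>. (AE x in lebesgue_on \<Omega>. weak_div \<Omega> u x = Re (X x)) \<and>
    (H1_seminorm \<Omega> u)\<^sup>2 = (l2norm (lebesgue_on \<Omega>) X)\<^sup>2"
proof -
  let ?M = "lebesgue_on \<Omega>"
  obtain \<phi> \<psi> where t: "\<And>n::nat. \<phi> n \<in> test_functions \<Omega>" "\<And>n. \<psi> n \<in> test_functions \<Omega>"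
    and lim: "(\<lambda>n. l2norm ?M (\<lambda>x. div_curl (\<phi> n) (\<psi> n) x - X x)) \<longlonglongrightarrow> 0"
    using div_curl_closure_approximation[OF X] by auto
  have Xs: "X \<in> l2 ?M" using X by (simp add: div_curl_closure_def)
  have dcs: "div_curl (\<phi> n) (\<psi> n) \<in> l2 ?M" for n
    by (rule div_curl_l2[OF \<Omega>(1) t])
  define d where "d m n = l2norm ?M (\<lambda>x. div_curl (\<phi> m) (\<psi> m) x - div_curl (\<phi> n) (\<psi> n) x)" for m n
  have part: "l2norm ?M (\<lambda>x. partial_deriv b (\<phi> m) x - partial_deriv b (\<phi> n) x) \<le> d m n"
    "l2norm ?M (\<lambda>x. partial_deriv b (\<psi> m) x - partial_deriv b (\<psi> n) x) \<le> d m n" if b: "b \<in> Basis" for b m n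
  proof -
    let ?p = "\<lambda>x. \<phi> m x - \<phi> n x" and ?q = "\<lambda>x. \<psi> m x - \<psi> n x"
    have "div_curl ?p ?q = (\<lambda>x. div_curl (\<phi> m) (\<psi> m) x - div_curl (\<phi> n) (\<psi> n) x)"
      using div_curl_add_scaled[OF t(1)[of m] t(2)[of m] t(1)[of n] t(2)[of n], where c = "-1"] by (simp add: fun_eq_iff)
    then have "(\<Sum>b\<in>Basis. (l2norm ?M (partial_deriv b ?p))\<^sup>2 + (l2norm ?M (partial_deriv b ?q))\<^sup>2) = (d m n)\<^sup>2"
      using div_curl_norm[OF \<Omega>(1) test_function_diff(1)[OF t(1) t(1)] test_function_diff(1)[OF t(2) t(2)], of m n m n]
      by (simp add: d_def)
    moreover have "(l2norm ?M (partial_deriv b ?p))\<^sup>2 + (l2norm ?M (partial_deriv b ?q))\<^sup>2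
        \<le> (\<Sum>b\<in>Basis. (l2norm ?M (partial_deriv b ?p))\<^sup>2 + (l2norm ?M (partial_deriv b ?q))\<^sup>2)"
      using b by (intro member_le_sum) auto
    ultimately have s: "(l2norm ?M (partial_deriv b ?p))\<^sup>2 \<le> (d m n)\<^sup>2" "(l2norm ?M (partial_deriv b ?q))\<^sup>2 \<le> (d m n)\<^sup>2"
      using zero_le_power2[of "l2norm ?M (partial_deriv b ?p)"] zero_le_power2[of "l2norm ?M (partial_deriv b ?q)"]
      by linarith+
    have e: "partial_deriv b ?p = (\<lambda>x. partial_deriv b (\<phi> m) x - partial_deriv b (\<phi> n) x)"
      "partial_deriv b ?q = (\<lambda>x. partial_deriv b (\<psi> m) x - partial_deriv b (\<psi> n) x)"
      using test_function_diff(2)[OF t(1) t(1)] test_function_diff(2)[OF t(2) t(2)] by auto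
    have "0 \<le> d m n" by (simp add: d_def)
    then show "l2norm ?M (\<lambda>x. partial_deriv b (\<phi> m) x - partial_deriv b (\<phi> n) x) \<le> d m n"
      "l2norm ?M (\<lambda>x. partial_deriv b (\<psi> m) x - partial_deriv b (\<psi> n) x) \<le> d m n"
      using power2_le_imp_le[OF s(1)] power2_le_imp_le[OF s(2)] unfolding e by blast+
  qed
  have d: "\<exists>N. \<forall>m\<ge>N. \<forall>n\<ge>N. d m n < e" if e: "e > 0" for e
    unfolding d_def by (rule l2_convergent_Cauchy[OF dcs Xs lim e])
  have C: "\<exists>N. \<forall>m\<ge>N. \<forall>n\<ge>N. l2norm ?M (\<lambda>x. partial_deriv b (\<phi> m) x - partial_deriv b (\<phi> n) x) < e"
    "\<exists>N. \<forall>m\<ge>N. \<forall>n\<ge>N. l2norm ?M (\<lambda>x. partial_deriv b (\<psi> m) x - partial_deriv b (\<psi> n) x) < e"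
    if "b \<in> Basis" "e > 0" for b e
    using d[OF that(2)] le_less_trans[OF part(1)[OF that(1)]] le_less_trans[OF part(2)[OF that(1)]] by blast+
  obtain u\<^sub>1 where u1: "u\<^sub>1 \<in> H1_0 \<Omega>"
    "\<And>b. b \<in> Basis \<Longrightarrow> (\<lambda>n. l2norm ?M (\<lambda>x. partial_deriv b (\<phi> n) x - weak_deriv \<Omega> b u\<^sub>1 x)) \<longlonglongrightarrow> 0"
    using H1_0_Cauchy_gradients[of \<Omega> \<phi>, OF \<Omega> t(1) C(1)] by blast
  obtain u\<^sub>2 where u2: "u\<^sub>2 \<in> H1_0 \<Omega>"
    "\<And>b. b \<in> Basis \<Longrightarrow> (\<lambda>n. l2norm ?M (\<lambda>x. partial_deriv b (\<psi> n) x - weak_deriv \<Omega> b u\<^sub>2 x)) \<longlonglongrightarrow> 0"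
    using H1_0_Cauchy_gradients[of \<Omega> \<psi>, OF \<Omega> t(2) C(2)] by blast
  have w: "weak_deriv \<Omega> b u\<^sub>1 \<in> l2 ?M" "weak_deriv \<Omega> b u\<^sub>2 \<in> l2 ?M" if "b \<in> Basis" for b
    using weak_deriv_properties(1)[of _ \<Omega> b] u1(1) u2(1) that by (auto simp: L2_eq_l2 H1_0_def)
  let ?Y = "\<lambda>x. Complex (weak_deriv \<Omega> 1 u\<^sub>1 x + weak_deriv \<Omega> \<i> u\<^sub>2 x) (weak_deriv \<Omega> 1 u\<^sub>2 x - weak_deriv \<Omega> \<i> u\<^sub>1 x)"
  have l: "?Y \<in> l2 ?M" "(\<lambda>n. l2norm ?M (\<lambda>x. div_curl (\<phi> n) (\<psi> n) x - ?Y x)) \<longlonglongrightarrow> 0"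
    "(l2norm ?M ?Y)\<^sup>2 = (\<Sum>b\<in>Basis. (l2norm ?M (weak_deriv \<Omega> b u\<^sub>1))\<^sup>2 + (l2norm ?M (weak_deriv \<Omega> b u\<^sub>2))\<^sup>2)"
    using div_curl_limit[OF \<Omega>(1) t w u1(2) u2(2)] by blast+
  have XY: "AE x in ?M. X x = ?Y x" by (rule l2_limit_unique[OF dcs Xs l(1) lim l(2)])
  then have Xn: "l2norm ?M X = l2norm ?M ?Y"
    by (intro l2norm_cong_AE l2D(1)[OF Xs] l2D(1)[OF l(1)])
  show ?thesis
  proof (intro bexI[of _ "(u\<^sub>1, u\<^sub>2)"] conjI)
    show "(u\<^sub>1, u\<^sub>2) \<in> H1_0 \<Omega> \<times> H1_0 \<Omega>" using u1(1) u2(1) by simp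
    show "AE x in ?M. weak_div \<Omega> (u\<^sub>1, u\<^sub>2) x = Re (X x)"
      using XY by eventually_elim (simp add: weak_div_def)
    show "(H1_seminorm \<Omega> (u\<^sub>1, u\<^sub>2))\<^sup>2 = (l2norm ?M X)\<^sup>2"
      unfolding Xn l(3) by (simp add: H1_seminorm_def L2_norm_eq_l2norm sum_nonneg)
  qed
qed

text \<open>\<open>Friedrichs_space\<close> demands genuine holomorphy, whereas \<open>a\<close> is
  only a representative; Weyl's lemma supplies a holomorphic function equal to it almost everywhere,
  with the same norms and mean.\<close>

lemma Friedrichs_inequality_orthogonal:
  assumes \<Omega>: "open \<Omega>" "bounded \<Omega>" and F: "Friedrichs_admissible \<Omega> \<Gamma>"
    and a: "a \<in> div_curl_orthogonal \<Omega>" "(LINT x|lebesgue_on \<Omega>. Re (a x)) = 0" "(LINT x|lebesgue_on \<Omega>. Im (a x)) = 0"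
  shows "(l2norm (lebesgue_on \<Omega>) (\<lambda>x. Re (a x)))\<^sup>2 \<le> \<Gamma> * (l2norm (lebesgue_on \<Omega>) (\<lambda>x. Im (a x)))\<^sup>2"
proof -
  let ?M = "lebesgue_on \<Omega>"
  have as: "a \<in> l2 ?M" using a(1) by (simp add: div_curl_orthogonal_def)
  obtain f where f: "f holomorphic_on \<Omega>" "AE z in ?M. a z = f z"
    using weakly_holomorphic_imp_holomorphic[OF \<Omega> as div_curl_orthogonal_weakly_holomorphic[OF \<Omega>(1) a(1)]] .
  have fm: "f \<in> borel_measurable ?M"
    using \<Omega>(1) by (intro continuous_imp_measurable_on_sets_lebesgue holomorphic_on_imp_continuous_on f) simp
  note am = l2D(1)[OF as]
  have int: "integrable ?M a" by (rule l2_imp_integrable[OF finite_measure_bounded_open[OF \<Omega>] as])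
  have "f \<in> Friedrichs_space \<Omega>"
    unfolding Friedrichs_space_def
  proof (intro CollectI conjI f(1))
    have "integrable ?M (\<lambda>z. (norm (a z))\<^sup>2) \<longleftrightarrow> integrable ?M (\<lambda>z. (norm (f z))\<^sup>2)"
      by (rule integrable_cong_AE) (use am fm f(2) in auto)
    then show "integrable ?M (\<lambda>z. (norm (f z))\<^sup>2)" using l2D(2)[OF as] by simp
    have "(LINT z|?M. f z) = (LINT z|?M. a z)" by (rule integral_cong_AE) (use am fm f(2) in auto)
    also have "\<dots> = 0" using a(2,3) int by (simp add: complex_eq_iff)
    finally show "(LINT z|?M. f z) = 0" .
  qed
  then have "(l2norm ?M (\<lambda>x. Re (f x)))\<^sup>2 \<le> \<Gamma> * (l2norm ?M (\<lambda>x. Im (f x)))\<^sup>2"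
    using F by (simp add: Friedrichs_admissible_def L2_norm_eq_l2norm)
  moreover have "l2norm ?M (\<lambda>x. Re (f x)) = l2norm ?M (\<lambda>x. Re (a x))" "l2norm ?M (\<lambda>x. Im (f x)) = l2norm ?M (\<lambda>x. Im (a x))"
    using am fm f(2) by (auto intro!: l2norm_cong_AE)
  ultimately show ?thesis by simp
qed

text \<open>Minimise \<open>\<parallel>q - div V\<parallel>\<^sup>2 + t\<^sup>2 \<parallel>curl V\<parallel>\<^sup>2\<close>; the Euler-Lagrange equation says that \<open>q - div V - i t\<^sup>2 curl V\<close>
  is orthogonal to the range.\<close>

lemma penalized_div_curl:
  assumes \<Omega>: "open \<Omega>" "bounded \<Omega>" and q: "q \<in> l2 (lebesgue_on \<Omega>)" and t: "t > 0"
  shows "\<exists>x\<in>div_curl_closure \<Omega>. (\<lambda>z. Complex (q z - Re (x z)) (- (t\<^sup>2 * Im (x z)))) \<in> div_curl_orthogonal \<Omega>"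
proof -
  let ?M = "lebesgue_on \<Omega>"
  \<comment> \<open>Scaling the imaginary part by t turns the penalised functional into an ordinary
    squared distance, so that \<open>l2_projection\<close> applies.\<close>
  define st where "st c f z = Complex (Re (f z)) (c * Im (f z))" for c and f :: "complex \<Rightarrow> complex" and z
  have st_sq: "st c f \<in> l2 ?M" if "f \<in> l2 ?M" for c f
    unfolding st_def[abs_def]
    using l2_Complex[OF l2_Re_Im(1)[OF that] l2_scaleR[OF l2_Re_Im(2)[OF that], of c]] by simp
  define S where "S = {st t (div_curl \<phi> \<psi>) |\<phi> \<psi>. \<phi> \<in> test_functions \<Omega> \<and> \<psi> \<in> test_functions \<Omega>}"
  have f: "(\<lambda>z. Complex (q z) 0) \<in> l2 ?M"
    by (rule l2_Complex[OF q]) (simp add: l2_def)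
  have S1: "S \<subseteq> l2 ?M" unfolding S_def using div_curl_l2[OF \<Omega>(1)] st_sq by auto
  have S2: "S \<noteq> {}" unfolding S_def using zero_test_function by blast
  have S3: "(\<lambda>x. s x + c *\<^sub>R s' x) \<in> S" if "s \<in> S" "s' \<in> S" for s s' c
  proof -
    obtain \<phi> \<psi> \<phi>' \<psi>' where e: "s = st t (div_curl \<phi> \<psi>)" "s' = st t (div_curl \<phi>' \<psi>')"
      and T: "\<phi> \<in> test_functions \<Omega>" "\<psi> \<in> test_functions \<Omega>" "\<phi>' \<in> test_functions \<Omega>" "\<psi>' \<in> test_functions \<Omega>"
      using \<open>s \<in> S\<close> \<open>s' \<in> S\<close> unfolding S_def by blast
    have "(\<lambda>x. s x + c *\<^sub>R s' x) = st t (div_curl (\<lambda>x. \<phi> x + c * \<phi>' x) (\<lambda>x. \<psi> x + c * \<psi>' x))"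
      unfolding e st_def by (auto simp: div_curl_add_scaled[OF T] complex_eq_iff algebra_simps fun_eq_iff)
    then show ?thesis
      unfolding S_def using test_function_add_scaled(1)[OF T(1,3)] test_function_add_scaled(1)[OF T(2,4)] by blast
  qed
  obtain p s where p: "p \<in> l2 ?M" and s: "\<And>n::nat. s n \<in> S" and lim: "(\<lambda>n. l2norm ?M (\<lambda>x. s n x - p x)) \<longlonglongrightarrow> 0"
    and orth: "\<And>r. r \<in> S \<Longrightarrow> (LINT x|?M. (Complex (q x) 0 - p x) \<bullet> r x) = 0"
    using l2_projection[OF f S1 S2 S3] by blast
  have "\<forall>n. \<exists>\<phi> \<psi>. s n = st t (div_curl \<phi> \<psi>) \<and> \<phi> \<in> test_functions \<Omega> \<and> \<psi> \<in> test_functions \<Omega>"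
    using s unfolding S_def by blast
  then obtain \<phi> \<psi> where e: "\<And>n. s n = st t (div_curl (\<phi> n) (\<psi> n))" and T: "\<And>n. \<phi> n \<in> test_functions \<Omega>" "\<And>n. \<psi> n \<in> test_functions \<Omega>"
    by metis
  \<comment> \<open>The scaling is undone: \<open>p\<close> is a limit of scaled fields, so
    \<open>x\<close> is a limit of unscaled ones.\<close>
  define x where "x = st (1 / t) p"
  have xs: "x \<in> l2 ?M" unfolding x_def by (rule st_sq[OF p])
  have "x \<in> div_curl_closure \<Omega>"
  proof (rule div_curl_closureI[OF xs T], rule Lim_null_comparison[OF always_eventually], rule allI)
    fix n
    have d: "(\<lambda>x. s n x - p x) \<in> l2 ?M" using s S1 p by (auto intro: l2_diff)
    have "(\<lambda>z. div_curl (\<phi> n) (\<psi> n) z - x z) = (\<lambda>z. Complex (Re (s n z - p z)) ((1 / t) *\<^sub>R Im (s n z - p z)))"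
      unfolding x_def e st_def using t by (auto simp: complex_eq_iff fun_eq_iff field_simps)
    then have "l2norm ?M (\<lambda>z. div_curl (\<phi> n) (\<psi> n) z - x z) \<le> l2norm ?M (\<lambda>z. Re (s n z - p z)) + l2norm ?M (\<lambda>z. (1 / t) *\<^sub>R Im (s n z - p z))"
      by (simp only:) (intro l2norm_Complex_le l2_scaleR l2_Re_Im(1,2)[OF d])
    also have "\<dots> = l2norm ?M (\<lambda>z. Re (s n z - p z)) + (1 / t) * l2norm ?M (\<lambda>z. Im (s n z - p z))"
      using t by (simp only: l2norm_scaleR) simp
    also have "\<dots> \<le> l2norm ?M (\<lambda>z. s n z - p z) + (1 / t) * l2norm ?M (\<lambda>z. s n z - p z)"
    proof (intro add_mono mult_left_mono)
      show "l2norm ?M (\<lambda>z. Re (s n z - p z)) \<le> l2norm ?M (\<lambda>z. s n z - p z)" "l2norm ?M (\<lambda>z. Im (s n z - p z)) \<le> l2norm ?M (\<lambda>z. s n z - p z)"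
        by (rule l2norm_Re_le[OF d] l2norm_Im_le[OF d])+
    qed (use t in simp)
    finally show "norm (l2norm ?M (\<lambda>z. div_curl (\<phi> n) (\<psi> n) z - x z)) \<le> (1 + 1 / t) * l2norm ?M (\<lambda>z. s n z - p z)"
      by (simp add: algebra_simps)
  next
    show "(\<lambda>n. (1 + 1 / t) * l2norm ?M (\<lambda>z. s n z - p z)) \<longlonglongrightarrow> 0"
      using tendsto_mult_left[OF lim, of "1 + 1 / t"] by simp
  qed
  moreover have "(\<lambda>z. Complex (q z - Re (x z)) (- (t\<^sup>2 * Im (x z)))) \<in> div_curl_orthogonal \<Omega>"
    unfolding div_curl_orthogonal_def
  proof (intro CollectI conjI ballI)
    show "(\<lambda>z. Complex (q z - Re (x z)) (- (t\<^sup>2 * Im (x z)))) \<in> l2 ?M"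
      using l2_Complex[OF l2_diff[OF q l2_Re_Im(1)[OF xs]]
        l2_scaleR[OF l2_Re_Im(2)[OF xs], of "- t\<^sup>2"]] by simp
    fix \<phi> \<psi> assume "\<phi> \<in> test_functions \<Omega>" "\<psi> \<in> test_functions \<Omega>"
    then have "st t (div_curl \<phi> \<psi>) \<in> S" unfolding S_def by blast
    \<comment> \<open>One factor t comes from Im p = t Im x, the other from scaling the test field;
      moved to the residual, they form the weight t^2.\<close>
    from orth[OF this] show "(LINT z|?M. Complex (q z - Re (x z)) (- (t\<^sup>2 * Im (x z))) \<bullet> div_curl \<phi> \<psi> z) = 0"
      using t by (simp add: x_def st_def inner_complex_def power2_eq_square algebra_simps)
  qed
  ultimately show ?thesis by blast
qed

section \<open>Comparison of the two constants\<close>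

text \<open>A datum of positive norm is what forces 1 \<le> C for an admissible C. The function Re z
  minus its mean is continuous and not constant on any disc.\<close>

lemma L2_mean_zero_nontrivial:
  assumes "bounded_domain (\<Omega> :: complex set)"
  obtains q where "q \<in> L2_mean_zero \<Omega>" "l2norm (lebesgue_on \<Omega>) q > 0"
proof -
  have \<Omega>: "open \<Omega>" "bounded \<Omega>" "\<Omega> \<noteq> {}" using assms by (auto simp: bounded_domain_def)
  let ?M = "lebesgue_on \<Omega>"
  interpret finite_measure ?M by (rule finite_measure_bounded_open[OF \<Omega>(1,2)])
  obtain R where R: "\<And>z. z \<in> \<Omega> \<Longrightarrow> norm z \<le> R" using \<Omega>(2) unfolding bounded_iff by blast
  define c where "c = (LINT z|?M. Re z) / measure ?M \<Omega>"
  define q where "q z = Re z - c" for z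
  have qc: "continuous_on S q" for S unfolding q_def by (intro continuous_intros)
  have qm: "q \<in> borel_measurable ?M" using \<Omega>(1) by (intro continuous_imp_measurable_on_sets_lebesgue qc) simp
  have Rem: "Re \<in> borel_measurable ?M"
    using \<Omega>(1) by (intro continuous_imp_measurable_on_sets_lebesgue continuous_intros) simp
  have Re_int: "integrable ?M Re"
    by (rule integrable_const_bound[of _ R]) (use Rem order_trans[OF abs_Re_le_cmod R] in auto)
  have "norm (q z) \<le> R + \<bar>c\<bar>" if "z \<in> space ?M" for z
    using R[of z] abs_Re_le_cmod[of z] that by (simp add: q_def)
  then have qs: "q \<in> l2 ?M" by (rule l2_bounded[OF finite_measure_axioms qm])
  have "\<not> negligible \<Omega>" using open_not_negligible[OF \<Omega>(1,3)] .
  then have "measure ?M \<Omega> \<noteq> 0"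
    using lmeasurable_open[OF \<Omega>(2,1)] \<Omega>(1)
    by (simp add: measure_restrict_space negligible_iff_measure)
  then have "(LINT z|?M. q z) = 0" using Re_int by (simp add: q_def c_def)
  then have q0: "q \<in> L2_mean_zero \<Omega>" using qs by (simp add: L2_mean_zero_def L2_eq_l2)
  have "l2norm ?M q \<noteq> 0"
  proof
    assume "l2norm ?M q = 0"
    from l2norm_eq_0[OF qs this] have "AE z in lebesgue. z \<in> \<Omega> \<longrightarrow> q z = 0"
      using \<Omega>(1) by (simp add: AE_restrict_space_iff)
    then have "negligible {z \<in> \<Omega>. q z \<noteq> 0}"
      unfolding negligible_iff_null_sets eventually_ae_filter
      by (auto intro: null_sets_completion_subset)
    moreover have "open {z \<in> \<Omega>. q z \<noteq> 0}"
    proof -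
      have "{z \<in> \<Omega>. q z \<noteq> 0} = \<Omega> \<inter> {z. q z \<noteq> 0}" by auto
      then show ?thesis using \<Omega>(1) open_Collect_neq[OF qc continuous_on_const[of UNIV 0]] by auto
    qed
    moreover have "{z \<in> \<Omega>. q z \<noteq> 0} \<noteq> {}"
    proof -
      obtain z where z: "z \<in> \<Omega>" using \<Omega>(3) by auto
      obtain d where d: "d > 0" "ball z d \<subseteq> \<Omega>" using \<Omega>(1) z open_contains_ball_eq by blast
      \<comment> \<open>A shift in the real direction changes \<open>q\<close>, so one of the two
        values is nonzero.\<close>
      have "z + of_real (d / 2) \<in> ball z d" using d(1) by (simp add: dist_norm)
      then have "z + of_real (d / 2) \<in> \<Omega>" using d(2) by blast
      moreover have "q (z + of_real (d / 2)) \<noteq> q z" using d(1) by (simp add: q_def)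
      ultimately show ?thesis using z by (metis (mono_tags, lifting) empty_Collect_eq)
    qed
    ultimately show False using open_not_negligible by blast
  qed
  then have "l2norm ?M q > 0" using l2norm_nonneg[of ?M q] by linarith
  with q0 show ?thesis by (rule that)
qed

text \<open>The seminorm of the solution splits into the norms of its divergence \<open>q\<close>
  and its curl \<open>Im X\<close>. The resulting inequality contains both 1 \<le> C for nonzero
  \<open>q\<close> and the bound (C - 1) \<parallel>q\<parallel>^2 on the curl.\<close>

lemma Babuska_Aziz_admissible_closure:
  assumes \<Omega>: "open \<Omega>" "bounded \<Omega>" and C: "Babuska_Aziz_admissible \<Omega> C" and q: "q \<in> L2_mean_zero \<Omega>"
  obtains X where "X \<in> div_curl_closure \<Omega>" "AE x in lebesgue_on \<Omega>. Re (X x) = q x"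
    "(l2norm (lebesgue_on \<Omega>) q)\<^sup>2 + (l2norm (lebesgue_on \<Omega>) (\<lambda>x. Im (X x)))\<^sup>2 \<le> C * (l2norm (lebesgue_on \<Omega>) q)\<^sup>2"
proof -
  let ?M = "lebesgue_on \<Omega>"
  obtain u\<^sub>1 u\<^sub>2 where u: "u\<^sub>1 \<in> H1_0 \<Omega>" "u\<^sub>2 \<in> H1_0 \<Omega>" "AE x in ?M. weak_div \<Omega> (u\<^sub>1, u\<^sub>2) x = q x"
    "(H1_seminorm \<Omega> (u\<^sub>1, u\<^sub>2))\<^sup>2 \<le> C * (l2norm ?M q)\<^sup>2"
    using C q unfolding Babuska_Aziz_admissible_def L2_norm_eq_l2norm by blast
  obtain X where X: "X \<in> div_curl_closure \<Omega>" "\<And>x. Re (X x) = weak_div \<Omega> (u\<^sub>1, u\<^sub>2) x"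
    "(l2norm ?M X)\<^sup>2 = (H1_seminorm \<Omega> (u\<^sub>1, u\<^sub>2))\<^sup>2"
    using H1_0_div_curl_closure[OF \<Omega> u(1,2)] by auto
  have Xs: "X \<in> l2 ?M" using X(1) by (simp add: div_curl_closure_def)
  have qs: "q \<in> l2 ?M" using q by (simp add: L2_mean_zero_def L2_eq_l2)
  have ae: "AE x in ?M. Re (X x) = q x" using u(3) by (simp add: X(2))
  then have "l2norm ?M (\<lambda>x. Re (X x)) = l2norm ?M q"
    by (intro l2norm_cong_AE l2D(1)[OF qs] l2D(1)[OF l2_Re_Im(1)[OF Xs]])
  then have "(l2norm ?M q)\<^sup>2 + (l2norm ?M (\<lambda>x. Im (X x)))\<^sup>2 \<le> C * (l2norm ?M q)\<^sup>2"
    using l2_Re_Im(3)[OF Xs] X(3) u(4) by simp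
  with X(1) ae show ?thesis by (rule that)
qed

lemma Babuska_Aziz_imp_Friedrichs:
  assumes "bounded_domain \<Omega>" and C: "Babuska_Aziz_admissible \<Omega> C"
  shows "1 \<le> C" "Friedrichs_admissible \<Omega> (C - 1)"
proof -
  have \<Omega>: "open \<Omega>" "bounded \<Omega>" using assms by (auto simp: bounded_domain_def)
  let ?M = "lebesgue_on \<Omega>"
  show C1: "1 \<le> C"
  proof -
    obtain q where q: "q \<in> L2_mean_zero \<Omega>" "l2norm ?M q > 0" using L2_mean_zero_nontrivial[OF assms(1)] .
    obtain X where "(l2norm ?M q)\<^sup>2 + (l2norm ?M (\<lambda>x. Im (X x)))\<^sup>2 \<le> C * (l2norm ?M q)\<^sup>2"
      using Babuska_Aziz_admissible_closure[OF \<Omega> C q(1)] .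
    then have "1 * (l2norm ?M q)\<^sup>2 \<le> C * (l2norm ?M q)\<^sup>2" by (smt (verit) zero_le_power2)
    then show ?thesis using q(2) by (simp add: mult_le_cancel_right)
  qed
  show "Friedrichs_admissible \<Omega> (C - 1)"
    unfolding Friedrichs_admissible_def L2_norm_eq_l2norm
  proof
    fix w assume w: "w \<in> Friedrichs_space \<Omega>"
    then have hol: "w holomorphic_on \<Omega>" and mean: "(LINT z|?M. w z) = 0" by (auto simp: Friedrichs_space_def)
    have wm: "w \<in> borel_measurable ?M"
      using \<Omega>(1) by (intro continuous_imp_measurable_on_sets_lebesgue holomorphic_on_imp_continuous_on hol) simp
    have ws: "w \<in> l2 ?M" using w wm by (simp add: Friedrichs_space_def l2_def)
    note RI = l2_Re_Im(1,2)[OF ws]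
    have int: "integrable ?M w" by (rule l2_imp_integrable[OF finite_measure_bounded_open[OF \<Omega>] ws])
    have "(LINT z|?M. Re (w z)) = 0" using mean int by simp
    then have h: "(\<lambda>z. Re (w z)) \<in> L2_mean_zero \<Omega>" using RI by (simp add: L2_mean_zero_def L2_eq_l2)
    let ?h = "l2norm ?M (\<lambda>z. Re (w z))" and ?g = "l2norm ?M (\<lambda>z. Im (w z))"
    obtain X where X: "X \<in> div_curl_closure \<Omega>" "AE x in ?M. Re (X x) = Re (w x)"
      "?h\<^sup>2 + (l2norm ?M (\<lambda>x. Im (X x)))\<^sup>2 \<le> C * ?h\<^sup>2"
      using Babuska_Aziz_admissible_closure[OF \<Omega> C h] .
    have Xs: "X \<in> l2 ?M" using X(1) by (simp add: div_curl_closure_def)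
    note XRI = l2_Re_Im(1,2)[OF Xs]
    have "0 = (LINT x|?M. w x \<bullet> X x)"
      using div_curl_closure_orthogonal[OF \<Omega>(1) holomorphic_div_curl_orthogonal[OF \<Omega>(1) hol ws] X(1)] by simp
    also have "\<dots> = (LINT x|?M. Re (w x) * Re (X x)) + (LINT x|?M. Im (w x) * Im (X x))"
      using l2_real_mult[OF RI(1) XRI(1)] l2_real_mult[OF RI(2) XRI(2)]
      by (simp add: inner_complex_def)
    also have "(LINT x|?M. Re (w x) * Re (X x)) = ?h\<^sup>2"
      unfolding l2norm_power2
      by (rule integral_cong_AE)
        (use X(2) RI[THEN l2D(1)] XRI[THEN l2D(1)] in \<open>auto simp: power2_eq_square\<close>)
    finally have "?h\<^sup>2 = - (LINT x|?M. Im (w x) * Im (X x))" by simp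
    then have le: "?h\<^sup>2 \<le> ?g * l2norm ?M (\<lambda>x. Im (X x))"
      using l2_Cauchy_Schwarz[OF RI(2) XRI(2)] by simp
    have "(?h\<^sup>2)\<^sup>2 \<le> (?g * l2norm ?M (\<lambda>x. Im (X x)))\<^sup>2" by (rule power_mono[OF le]) simp
    also have "\<dots> \<le> ?g\<^sup>2 * ((C - 1) * ?h\<^sup>2)"
      unfolding power_mult_distrib using X(3) by (intro mult_left_mono) (auto simp: algebra_simps)
    \<comment> \<open>Everything is kept squared to avoid roots. A factor \<parallel>h\<parallel>^2
      is cancelled next; if it is zero, 1 \<le> C makes the right-hand side nonnegative.\<close>
    finally have le2: "?h\<^sup>2 * ?h\<^sup>2 \<le> ((C - 1) * ?g\<^sup>2) * ?h\<^sup>2" by (simp add: power2_eq_square mult.assoc mult.left_commute mult.commute)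
    show "?h\<^sup>2 \<le> (C - 1) * ?g\<^sup>2"
    proof (cases "?h = 0")
      case True
      then show ?thesis using C1 by simp
    next
      case False
      then have "?h\<^sup>2 > 0" by simp
      then show ?thesis using le2 by (rule mult_right_le_imp_le[rotated])
    qed
  qed
qed

lemma div_curl_orthogonal_scaleR:
  "a \<in> div_curl_orthogonal \<Omega> \<Longrightarrow> (\<lambda>x. c *\<^sub>R a x) \<in> div_curl_orthogonal \<Omega>"
  by (auto simp: div_curl_orthogonal_def intro: l2_scaleR)

lemma div_curl_orthogonal_diff:
  assumes "open \<Omega>" "a \<in> div_curl_orthogonal \<Omega>" "b \<in> div_curl_orthogonal \<Omega>"
  shows "(\<lambda>x. a x - b x) \<in> div_curl_orthogonal \<Omega>"
  using assms l2_inner[OF _ div_curl_l2[OF assms(1)]]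
  by (auto simp: div_curl_orthogonal_def inner_diff_left intro: l2_diff)

lemma div_curl_closure_closed:
  assumes "open \<Omega>" "\<And>n::nat. x n \<in> div_curl_closure \<Omega>" "X \<in> l2 (lebesgue_on \<Omega>)"
    "(\<lambda>n. l2norm (lebesgue_on \<Omega>) (\<lambda>z. x n z - X z)) \<longlonglongrightarrow> 0"
  shows "X \<in> div_curl_closure \<Omega>"
  unfolding div_curl_closure_def
proof (intro CollectI conjI allI impI assms(3))
  let ?M = "lebesgue_on \<Omega>"
  fix \<epsilon> :: real assume \<epsilon>: "\<epsilon> > 0"
  obtain n where n: "l2norm ?M (\<lambda>z. x n z - X z) < \<epsilon> / 2"
    using order_tendstoD(2)[OF assms(4) half_gt_zero[OF \<epsilon>]] by (auto simp: eventually_sequentially)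
  obtain \<phi> \<psi> where t: "\<phi> \<in> test_functions \<Omega>" "\<psi> \<in> test_functions \<Omega>" "l2norm ?M (\<lambda>z. div_curl \<phi> \<psi> z - x n z) < \<epsilon> / 2"
    using assms(2)[of n] half_gt_zero[OF \<epsilon>] unfolding div_curl_closure_def by blast
  have "x n \<in> l2 ?M" using assms(2) by (simp add: div_curl_closure_def)
  from l2norm_diff_triangle[OF div_curl_l2[OF assms(1) t(1,2)] this assms(3)]
  have "l2norm ?M (\<lambda>z. div_curl \<phi> \<psi> z - X z) < \<epsilon>" using n t(3) by linarith
  then show "\<exists>\<phi>\<in>test_functions \<Omega>. \<exists>\<psi>\<in>test_functions \<Omega>. l2norm ?M (\<lambda>x. div_curl \<phi> \<psi> x - X x) < \<epsilon>"
    using t(1,2) by blast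
qed

text \<open>Stated for a pair (y, b) without \<tau>, so that it covers a single minimiser and a
  difference of two. Orthogonality says that \<parallel>Im y\<parallel>^2 is the integral of Re b Re
  y, and the Friedrichs inequality bounds Re b by Im b = -Im y; one factor \<parallel>Im
  y\<parallel> cancels.\<close>

lemma conjugate_estimate:
  assumes \<Omega>: "open \<Omega>" "bounded \<Omega>" and F: "Friedrichs_admissible \<Omega> \<Gamma>" and \<Gamma>: "0 \<le> \<Gamma>"
    and y: "y \<in> l2 (lebesgue_on \<Omega>)"
    and b: "b \<in> div_curl_orthogonal \<Omega>" "(LINT x|lebesgue_on \<Omega>. Re (b x)) = 0" "(LINT x|lebesgue_on \<Omega>. Im (b x)) = 0"
    and yb: "\<And>z. Im (b z) = - Im (y z)" "(LINT x|lebesgue_on \<Omega>. b x \<bullet> y x) = 0"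
  shows "(l2norm (lebesgue_on \<Omega>) (\<lambda>x. Im (y x)))\<^sup>2 \<le> \<Gamma> * (l2norm (lebesgue_on \<Omega>) (\<lambda>x. Re (y x)))\<^sup>2"
    and "(l2norm (lebesgue_on \<Omega>) (\<lambda>x. Re (b x)))\<^sup>2 \<le> \<Gamma> * (l2norm (lebesgue_on \<Omega>) (\<lambda>x. Im (y x)))\<^sup>2"
proof -
  let ?M = "lebesgue_on \<Omega>"
  let ?c = "l2norm ?M (\<lambda>x. Im (y x))" and ?d = "l2norm ?M (\<lambda>x. Re (y x))" and ?p = "l2norm ?M (\<lambda>x. Re (b x))"
  have bs: "b \<in> l2 ?M" using b(1) by (simp add: div_curl_orthogonal_def)
  note Y = l2_Re_Im(1,2)[OF y] and B = l2_Re_Im(1,2)[OF bs]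
  have "l2norm ?M (\<lambda>x. Im (b x)) = ?c" unfolding yb(1) by (simp add: l2norm_def)
  with Friedrichs_inequality_orthogonal[OF \<Omega> F b] show p: "?p\<^sup>2 \<le> \<Gamma> * ?c\<^sup>2" by simp
  have "0 = (LINT x|?M. Re (b x) * Re (y x)) - (LINT x|?M. (norm (Im (y x)))\<^sup>2)"
    using yb(2) l2_real_mult[OF B(1) Y(1)] l2D(2)[OF Y(2)]
    by (simp add: inner_complex_def yb(1) power2_eq_square)
  then have "?c\<^sup>2 = (LINT x|?M. Re (b x) * Re (y x))" by (simp add: l2norm_power2)
  then have le: "?c\<^sup>2 \<le> ?p * ?d" using l2_Cauchy_Schwarz[OF B(1) Y(1)] by simp
  have "(?c\<^sup>2)\<^sup>2 \<le> (?p * ?d)\<^sup>2" by (rule power_mono[OF le]) simp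
  also have "\<dots> \<le> (\<Gamma> * ?c\<^sup>2) * ?d\<^sup>2" unfolding power_mult_distrib by (intro mult_right_mono p) simp
  finally have le2: "?c\<^sup>2 * ?c\<^sup>2 \<le> (\<Gamma> * ?d\<^sup>2) * ?c\<^sup>2" by (simp add: power2_eq_square mult.assoc mult.left_commute mult.commute)
  show "?c\<^sup>2 \<le> \<Gamma> * ?d\<^sup>2"
  proof (cases "?c = 0")
    case True
    then show ?thesis using \<Gamma> by simp
  next
    case False
    then have "?c\<^sup>2 > 0" by simp
    then show ?thesis using le2 by (rule mult_right_le_imp_le[rotated])
  qed
qed

lemma Friedrichs_imp_Babuska_Aziz:
  assumes \<Omega>: "open \<Omega>" "bounded \<Omega>" and F: "Friedrichs_admissible \<Omega> \<Gamma>" and \<Gamma>: "0 \<le> \<Gamma>"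
  shows "Babuska_Aziz_admissible \<Omega> (\<Gamma> + 1)"
  unfolding Babuska_Aziz_admissible_def L2_norm_eq_l2norm
proof
  let ?M = "lebesgue_on \<Omega>"
  fix q assume q: "q \<in> L2_mean_zero \<Omega>"
  have qs: "q \<in> l2 ?M" and qm: "(LINT z|?M. q z) = 0"
    using q by (auto simp: L2_mean_zero_def L2_eq_l2)
  have fin: "finite_measure ?M" by (rule finite_measure_bounded_open[OF \<Omega>])
  \<comment> \<open>A square, because \<open>penalized_div_curl\<close> takes t and penalises with
    t^2.\<close>
  define \<tau> where "\<tau> n = (1 / real (Suc n))\<^sup>2" for n
  have \<tau>: "\<tau> n > 0" for n by (simp add: \<tau>_def)
  have "\<forall>n. \<exists>x. x \<in> div_curl_closure \<Omega> \<and> (\<lambda>z. Complex (q z - Re (x z)) (- (\<tau> n * Im (x z)))) \<in> div_curl_orthogonal \<Omega>"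
    unfolding \<tau>_def using penalized_div_curl[OF \<Omega> qs] by (metis of_nat_0_less_iff zero_less_Suc zero_less_divide_1_iff)
  then obtain x where xc: "\<And>n. x n \<in> div_curl_closure \<Omega>"
    and xo: "\<And>n. (\<lambda>z. Complex (q z - Re (x n z)) (- (\<tau> n * Im (x n z)))) \<in> div_curl_orthogonal \<Omega>" by metis
  have xs: "x n \<in> l2 ?M" for n using xc by (simp add: div_curl_closure_def)
  note xRI = l2_Re_Im(1,2)[OF xs]
  have ints: "integrable ?M q" "integrable ?M (\<lambda>z. Re (x n z))" "integrable ?M (\<lambda>z. Im (x n z))" for n
    by (intro l2_imp_integrable[OF fin] qs xRI)+
  \<comment> \<open>After division by \<tau> the imaginary part is -Im x, so b m - b n and x m - x n
    again form a conjugate pair although the weights differ.\<close>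
  define b where "b n z = Complex ((q z - Re (x n z)) / \<tau> n) (- Im (x n z))" for n z
  have bo: "b n \<in> div_curl_orthogonal \<Omega>" for n
  proof -
    have "b n = (\<lambda>z. (1 / \<tau> n) *\<^sub>R Complex (q z - Re (x n z)) (- (\<tau> n * Im (x n z))))"
      using \<tau>[of n] by (auto simp: b_def complex_eq_iff fun_eq_iff)
    then show ?thesis using div_curl_orthogonal_scaleR[OF xo] by simp
  qed
  have bs: "b n \<in> l2 ?M" for n using bo by (simp add: div_curl_orthogonal_def)
  have xmean: "(LINT z|?M. Re (x n z)) = 0" "(LINT z|?M. Im (x n z)) = 0" for n
    by (rule div_curl_closure_mean_zero[OF \<Omega> xc])+
  have bmean: "(LINT z|?M. Re (b n z)) = 0" "(LINT z|?M. Im (b n z)) = 0" for n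
    using ints qm xmean by (simp_all add: b_def)
  have bint: "integrable ?M (\<lambda>z. Re (b n z))" "integrable ?M (\<lambda>z. Im (b n z))" for n
    by (intro l2_imp_integrable[OF fin] l2_Re_Im(1,2)[OF bs])+
  have orth: "(LINT z|?M. b m z \<bullet> x n z) = 0" for m n by (rule div_curl_closure_orthogonal[OF \<Omega>(1) bo xc])
  have Imb: "Im (b n z) = - Im (x n z)" for n z by (simp add: b_def)
  let ?d = "\<lambda>n z. Re (x n z)" and ?c = "\<lambda>n z. Im (x n z)"
  note single = conjugate_estimate[OF \<Omega> F \<Gamma> xs bo bmean Imb orth]
  \<comment> \<open>Testing the residual with x n itself gives \<integral> q d =
    \<parallel>d\<parallel>^2 + \<tau> \<parallel>c\<parallel>^2, with a nonnegative last
    term.\<close>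
  have dle: "l2norm ?M (?d n) \<le> l2norm ?M q" for n
  proof -
    have i: "integrable ?M (\<lambda>z. q z * ?d n z)" "integrable ?M (\<lambda>z. (?d n z)\<^sup>2)" "integrable ?M (\<lambda>z. (?c n z)\<^sup>2)"
      using l2_real_mult[OF qs xRI(1)[of n]] l2D(2)[OF xRI(1)[of n]] l2D(2)[OF xRI(2)[of n]] by simp_all
    have "(LINT z|?M. Complex (q z - Re (x n z)) (- (\<tau> n * Im (x n z))) \<bullet> x n z) = 0"
      by (rule div_curl_closure_orthogonal[OF \<Omega>(1) xo xc])
    moreover have "Complex (q z - Re (x n z)) (- (\<tau> n * Im (x n z))) \<bullet> x n z = q z * ?d n z - (?d n z)\<^sup>2 - \<tau> n * (?c n z)\<^sup>2" for z
      by (simp add: inner_complex_def power2_eq_square algebra_simps)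
    ultimately have "(LINT z|?M. q z * ?d n z) - (l2norm ?M (?d n))\<^sup>2 - \<tau> n * (l2norm ?M (?c n))\<^sup>2 = 0"
      using i by (simp add: l2norm_power2)
    moreover have "\<tau> n * (l2norm ?M (?c n))\<^sup>2 \<ge> 0" using \<tau>[of n] by simp
    moreover have "(LINT z|?M. q z * ?d n z) \<le> l2norm ?M q * l2norm ?M (?d n)"
      using l2_Cauchy_Schwarz[OF qs xRI(1)[of n]] by simp
    ultimately have "l2norm ?M (?d n) * l2norm ?M (?d n) \<le> l2norm ?M q * l2norm ?M (?d n)"
      by (simp add: power2_eq_square)
    then show ?thesis
      using l2norm_nonneg[of ?M "?d n"] by (cases "l2norm ?M (?d n) = 0") (auto simp: mult_le_cancel_right)
  qed
  \<comment> \<open>The residual q - d is \<tau> Re b, and the two parts of \<open>single\<close>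
    together bound \<parallel>Re b\<parallel> by \<Gamma> \<parallel>d\<parallel>.\<close>
  have qd: "l2norm ?M (\<lambda>z. ?d n z - q z) \<le> \<tau> n * (\<Gamma> * l2norm ?M q)" for n
  proof -
    have "(l2norm ?M (\<lambda>z. Re (b n z)))\<^sup>2 \<le> \<Gamma> * (\<Gamma> * (l2norm ?M (?d n))\<^sup>2)"
      using single(2)[of n] mult_left_mono[OF single(1)[of n] \<Gamma>] by linarith
    also have "\<dots> = (\<Gamma> * l2norm ?M (?d n))\<^sup>2" by (simp add: power2_eq_square mult.left_commute mult.assoc)
    finally have "l2norm ?M (\<lambda>z. Re (b n z)) \<le> \<Gamma> * l2norm ?M (?d n)" by (rule power2_le_imp_le) (use \<Gamma> in simp)
    also have "\<dots> \<le> \<Gamma> * l2norm ?M q" by (intro mult_left_mono dle \<Gamma>)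
    finally have *: "l2norm ?M (\<lambda>z. Re (b n z)) \<le> \<Gamma> * l2norm ?M q" .
    have "(\<lambda>z. ?d n z - q z) = (\<lambda>z. (- \<tau> n) *\<^sub>R Re (b n z))" using \<tau>[of n] by (auto simp: b_def)
    then have "l2norm ?M (\<lambda>z. ?d n z - q z) = \<tau> n * l2norm ?M (\<lambda>z. Re (b n z))"
      using \<tau>[of n] by (simp only: l2norm_scaleR abs_minus_cancel abs_of_pos)
    also have "\<dots> \<le> \<tau> n * (\<Gamma> * l2norm ?M q)" using \<tau>[of n] * by (intro mult_left_mono) auto
    finally show ?thesis .
  qed
  have \<tau>0: "\<tau> \<longlonglongrightarrow> 0"
  proof -
    have "(\<lambda>n. (1 / real (Suc n))\<^sup>2) \<longlonglongrightarrow> 0\<^sup>2" by (intro tendsto_power LIMSEQ_Suc[OF lim_1_over_n])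
    then show ?thesis by (simp only: \<tau>_def[abs_def] zero_power2)
  qed
  have qd0: "(\<lambda>n. l2norm ?M (\<lambda>z. ?d n z - q z)) \<longlonglongrightarrow> 0"
    by (rule Lim_null_comparison[OF always_eventually tendsto_mult_left_zero[OF \<tau>0]]) (use qd in auto)
  \<comment> \<open>The real parts converge to \<open>q\<close>, hence are Cauchy; this estimate
    makes the imaginary parts follow. It uses \<open>orth\<close> for all four combinations of m and
    n.\<close>
  have diff: "l2norm ?M (\<lambda>z. x m z - x n z) \<le> sqrt (1 + \<Gamma>) * l2norm ?M (\<lambda>z. ?d m z - ?d n z)" for m n
  proof (rule power2_le_imp_le)
    have y: "(\<lambda>z. x m z - x n z) \<in> l2 ?M" by (intro l2_diff xs)
    have "(LINT z|?M. (b m z - b n z) \<bullet> (x m z - x n z)) = 0"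
      using orth l2_inner[OF bs xs] by (simp add: inner_diff_left inner_diff_right)
    then have "(l2norm ?M (\<lambda>z. Im (x m z - x n z)))\<^sup>2 \<le> \<Gamma> * (l2norm ?M (\<lambda>z. Re (x m z - x n z)))\<^sup>2"
      by (intro conjugate_estimate(1)[OF \<Omega> F \<Gamma> y div_curl_orthogonal_diff[OF \<Omega>(1) bo[of m] bo[of n]]])
        (use bint bmean in \<open>simp_all add: Imb\<close>)
    then show "(l2norm ?M (\<lambda>z. x m z - x n z))\<^sup>2 \<le> (sqrt (1 + \<Gamma>) * l2norm ?M (\<lambda>z. ?d m z - ?d n z))\<^sup>2"
      using l2_Re_Im(3)[OF y] \<Gamma> by (simp add: power_mult_distrib algebra_simps)
  qed (use \<Gamma> in simp)
  have Cauchy: "\<exists>N. \<forall>m\<ge>N. \<forall>n\<ge>N. l2norm ?M (\<lambda>z. x m z - x n z) < \<epsilon>" if \<epsilon>: "\<epsilon> > 0" for \<epsilon>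
  proof -
    have "\<epsilon> / sqrt (1 + \<Gamma>) > 0" using \<epsilon> \<Gamma> by simp
    from l2_convergent_Cauchy[of ?d ?M q, OF xRI(1) qs qd0 this] obtain N where
      N: "\<And>m n. m \<ge> N \<Longrightarrow> n \<ge> N \<Longrightarrow> l2norm ?M (\<lambda>z. ?d m z - ?d n z) < \<epsilon> / sqrt (1 + \<Gamma>)" by blast
    have "l2norm ?M (\<lambda>z. x m z - x n z) < \<epsilon>" if "m \<ge> N" "n \<ge> N" for m n
      using diff[of m n] N[OF that] \<Gamma> by (simp add: field_simps)
    then show ?thesis by blast
  qed
  obtain X where Xs: "X \<in> l2 ?M" and lim: "(\<lambda>n. l2norm ?M (\<lambda>z. x n z - X z)) \<longlonglongrightarrow> 0"
    using l2_complete[of x ?M, OF xs Cauchy] by blast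
  have Xc: "X \<in> div_curl_closure \<Omega>" by (rule div_curl_closure_closed[OF \<Omega>(1) xc Xs lim])
  have "(\<lambda>n. l2norm ?M (\<lambda>z. ?d n z - Re (X z))) \<longlonglongrightarrow> 0"
    by (rule Lim_null_comparison[OF always_eventually lim])
      (use l2norm_Re_le[OF l2_diff[OF xs Xs]] in simp)
  then have ae: "AE z in ?M. Re (X z) = q z"
    by (rule l2_limit_unique[of ?d, OF xRI(1) l2_Re_Im(1)[OF Xs] qs _ qd0])
  have "(l2norm ?M (x n))\<^sup>2 \<le> (\<Gamma> + 1) * (l2norm ?M q)\<^sup>2" for n
  proof -
    have "(l2norm ?M (x n))\<^sup>2 \<le> (\<Gamma> + 1) * (l2norm ?M (?d n))\<^sup>2"
      using l2_Re_Im(3)[OF xs[of n]] single(1)[of n] by (simp add: algebra_simps)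
    also have "\<dots> \<le> (\<Gamma> + 1) * (l2norm ?M q)\<^sup>2" using \<Gamma> dle[of n] by (intro mult_left_mono power_mono) auto
    finally show ?thesis .
  qed
  then have Xn: "(l2norm ?M X)\<^sup>2 \<le> (\<Gamma> + 1) * (l2norm ?M q)\<^sup>2"
    by (intro LIMSEQ_le_const2[OF tendsto_power[OF l2_tendsto_norm[OF xs Xs lim]]]) auto
  obtain u where u: "u \<in> H1_0 \<Omega> \<times> H1_0 \<Omega>" "AE z in ?M. weak_div \<Omega> u z = Re (X z)" "(H1_seminorm \<Omega> u)\<^sup>2 = (l2norm ?M X)\<^sup>2"
    using div_curl_closure_H1_0[OF \<Omega> Xc] by blast
  have "AE z in ?M. weak_div \<Omega> u z = q z" using u(2) ae by eventually_elim simp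
  moreover have "(H1_seminorm \<Omega> u)\<^sup>2 \<le> (\<Gamma> + 1) * (l2norm ?M q)\<^sup>2" using u(3) Xn by simp
  ultimately show "\<exists>u\<in>H1_0 \<Omega> \<times> H1_0 \<Omega>. (AE z in ?M. weak_div \<Omega> u z = q z) \<and> (H1_seminorm \<Omega> u)\<^sup>2 \<le> (\<Gamma> + 1) * (l2norm ?M q)\<^sup>2"
    using u(1) by blast
qed

text \<open>The empty set is included, with both sides infinite; this is the case without any finite
  admissible constant.\<close>

lemma Inf_ennreal_add_1: "Inf ((\<lambda>a. a + 1) ` A) = Inf A + (1::ennreal)"
proof (rule antisym)
  have "Inf ((\<lambda>a. a + 1) ` A) - 1 \<le> Inf A"
  proof (rule Inf_greatest)
    fix a assume "a \<in> A"
    then have "Inf ((\<lambda>a. a + 1) ` A) \<le> a + 1" by (intro Inf_lower) auto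
    then show "Inf ((\<lambda>a. a + 1) ` A) - 1 \<le> a" by (simp add: ennreal_minus_le_iff add.commute)
  qed
  then show "Inf ((\<lambda>a. a + 1) ` A) \<le> Inf A + 1" by (simp add: ennreal_minus_le_iff add.commute)
  show "Inf A + 1 \<le> Inf ((\<lambda>a. a + 1) ` A)"
    by (rule Inf_greatest) (auto intro: add_right_mono Inf_lower)
qed

theorem theorem2p1:
  fixes \<Omega> :: "complex set"
  assumes "bounded_domain \<Omega>"
  shows "(Babuska_Aziz_const \<Omega> < \<infinity> \<longleftrightarrow> Friedrichs_const \<Omega> < \<infinity>) \<and>
         Babuska_Aziz_const \<Omega> = Friedrichs_const \<Omega> + 1"
proof -
  have \<Omega>: "open \<Omega>" "bounded \<Omega>" using assms by (auto simp: bounded_domain_def)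
  \<comment> \<open>Already the sets of admissible numbers are translates of each other by 1, so
    attainment of the infima is not at issue. The bound 1 \<le> C makes C - 1 an admissible
    nonnegative number.\<close>
  have "{C. 0 \<le> C \<and> Babuska_Aziz_admissible \<Omega> C} = (\<lambda>\<Gamma>. \<Gamma> + 1) ` {\<Gamma>. 0 \<le> \<Gamma> \<and> Friedrichs_admissible \<Omega> \<Gamma>}"
  proof (intro equalityI subsetI)
    fix C assume "C \<in> {C. 0 \<le> C \<and> Babuska_Aziz_admissible \<Omega> C}"
    then have "1 \<le> C" "Friedrichs_admissible \<Omega> (C - 1)" using Babuska_Aziz_imp_Friedrichs[OF assms] by auto
    then show "C \<in> (\<lambda>\<Gamma>. \<Gamma> + 1) ` {\<Gamma>. 0 \<le> \<Gamma> \<and> Friedrichs_admissible \<Omega> \<Gamma>}"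
      by (intro image_eqI[of _ _ "C - 1"]) auto
  next
    fix C assume "C \<in> (\<lambda>\<Gamma>. \<Gamma> + 1) ` {\<Gamma>. 0 \<le> \<Gamma> \<and> Friedrichs_admissible \<Omega> \<Gamma>}"
    then show "C \<in> {C. 0 \<le> C \<and> Babuska_Aziz_admissible \<Omega> C}"
      using Friedrichs_imp_Babuska_Aziz[OF \<Omega>] by auto
  qed
  then have "ennreal ` {C. 0 \<le> C \<and> Babuska_Aziz_admissible \<Omega> C}
      = (\<lambda>a. a + 1) ` ennreal ` {\<Gamma>. 0 \<le> \<Gamma> \<and> Friedrichs_admissible \<Omega> \<Gamma>}"
    by (simp add: image_image ennreal_plus cong: image_cong_simp)
  then have eq: "Babuska_Aziz_const \<Omega> = Friedrichs_const \<Omega> + 1"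
    unfolding Babuska_Aziz_const_def Friedrichs_const_def by (simp only: Inf_ennreal_add_1)
  then show ?thesis by (simp add: ennreal_add_eq_top less_top)
qed

end
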